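(* Let $(X,L)$ be a polarised variety with homogeneous coordinate ring $R=\bigoplus_{k\ge0}H^0(X,L^{\otimes k})$, let $\chi$ be a possibly non-finitely generated filtration of $R$, and let $\bar\chi$ be its specialisation with respect to a complex torus $T\subset\mathrm{Aut}(X,L)$. Then $$\mathrm{Chow}_\infty(\bar\chi)\le\mathrm{Chow}_\infty(\chi).$$
   Context: A polarised variety $(X,L)$ is a complex projective variety $X$ with a very ample and projectively normal line bundle $L$ (so $R$ is generated in degree 1); $n=\dim X$, $R_k=H^0(X,L^{\otimes k})$. $\mathrm{Aut}(X,L)$ is the group of automorphisms of $X$ together with a lift to $L$; it acts on $R$. A filtration $\chi$ of $R$ is a sequence of vector subspaces $H^0(X,\mathcal O)=F_0R\subset F_1R\subset\cdots$ of $R$ which is exhaustive (for every $k$ there is $j$ with $F_jR_k=R_k$, where $F_jR_k=F_jR\cap R_k$), multiplicative ($(F_iR_l)(F_jR_m)\subset F_{i+j}R_{l+m}$) and homogeneous (if $f\in F_iR$ then each homogeneous component of $f$ is in $F_iR$). Its Rees algebra is $\bigoplus_{i\ge0}(F_iR)t^i\subset R[t]$; $\chi$ is finitely generated if the Rees algebra is a finitely generated algebra. Specialisation. Let $\lambda:\mathbb C^*\to T$ be a generic one-parameter subgroup (generic in the sense that the limit subspaces $\lim_{\tau\to0}\lambda(\tau)\cdot F_iR_k$ are $T$-invariant; the choice of $\lambda$ is suppressed in the notation). The specialisation $\bar\chi$ of $\chi$ with respect to $T$ is the filtration with $\bar F_iR_k=\lim_{\tau\to0}\lambda(\tau)\cdot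 F_iR_k$, the limit being taken in the Grassmannian of subspaces of $R_k$. (This is again a filtration of $R$, i.e. an increasing sequence of vector subspaces starting with $\bar F_0R=H^0(X,\mathcal O)$ which is exhaustive, multiplicative and homogeneous.) Weights. Put $\mathrm{gr}_iR_k=F_iR_k/F_{i-1}R_k$, $w(k)=\sum_i(-i)\dim\mathrm{gr}_iR_k$, $h(k)=\dim R_k$. For a finitely generated filtration of the form $\chi^{(r)}$ (the approximations defined in the next paragraph) one has, for all large $k$ divisible by $r$, $h(k)=a_0k^n+a_1k^{n-1}+\cdots$ and $w(k)=b_0k^{n+1}+b_1k^n+\cdots$, and the $r$-th Chow weight is $$\mathrm{Chow}_r=r\frac{b_0}{a_0}-\frac{w(r)}{h(r)}.$$ Approximations. For a filtration $\chi$ and $r\ge1$, let $N$ be the smallest integer with $F_NR_r=R_r$, and let $A\subset R[t]$ be the $\mathbb C[t]$-subalgebra generated by $H^0(X,L)t^N\oplus\bigoplus_{i=1}^N F_iH^0(X,L^{\otimes r})t^i$. Then $\chi^{(r)}$ is the finitely generated filtration whose $i$-th piece is $\{s\in R: t^is\in A\}$. The asymptotic Chow weight of $\chi$ is $\mathrm{Chow}_\infty(\chi)=\liminf_{r\to\infty}\mathrm{Chow}_r(\chi^{(r)})$. *)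

theory Defs
  imports
    "HOL-Analysis.Analysis"
    "HOL-Library.Function_Algebras"
    "HOL-Computational_Algebra.Polynomial"
begin

text \<open>
  A polarised variety \<open>(X, L)\<close> with \<open>L\<close> very ample and projectively normal is given by its
  embedding in projective space by the complete linear system of \<open>L\<close>, so \<open>L\<close> is the restriction
  of the hyperplane bundle. The set \<open>X\<close> below is always the affine cone over the variety with
  the origin removed. Equivalently, it is the total space of the inverse of \<open>L\<close> minus the zero
  section, so sections of \<open>L\<close> to the power \<open>k\<close> are functions on it that are homogeneous of
  degree \<open>k\<close>, and automorphisms of the pair are its automorphisms commuting with scalars.
\<close>

type_synonym 'n sect = "complex^'n \<Rightarrow> complex"

section \<open>Polynomial and regular functions\<close>

text \<open>The algebra of functions generated by a set \<open>C\<close> of coordinate functions. As the ground field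
  is infinite, polynomials and polynomial functions are the same thing.\<close>

inductive_set poly_funs :: "('a \<Rightarrow> complex) set \<Rightarrow> ('a \<Rightarrow> complex) set"
  for C :: "('a \<Rightarrow> complex) set" where
  const: "(\<lambda>_. c) \<in> poly_funs C"
| coord: "f \<in> C \<Longrightarrow> f \<in> poly_funs C"
| add: "f \<in> poly_funs C \<Longrightarrow> g \<in> poly_funs C \<Longrightarrow> (\<lambda>x. f x + g x) \<in> poly_funs C"
| mult: "f \<in> poly_funs C \<Longrightarrow> g \<in> poly_funs C \<Longrightarrow> (\<lambda>x. f x * g x) \<in> poly_funs C"

definition regular_on :: "('a \<Rightarrow> complex) set \<Rightarrow> 'a set \<Rightarrow> ('a \<Rightarrow> complex) \<Rightarrow> bool" where
  "regular_on C S f \<longleftrightarrow>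
     (\<forall>x\<in>S. \<exists>p\<in>poly_funs C. \<exists>q\<in>poly_funs C.
        q x \<noteq> 0 \<and> (\<forall>y\<in>S. q y \<noteq> 0 \<longrightarrow> f y = p y / q y))"

definition hom_polys :: "nat \<Rightarrow> ('n::finite) sect set" where
  "hom_polys k =
     {p \<in> poly_funs (range (\<lambda>i v. v $ i)). \<forall>c v. p (c *s v) = c ^ k * p v}"

section \<open>Projective varieties and their coordinate rings\<close>

definition proj_closed :: "(complex^'n::finite) set \<Rightarrow> bool" where
  "proj_closed Z \<longleftrightarrow>
     (\<exists>S \<subseteq> (\<Union>k. hom_polys k). Z = {v. v \<noteq> 0 \<and> (\<forall>p\<in>S. p v = 0)})"

definition projective_variety :: "(complex^'n::finite) set \<Rightarrow> bool" where
  "projective_variety X \<longleftrightarrow>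
     proj_closed X \<and> X \<noteq> {} \<and>
     (\<forall>Y Z. proj_closed Y \<longrightarrow> proj_closed Z \<longrightarrow> X \<subseteq> Y \<union> Z \<longrightarrow> X \<subseteq> Y \<or> X \<subseteq> Z)"

text \<open>Global sections of the \<open>k\<close>-th power of \<open>L\<close>: locally a quotient of homogeneous polynomials
  whose degrees differ by \<open>k\<close>. Functions are extended by zero outside \<open>X\<close>.\<close>

definition sections :: "(complex^'n::finite) set \<Rightarrow> nat \<Rightarrow> 'n sect set" where
  "sections X k =
     {f. (\<forall>v. v \<notin> X \<longrightarrow> f v = 0) \<and>
         (\<forall>v\<in>X. \<exists>d. \<exists>p\<in>hom_polys (d + k). \<exists>q\<in>hom_polys d.
            q v \<noteq> 0 \<and> (\<forall>u\<in>X. q u \<noteq> 0 \<longrightarrow> f u = p u / q u))}"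

definition projectively_normal :: "(complex^'n::finite) set \<Rightarrow> bool" where
  "projectively_normal X \<longleftrightarrow>
     (\<forall>k. \<forall>f\<in>sections X k. \<exists>p\<in>hom_polys k. \<forall>v\<in>X. f v = p v)"

definition polarised_variety :: "(complex^'n::finite) set \<Rightarrow> bool" where
  "polarised_variety X \<longleftrightarrow> projective_variety X \<and> projectively_normal X"

definition fscale :: "complex \<Rightarrow> ('a \<Rightarrow> complex) \<Rightarrow> ('a \<Rightarrow> complex)" where
  "fscale c f = (\<lambda>x. c * f x)"

global_interpretation fun_space: vector_space fscale
  by standard (auto simp: fscale_def algebra_simps fun_eq_iff)

text \<open>The direct sum of the spaces of sections is realised inside the functions on the cone:
  nonzero functions of different degrees of homogeneity are linearly independent.\<close>

definition coord_ring :: "(complex^'n::finite) set \<Rightarrow> 'n sect set" where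
  "coord_ring X = fun_space.span (\<Union>k. sections X k)"

text \<open>The dimension of the projective variety (not of its cone), as the transcendence degree of its
  function field, whose elements are quotients of homogeneous polynomials of equal degree.\<close>

definition alg_indep_on ::
  "(complex^'n::finite) set \<Rightarrow> nat \<Rightarrow> (nat \<Rightarrow> 'n sect) \<Rightarrow> (nat \<Rightarrow> 'n sect) \<Rightarrow> bool" where
  "alg_indep_on X m p q \<longleftrightarrow>
     (\<forall>G \<in> poly_funs ((\<lambda>j s. s j) ` {..<m}).
        (\<forall>v\<in>X. (\<forall>j<m. q j v \<noteq> 0) \<longrightarrow> G (\<lambda>j. p j v / q j v) = 0) \<longrightarrow> G = (\<lambda>_. 0))"

definition variety_dim :: "(complex^'n::finite) set \<Rightarrow> nat" where
  "variety_dim X =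
     (GREATEST m. \<exists>p q. (\<forall>j<m. (\<exists>e. p j \<in> hom_polys e \<and> q j \<in> hom_polys e) \<and>
                               (\<exists>v\<in>X. q j v \<noteq> 0)) \<and>
                        alg_indep_on X m p q)"

section \<open>Filtrations\<close>

definition filtration ::
  "(complex^'n::finite) set \<Rightarrow> (nat \<Rightarrow> 'n sect set) \<Rightarrow> bool" where
  "filtration X F \<longleftrightarrow>
     F 0 = sections X 0 \<and>
     (\<forall>i. fun_space.subspace (F i) \<and> F i \<subseteq> coord_ring X \<and> F i \<subseteq> F (Suc i)) \<and>
     (\<forall>k. \<exists>j. F j \<inter> sections X k = sections X k) \<and>
     (\<forall>i j l m. \<forall>f \<in> F i \<inter> sections X l. \<forall>g \<in> F j \<inter> sections X m.
        f * g \<in> F (i + j) \<inter> sections X (l + m)) \<and>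
     (\<forall>i K g. finite K \<longrightarrow> (\<forall>k\<in>K. g k \<in> sections X k) \<longrightarrow> (\<Sum>k\<in>K. g k) \<in> F i \<longrightarrow>
        (\<forall>k\<in>K. g k \<in> F i))"

section \<open>Torus actions and specialisation\<close>

definition automorphism_with_lift ::
  "(complex^'n::finite) set \<Rightarrow> (complex^'n \<Rightarrow> complex^'n) \<Rightarrow> bool" where
  "automorphism_with_lift X g \<longleftrightarrow>
     bij_betw g X X \<and>
     (\<forall>v\<in>X. \<forall>c. c \<noteq> 0 \<longrightarrow> g (c *s v) = c *s g v) \<and>
     (\<forall>i. (\<lambda>v. if v \<in> X then g v $ i else 0) \<in> sections X 1) \<and>
     (\<forall>i. (\<lambda>v. if v \<in> X then inv_into X g v $ i else 0) \<in> sections X 1)"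

definition act ::
  "(complex^'n::finite) set \<Rightarrow> (complex^'n \<Rightarrow> complex^'n) \<Rightarrow> 'n sect \<Rightarrow> 'n sect" where
  "act X g f = (\<lambda>v. if v \<in> X then f (inv_into X g v) else 0)"

text \<open>The torus of rank \<open>d\<close>; coordinates with index at least \<open>d\<close> are padded by 1.\<close>

definition torus :: "nat \<Rightarrow> (nat \<Rightarrow> complex) set" where
  "torus d = {s. (\<forall>j<d. s j \<noteq> 0) \<and> (\<forall>j\<ge>d. s j = 1)}"

definition torus_in_Aut ::
  "(complex^'n::finite) set \<Rightarrow> nat \<Rightarrow> ((nat \<Rightarrow> complex) \<Rightarrow> complex^'n \<Rightarrow> complex^'n) \<Rightarrow> bool" where
  "torus_in_Aut X d \<rho> \<longleftrightarrow>
     (\<forall>s\<in>torus d. automorphism_with_lift X (\<rho> s)) \<and>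
     (\<forall>s\<in>torus d. \<forall>s'\<in>torus d. \<forall>v\<in>X. \<rho> (s * s') v = \<rho> s (\<rho> s' v)) \<and>
     (\<forall>s\<in>torus d. (\<forall>v\<in>X. \<rho> s v = v) \<longrightarrow> s = 1) \<and>
     (\<forall>i. regular_on ((\<lambda>j (s, v). s j) ` {..<d} \<union> range (\<lambda>l (s, v). v $ l))
            (torus d \<times> X) (\<lambda>(s, v). \<rho> s v $ i))"

definition one_parameter_subgroup :: "nat \<Rightarrow> (complex \<Rightarrow> nat \<Rightarrow> complex) \<Rightarrow> bool" where
  "one_parameter_subgroup d \<gamma> \<longleftrightarrow>
     (\<forall>\<tau>. \<tau> \<noteq> 0 \<longrightarrow> \<gamma> \<tau> \<in> torus d) \<and>
     (\<forall>\<tau> \<sigma>. \<tau> \<noteq> 0 \<longrightarrow> \<sigma> \<noteq> 0 \<longrightarrow> \<gamma> (\<tau> * \<sigma>) = \<gamma> \<tau> * \<gamma> \<sigma>) \<and>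
     (\<forall>j<d. regular_on {\<lambda>\<tau>. \<tau>} (- {0}) (\<lambda>\<tau>. \<gamma> \<tau> j))"

definition is_frame :: "nat \<Rightarrow> (nat \<Rightarrow> 'a \<Rightarrow> complex) \<Rightarrow> ('a \<Rightarrow> complex) set \<Rightarrow> bool" where
  "is_frame m b W \<longleftrightarrow>
     inj_on b {..<m} \<and> fun_space.independent (b ` {..<m}) \<and> fun_space.span (b ` {..<m}) = W"

text \<open>The Grassmannian is the quotient of the space of linearly independent \<open>m\<close>-tuples by the
  general linear group, and this quotient map has local sections. So convergence of subspaces
  is convergence of suitable bases. On a finite-dimensional space of functions the vector space
  topology is that of pointwise convergence.\<close>

definition grassmann_limit ::
  "(complex \<Rightarrow> ('a \<Rightarrow> complex) set) \<Rightarrow> ('a \<Rightarrow> complex) set \<Rightarrow> bool" where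
  "grassmann_limit W W\<^sub>0 \<longleftrightarrow>
     (\<exists>m b b\<^sub>0. is_frame m b\<^sub>0 W\<^sub>0 \<and>
        (\<forall>\<^sub>F \<tau> in at 0. is_frame m (b \<tau>) (W \<tau>)) \<and>
        (\<forall>j<m. \<forall>x. ((\<lambda>\<tau>. b \<tau> j x) \<longlongrightarrow> b\<^sub>0 j x) (at 0)))"

text \<open>A homogeneous filtration is determined by its graded pieces, so at most one \<open>Fbar\<close> satisfies
  this for given \<open>\<gamma>\<close>. The last conjunct says that \<open>\<gamma>\<close> is generic.\<close>

definition is_specialisation ::
  "(complex^'n::finite) set \<Rightarrow> nat \<Rightarrow> ((nat \<Rightarrow> complex) \<Rightarrow> complex^'n \<Rightarrow> complex^'n) \<Rightarrow>
   (complex \<Rightarrow> nat \<Rightarrow> complex) \<Rightarrow> (nat \<Rightarrow> 'n sect set) \<Rightarrow> (nat \<Rightarrow> 'n sect set) \<Rightarrow> bool" where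
  "is_specialisation X d \<rho> \<gamma> F Fbar \<longleftrightarrow>
     filtration X Fbar \<and>
     (\<forall>i k. grassmann_limit (\<lambda>\<tau>. act X (\<rho> (\<gamma> \<tau>)) ` (F i \<inter> sections X k))
              (Fbar i \<inter> sections X k)) \<and>
     (\<forall>i k. \<forall>s\<in>torus d.
        act X (\<rho> s) ` (Fbar i \<inter> sections X k) = Fbar i \<inter> sections X k)"

section \<open>Weights\<close>

definition gr_dim ::
  "(complex^'n::finite) set \<Rightarrow> (nat \<Rightarrow> 'n sect set) \<Rightarrow> nat \<Rightarrow> nat \<Rightarrow> nat" where
  "gr_dim X F i k =
     (case i of 0 \<Rightarrow> fun_space.dim (F 0 \<inter> sections X k)
      | Suc j \<Rightarrow> fun_space.dim (F (Suc j) \<inter> sections X k) - fun_space.dim (F j \<inter> sections X k))"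

definition hilb :: "(complex^'n::finite) set \<Rightarrow> nat \<Rightarrow> nat" where
  "hilb X k = fun_space.dim (sections X k)"

definition weight :: "(complex^'n::finite) set \<Rightarrow> (nat \<Rightarrow> 'n sect set) \<Rightarrow> nat \<Rightarrow> int" where
  "weight X F k = (\<Sum>i | gr_dim X F i k \<noteq> 0. - int i * int (gr_dim X F i k))"

text \<open>The expansion of \<open>g\<close> at large multiples of \<open>r\<close>. It is unique for positive \<open>r\<close>, and it exists
  for the Hilbert and weight functions of the approximations defined below.\<close>

definition eventual_poly :: "nat \<Rightarrow> (nat \<Rightarrow> real) \<Rightarrow> real poly" where
  "eventual_poly r g =
     (THE P. \<forall>\<^sub>F k in sequentially. r dvd k \<longrightarrow> g k = poly P (real k))"

definition chow_weight ::
  "(complex^'n::finite) set \<Rightarrow> (nat \<Rightarrow> 'n sect set) \<Rightarrow> nat \<Rightarrow> real" where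
  "chow_weight X F r =
     (let n = variety_dim X;
          a\<^sub>0 = coeff (eventual_poly r (\<lambda>k. real (hilb X k))) n;
          b\<^sub>0 = coeff (eventual_poly r (\<lambda>k. real_of_int (weight X F k))) (n + 1)
      in real r * (b\<^sub>0 / a\<^sub>0) - real_of_int (weight X F r) / real (hilb X r))"

section \<open>Finitely generated approximations\<close>

text \<open>In the ring of polynomials in \<open>t\<close> over the functions, \<open>monom f j\<close> is \<open>f\<close> times the \<open>j\<close>-th
  power of \<open>t\<close>. The scalars are the constant functions on \<open>X\<close>, extended by zero.\<close>

inductive_set Ct_subalgebra ::
  "(complex^'n::finite) set \<Rightarrow> 'n sect poly set \<Rightarrow> 'n sect poly set"
  for X :: "(complex^'n::finite) set" and G :: "'n sect poly set" where
  scalar: "monom (\<lambda>v. if v \<in> X then c else 0) j \<in> Ct_subalgebra X G"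
| gen: "p \<in> G \<Longrightarrow> p \<in> Ct_subalgebra X G"
| add: "p \<in> Ct_subalgebra X G \<Longrightarrow> q \<in> Ct_subalgebra X G \<Longrightarrow> p + q \<in> Ct_subalgebra X G"
| mult: "p \<in> Ct_subalgebra X G \<Longrightarrow> q \<in> Ct_subalgebra X G \<Longrightarrow> p * q \<in> Ct_subalgebra X G"

definition approx_algebra ::
  "(complex^'n::finite) set \<Rightarrow> (nat \<Rightarrow> 'n sect set) \<Rightarrow> nat \<Rightarrow> 'n sect poly set" where
  "approx_algebra X F r =
     (let N = (LEAST N. F N \<inter> sections X r = sections X r)
      in Ct_subalgebra X
           ((\<lambda>f. monom f N) ` sections X 1 \<union>
            (\<Union>i\<in>{1..N}. (\<lambda>f. monom f i) ` (F i \<inter> sections X r))))"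

definition approx ::
  "(complex^'n::finite) set \<Rightarrow> (nat \<Rightarrow> 'n sect set) \<Rightarrow> nat \<Rightarrow> nat \<Rightarrow> 'n sect set" where
  "approx X F r i = {s \<in> coord_ring X. monom s i \<in> approx_algebra X F r}"

definition chow_infinity ::
  "(complex^'n::finite) set \<Rightarrow> (nat \<Rightarrow> 'n sect set) \<Rightarrow> ereal" where
  "chow_infinity X F = liminf (\<lambda>r. ereal (chow_weight X (approx X F r) r))"

end

theory Submission
  imports Defs "HOL-Library.List_Lexorder"
begin

text \<open>
  The inequality already holds for the \<open>r\<close>-th Chow weights of the two approximations, for every
  \<open>r \<ge> 1\<close>. In degree \<open>r\<close> an approximation has the same pieces as the filtration it
  approximates, and a limit in the Grassmannian has the same dimension as the subspaces that
  converge to it; so the term \<open>w(r) / h(r)\<close> is the same on both sides. In degree \<open>r m\<close> the pieces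
  of an approximation are spanned by products of \<open>m\<close> elements of degree \<open>r\<close>. A product of limits is
  a limit of products, and vectors close to linearly independent ones are independent. So the pieces
  belonging to the limit filtration are at most as large as those belonging to the original one
  (\<open>dim_approx_limit_le\<close>). Since \<open>w(k)\<close> is minus the sum over \<open>i\<close> of \<open>h(k) - dim F\<^sub>i R\<^sub>k\<close>, specialising
  can only decrease \<open>w(r m)\<close>, and the same inequality follows for the leading coefficients
  (\<open>chow_weight_limit_le\<close>).

  For the last step the weights have to be polynomials of degree at most \<open>n + 1\<close> for large \<open>m\<close>,
  and \<open>h(r m)\<close> a polynomial of degree at most \<open>n\<close>, where \<open>n\<close> is the transcendence degree of the
  function field. Both facts are read off from monomials. Choose generators of \<open>R\<^sub>r\<close> compatible with
  the filtration, order the monomials in them by weight and then lexicographically, and call a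
  monomial standard if it is not a combination of smaller monomials of its degree. The standard
  monomials of degree \<open>m\<close> and weight at most \<open>i\<close> give a basis of the piece \<open>i\<close> in degree \<open>r m\<close>, so
  \<open>h(r m)\<close> is the number of standard monomials of degree \<open>m\<close> and \<open>- w(r m)\<close> is the sum of their
  weights. The exponents of standard monomials form an order ideal, and for order ideals such sums
  are eventually polynomial because of Dickson's lemma (\<open>eventually_poly_order_ideal\<close>). The growth
  of an order ideal is governed by the largest coordinate subspace that it contains
  (\<open>order_ideal_growth\<close>). A coordinate subspace of dimension \<open>\<delta> + 1\<close> consisting of standard monomials
  yields \<open>\<delta>\<close> algebraically independent rational functions
  (\<open>independent_ratios_of_coordinate_subspace\<close>), whence \<open>\<delta> \<le> n\<close>; conversely, the growth of the
  Hilbert function bounds the number of algebraically independent rational functions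
  (\<open>independent_ratios_le\<close>), so that the dimension is a maximum.
\<close>

section \<open>Eventually polynomial functions\<close>

definition eventually_poly :: "(nat \<Rightarrow> real) \<Rightarrow> bool" where
  "eventually_poly g \<longleftrightarrow> (\<exists>P. \<forall>\<^sub>F m in sequentially. g m = poly P (real m))"

lemma eventually_poly_poly: "eventually_poly (\<lambda>m. poly P (real m))"
  unfolding eventually_poly_def by (intro exI[of _ P]) simp

lemma eventually_poly_const: "eventually_poly (\<lambda>m. c)"
  using eventually_poly_poly[of "[:c:]"] by simp

lemma eventually_poly_ident: "eventually_poly (\<lambda>m. real m)"
  using eventually_poly_poly[of "[:0, 1:]"] by simp

lemma eventually_poly_cong:
  assumes "eventually_poly g" "\<forall>\<^sub>F m in sequentially. f m = g m"
  shows "eventually_poly f"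
proof -
  obtain P where "\<forall>\<^sub>F m in sequentially. g m = poly P (real m)"
    using assms(1) unfolding eventually_poly_def by blast
  with assms(2) have "\<forall>\<^sub>F m in sequentially. f m = poly P (real m)"
    by eventually_elim simp
  then show ?thesis unfolding eventually_poly_def by blast
qed

lemma eventually_poly_add:
  assumes "eventually_poly f" "eventually_poly g"
  shows "eventually_poly (\<lambda>m. f m + g m)"
proof -
  obtain P Q where "\<forall>\<^sub>F m in sequentially. f m = poly P (real m)"
    "\<forall>\<^sub>F m in sequentially. g m = poly Q (real m)"
    using assms unfolding eventually_poly_def by blast
  then have "\<forall>\<^sub>F m in sequentially. f m + g m = poly (P + Q) (real m)"
    by eventually_elim simp
  then show ?thesis unfolding eventually_poly_def by blast
qed

lemma eventually_poly_mult:
  assumes "eventually_poly f" "eventually_poly g"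
  shows "eventually_poly (\<lambda>m. f m * g m)"
proof -
  obtain P Q where "\<forall>\<^sub>F m in sequentially. f m = poly P (real m)"
    "\<forall>\<^sub>F m in sequentially. g m = poly Q (real m)"
    using assms unfolding eventually_poly_def by blast
  then have "\<forall>\<^sub>F m in sequentially. f m * g m = poly (P * Q) (real m)"
    by eventually_elim simp
  then show ?thesis unfolding eventually_poly_def by blast
qed

lemma eventually_poly_sum:
  assumes "\<And>i. i \<in> I \<Longrightarrow> eventually_poly (f i)"
  shows "eventually_poly (\<lambda>m. \<Sum>i\<in>I. f i m)"
  using assms
  by (induction I rule: infinite_finite_induct)
     (auto intro: eventually_poly_const eventually_poly_add)

lemma eventually_poly_shift:
  assumes "eventually_poly g"
  shows "eventually_poly (\<lambda>m. g (m - j))"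
proof -
  obtain P where P: "\<forall>\<^sub>F m in sequentially. g m = poly P (real m)"
    using assms unfolding eventually_poly_def by blast
  have "filterlim (\<lambda>m. m - j) sequentially sequentially"
    by (rule filterlim_minus_const_nat_at_top)
  from filterlim_iff[THEN iffD1, OF this, rule_format, OF P]
  have "\<forall>\<^sub>F m in sequentially. g (m - j) = poly P (real (m - j))" .
  moreover have "\<forall>\<^sub>F m in sequentially. m \<ge> j" by (rule eventually_ge_at_top)
  ultimately have "\<forall>\<^sub>F m in sequentially. g (m - j) = poly (pcompose P [:- real j, 1:]) (real m)"
    by eventually_elim (simp add: poly_pcompose of_nat_diff)
  then show ?thesis unfolding eventually_poly_def by blast
qed

text \<open>Summing \<open>(j + 1) ^ (d + 1) - j ^ (d + 1)\<close> over \<open>j\<close> telescopes; its binomial expansion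
  expresses the sum of \<open>d\<close>-th powers by sums of lower powers.\<close>

lemma power_sum_is_poly: "\<exists>Q. \<forall>m. (\<Sum>j\<le>m. real j ^ d) = poly Q (real m)"
proof (induction d rule: less_induct)
  case (less d)
  define Q where "Q i = (SOME Q. \<forall>m. (\<Sum>j\<le>m. real j ^ i) = poly Q (real m))" for i
  have Q: "(\<Sum>j\<le>m. real j ^ i) = poly (Q i) (real m)" if "i < d" for i m
    using someI_ex[OF less.IH[OF that]] unfolding Q_def by blast
  \<comment> \<open>Solve the telescoping identity for the sum of the \<open>d\<close>-th powers.\<close>
  define R :: "real poly" where
    "R = smult (1 / real (Suc d))
           ([:1, 1:] ^ Suc d - (\<Sum>i<d. smult (real (Suc d choose i)) (Q i)))"
  have "(\<Sum>j\<le>m. real j ^ d) = poly R (real m)" for m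
  proof -
    have "real (Suc m) ^ Suc d = (\<Sum>j\<le>m. real (Suc j) ^ Suc d - real j ^ Suc d)"
      by (induction m) auto
    also have "\<dots> = (\<Sum>j\<le>m. \<Sum>i\<le>d. real (Suc d choose i) * real j ^ i)"
    proof (rule sum.cong)
      fix j
      have "real (Suc j) ^ Suc d = (real j + 1) ^ Suc d" by (simp add: add.commute)
      also have "\<dots> = (\<Sum>i\<le>Suc d. real (Suc d choose i) * real j ^ i)"
        by (subst binomial_ring) simp
      finally show "real (Suc j) ^ Suc d - real j ^ Suc d
          = (\<Sum>i\<le>d. real (Suc d choose i) * real j ^ i)"
        by (simp only: sum.atMost_Suc) simp
    qed simp
    also have "\<dots> = (\<Sum>i\<le>d. real (Suc d choose i) * (\<Sum>j\<le>m. real j ^ i))"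
      by (subst sum.swap) (simp add: sum_distrib_left)
    also have "\<dots> = (\<Sum>i<d. real (Suc d choose i) * poly (Q i) (real m))
        + real (Suc d) * (\<Sum>j\<le>m. real j ^ d)"
      using Q by (simp add: lessThan_Suc_atMost[symmetric])
    finally have "real (Suc d) * (\<Sum>j\<le>m. real j ^ d)
        = real (Suc m) ^ Suc d - (\<Sum>i<d. real (Suc d choose i) * poly (Q i) (real m))"
      by simp
    then show ?thesis
      by (simp add: R_def poly_sum field_simps)
  qed
  then show ?case by blast
qed

lemma poly_sum_is_poly: "\<exists>Q. \<forall>m. (\<Sum>j\<le>m. poly P (real j)) = poly Q (real m)"
proof -
  obtain Q where Q: "\<And>d m. (\<Sum>j\<le>m. real j ^ d) = poly (Q d) (real m)"
    using power_sum_is_poly by metis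
  have "(\<Sum>j\<le>m. poly P (real j)) = poly (\<Sum>i\<le>degree P. smult (coeff P i) (Q i)) (real m)" for m
    unfolding poly_altdef[of P]
    by (subst sum.swap) (simp add: poly_sum sum_distrib_left[symmetric] Q)
  then show ?thesis by blast
qed

lemma eventually_poly_partial_sums:
  assumes "eventually_poly g"
  shows "eventually_poly (\<lambda>m. \<Sum>j\<le>m. g j)"
proof -
  obtain P K where P: "\<And>m. m \<ge> K \<Longrightarrow> g m = poly P (real m)"
    using assms unfolding eventually_poly_def eventually_sequentially by blast
  obtain Q where Q: "\<And>m. (\<Sum>j\<le>m. poly P (real j)) = poly Q (real m)"
    using poly_sum_is_poly by blast
  have "(\<Sum>j\<le>m. g j) = poly (Q + [:\<Sum>j<K. g j - poly P (real j):]) (real m)" if "m \<ge> K" for m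
  proof -
    have "(\<Sum>j\<le>m. g j - poly P (real j)) = (\<Sum>j<K. g j - poly P (real j))"
      using that by (intro sum.mono_neutral_right) (auto simp: P)
    then show ?thesis by (simp add: sum_subtractf Q[symmetric] algebra_simps)
  qed
  then show ?thesis
    unfolding eventually_poly_def eventually_sequentially by blast
qed

text \<open>A polynomial of larger degree would dominate the bound.\<close>

lemma degree_le_growth:
  fixes P :: "real poly"
  assumes "\<forall>\<^sub>F m in sequentially. \<bar>poly P (real m)\<bar> \<le> C * (real m + 1) ^ D"
  shows "degree P \<le> D"
proof (rule ccontr)
  assume "\<not> degree P \<le> D"
  then have D: "D < degree P" by simp
  define Q where "Q = smult C ([:1, 1:] ^ D)"
  have "degree Q < degree P" using D by (simp add: Q_def degree_power_eq)
  then have "((\<lambda>x. poly Q x / poly P x) \<longlongrightarrow> 0) at_infinity"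
    by (rule poly_divide_tendsto_0_at_infinity)
  then have lim: "((\<lambda>m. poly Q (real m) / poly P (real m)) \<longlongrightarrow> 0) sequentially"
    by (rule filterlim_compose)
       (rule filterlim_mono[OF filterlim_real_sequentially at_top_le_at_infinity order.refl])
  have "P \<noteq> 0" using D by auto
  then have "finite {x. poly P x = 0}" by (rule poly_roots_finite)
  then have "finite (real -` {x. poly P x = 0})"
    by (rule finite_vimageI) (simp add: inj_on_def)
  then have "\<forall>\<^sub>F m in sequentially. m \<notin> real -` {x. poly P x = 0}"
    by (metis (no_types, lifting) cofinite_eq_sequentially eventually_cofinite finite_subset mem_Collect_eq not_not subsetI)
  moreover have "\<forall>\<^sub>F m in sequentially. \<bar>poly Q (real m) / poly P (real m)\<bar> < 1"
    using tendstoD[OF lim, of 1] by (simp add: dist_real_def)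
  ultimately have "\<forall>\<^sub>F m in sequentially. False"
    using assms
  proof eventually_elim
    case (elim m)
    have "\<bar>poly P (real m)\<bar> \<le> \<bar>poly Q (real m)\<bar>"
      using elim(3) by (simp add: Q_def add.commute)
    then show ?case using elim(1,2) by (simp add: abs_divide divide_less_eq_1)
  qed
  then show False by simp
qed

lemma coeff_nonneg_of_eventually_nonneg:
  fixes P :: "real poly"
  assumes "degree P \<le> D" "\<forall>\<^sub>F m in sequentially. 0 \<le> poly P (real m)"
  shows "0 \<le> coeff P D"
proof (cases "degree P = D")
  case True
  show ?thesis
  proof (rule ccontr)
    assume "\<not> 0 \<le> coeff P D"
    then have "0 < lead_coeff (- P)" using True by simp
    then obtain n where n: "\<And>x. x \<ge> n \<Longrightarrow> poly (- P) x \<ge> lead_coeff (- P)"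
      using poly_pinfty_gt_lc by blast
    have "\<forall>\<^sub>F m in sequentially. n \<le> real m"
      using filterlim_real_sequentially by (simp add: filterlim_at_top)
    with assms(2) have "\<forall>\<^sub>F m in sequentially. False"
    proof eventually_elim
      case (elim m)
      then show ?case using n[of "real m"] \<open>0 < lead_coeff (- P)\<close> by simp
    qed
    then show False by simp
  qed
next
  case False
  then show ?thesis using assms(1) by (simp add: coeff_eq_0)
qed

text \<open>Two polynomials that agree at almost all multiples of \<open>r\<close> are equal, so the definite description in
  \<open>eventual_poly\<close> denotes the polynomial that arises from one in \<open>m\<close> by substituting \<open>m = k / r\<close>.\<close>

lemma eventual_poly_on_multiples:
  assumes r: "r \<ge> 1" and g: "eventually_poly (\<lambda>m. g (r * m))"
  shows "\<forall>\<^sub>F m in sequentially. g (r * m) = poly (eventual_poly r g) (real (r * m))"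
proof -
  obtain P K where P: "\<And>m. m \<ge> K \<Longrightarrow> g (r * m) = poly P (real m)"
    using g unfolding eventually_poly_def eventually_sequentially by blast
  define Q where "Q = pcompose P [:0, 1 / real r:]"
  have ex: "\<forall>\<^sub>F k in sequentially. r dvd k \<longrightarrow> g k = poly Q (real k)"
    unfolding eventually_sequentially
  proof (intro exI[of _ "r * K"] allI impI)
    fix k assume "r * K \<le> k" "r dvd k"
    then obtain m where k: "k = r * m" "m \<ge> K" using r by (auto elim!: dvdE)
    then show "g k = poly Q (real k)" using P[OF k(2)] r by (simp add: Q_def poly_pcompose)
  qed
  have uniq: "Q1 = Q2"
    if "\<forall>\<^sub>F k in sequentially. r dvd k \<longrightarrow> g k = poly Q1 (real k)"
      "\<forall>\<^sub>F k in sequentially. r dvd k \<longrightarrow> g k = poly Q2 (real k)" for Q1 Q2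
  proof (rule ccontr)
    assume "Q1 \<noteq> Q2"
    then have fin: "finite {x. poly (Q1 - Q2) x = 0}" by (intro poly_roots_finite) simp
    from that have "\<forall>\<^sub>F k in sequentially. r dvd k \<longrightarrow> poly (Q1 - Q2) (real k) = 0"
      by eventually_elim simp
    then obtain L where L: "\<And>k. k \<ge> L \<Longrightarrow> r dvd k \<Longrightarrow> poly (Q1 - Q2) (real k) = 0"
      unfolding eventually_sequentially by blast
    have "(\<lambda>m. real (r * m)) ` {L..} \<subseteq> {x. poly (Q1 - Q2) x = 0}"
    proof (rule image_subsetI)
      fix m assume "m \<in> {L..}"
      then have "L \<le> m" by simp
      also have "m \<le> r * m" using r by simp
      finally have "L \<le> r * m" .
      then show "real (r * m) \<in> {x. poly (Q1 - Q2) x = 0}" using L[of "r * m"] by simp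
    qed
    then have "finite ((\<lambda>m. real (r * m)) ` {L..})" using fin by (rule finite_subset)
    moreover have "inj_on (\<lambda>m. real (r * m)) {L..}" using r by (auto simp: inj_on_def)
    ultimately show False using finite_imageD infinite_Ici by blast
  qed
  have "\<forall>\<^sub>F k in sequentially. r dvd k \<longrightarrow> g k = poly (eventual_poly r g) (real k)"
    unfolding eventual_poly_def by (rule theI[where a = Q]) (use ex uniq in blast)+
  then obtain L where L: "\<And>k. k \<ge> L \<Longrightarrow> r dvd k \<Longrightarrow> g k = poly (eventual_poly r g) (real k)"
    unfolding eventually_sequentially by blast
  show ?thesis
    unfolding eventually_sequentially
  proof (intro exI[of _ L] allI impI)
    fix m assume "L \<le> m"
    also have "m \<le> r * m" using r by simp
    finally have "L \<le> r * m" .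
    then show "g (r * m) = poly (eventual_poly r g) (real (r * m))"
      by (rule L) simp
  qed
qed

text \<open>The growth bound limits the degree by \<open>D\<close>, so the coefficient is the leading one or zero.\<close>

lemma coeff_nonneg_on_multiples:
  fixes P :: "real poly"
  assumes r: "r \<ge> 1"
    and bound: "\<forall>\<^sub>F m in sequentially. \<bar>poly P (real (r * m))\<bar> \<le> C * (real m + 1) ^ D"
    and nonneg: "\<forall>\<^sub>F m in sequentially. 0 \<le> poly P (real (r * m))"
  shows "0 \<le> coeff P D"
proof -
  define Q where "Q = pcompose P [:0, real r:]"
  have Q: "poly Q (real m) = poly P (real (r * m))" for m
    by (simp add: Q_def poly_pcompose mult.commute)
  have "degree Q \<le> D" by (rule degree_le_growth[of _ C]) (use bound in \<open>simp add: Q\<close>)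
  then have "0 \<le> coeff Q D"
    by (rule coeff_nonneg_of_eventually_nonneg) (use nonneg in \<open>simp add: Q\<close>)
  moreover have "coeff Q D = real r ^ D * coeff P D" by (simp add: Q_def coeff_pcompose_linear)
  moreover have "0 < real r ^ D" using r by simp
  ultimately show ?thesis by (simp add: zero_le_mult_iff)
qed

section \<open>Order ideals of exponent vectors\<close>

definition exponents :: "nat \<Rightarrow> (nat \<Rightarrow> nat) set" where
  "exponents M = {\<alpha>. \<forall>i\<ge>M. \<alpha> i = 0}"

definition mdeg :: "nat \<Rightarrow> (nat \<Rightarrow> nat) \<Rightarrow> nat" where
  "mdeg M \<alpha> = (\<Sum>i<M. \<alpha> i)"

definition order_ideal :: "nat \<Rightarrow> (nat \<Rightarrow> nat) set \<Rightarrow> bool" where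
  "order_ideal M D \<longleftrightarrow> D \<subseteq> exponents M \<and> (\<forall>\<alpha>\<in>D. \<forall>\<beta>. \<beta> \<le> \<alpha> \<longrightarrow> \<beta> \<in> D)"

definition layer :: "nat \<Rightarrow> (nat \<Rightarrow> nat) set \<Rightarrow> nat \<Rightarrow> (nat \<Rightarrow> nat) set" where
  "layer M D m = {\<alpha>\<in>D. mdeg M \<alpha> = m}"

definition slice :: "nat \<Rightarrow> (nat \<Rightarrow> nat) set \<Rightarrow> nat \<Rightarrow> (nat \<Rightarrow> nat) set" where
  "slice M D j = {\<alpha>\<in>exponents M. \<alpha>(M := j) \<in> D}"

text \<open>A monotone subsequence that decreases becomes constant, as natural numbers are well-ordered.\<close>

lemma nat_sequence_incseq_subseq:
  fixes a :: "nat \<Rightarrow> nat"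
  shows "\<exists>\<phi>. strict_mono \<phi> \<and> incseq (a \<circ> \<phi>)"
proof -
  obtain \<phi> where \<phi>: "strict_mono \<phi>" "monoseq (a \<circ> \<phi>)"
    using seq_monosub[of a] by (auto simp: o_def)
  show ?thesis
  proof (cases "incseq (a \<circ> \<phi>)")
    case False
    then have dec: "decseq (a \<circ> \<phi>)" using \<phi>(2) by (auto simp: monoseq_iff)
    define v where "v = (LEAST v. \<exists>k. v = (a \<circ> \<phi>) k)"
    have "\<exists>k. v = (a \<circ> \<phi>) k" unfolding v_def by (rule LeastI_ex) blast
    then obtain K where K: "v = (a \<circ> \<phi>) K" by blast
    have "(a \<circ> \<phi>) k = v" if "k \<ge> K" for k
    proof (rule antisym)
      show "(a \<circ> \<phi>) k \<le> v" using decseqD[OF dec that] K by simp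
      show "v \<le> (a \<circ> \<phi>) k" unfolding v_def by (rule Least_le) blast
    qed
    then have "incseq (a \<circ> (\<lambda>k. \<phi> (k + K)))" by (simp add: incseq_def)
    moreover have "strict_mono (\<lambda>k. \<phi> (k + K))"
      using \<phi>(1) by (auto simp: strict_mono_def)
    ultimately show ?thesis by blast
  qed (use \<phi> in blast)
qed

text \<open>Dickson's lemma: thin out the sequence one coordinate at a time.\<close>

lemma dickson:
  fixes a :: "nat \<Rightarrow> nat \<Rightarrow> nat"
  shows "\<exists>\<phi>. strict_mono \<phi> \<and> (\<forall>i<M. incseq (\<lambda>k. a (\<phi> k) i))"
proof (induction M)
  case 0
  show ?case by (intro exI[of _ id]) (simp add: strict_mono_def)
next
  case (Suc M)
  then obtain \<phi> where \<phi>: "strict_mono \<phi>" "\<forall>i<M. incseq (\<lambda>k. a (\<phi> k) i)" by blast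
  obtain \<psi> where \<psi>: "strict_mono \<psi>" "incseq ((\<lambda>k. a (\<phi> k) M) \<circ> \<psi>)"
    using nat_sequence_incseq_subseq by blast
  have "strict_mono (\<phi> \<circ> \<psi>)" using \<phi>(1) \<psi>(1) by (rule strict_mono_o)
  moreover have "incseq (\<lambda>k. a ((\<phi> \<circ> \<psi>) k) i)" if "i < Suc M" for i
  proof (cases "i = M")
    case True then show ?thesis using \<psi>(2) by (simp add: o_def)
  next
    case False
    then have "incseq (\<lambda>k. a (\<phi> k) i)" using \<phi>(2) that by auto
    then show ?thesis
      using \<psi>(1) by (auto simp: incseq_def strict_mono_less_eq)
  qed
  ultimately show ?case by blast
qed

text \<open>If the chain dropped infinitely often, vectors lost at successive drops would form a sequence in
  which, by Dickson's lemma, some vector is below a later one; but the later one is still in the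
  ideal when the earlier one has been lost.\<close>

lemma decreasing_order_ideals_stabilise:
  assumes ideals: "\<And>j. order_ideal M (D j)" and dec: "\<And>j. D (Suc j) \<subseteq> D j"
  shows "\<exists>J. \<forall>j\<ge>J. D j = D J"
proof (rule ccontr)
  assume "\<not> ?thesis"
  moreover have mono: "D j \<subseteq> D i" if "i \<le> j" for i j
    using that by (induction rule: dec_induct) (use dec in auto)
  ultimately have ex: "\<forall>J. \<exists>j>J. \<exists>\<alpha>. \<alpha> \<in> D J \<and> \<alpha> \<notin> D j"
    by (metis le_neq_implies_less order_antisym subsetI)
  then obtain s where s: "\<And>J. s J > J" "\<And>J. \<exists>\<alpha>. \<alpha> \<in> D J \<and> \<alpha> \<notin> D (s J)"
    by metis
  define t where "t k = (s ^^ k) 0" for k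
  obtain a where a: "\<And>k. a k \<in> D (t k)" "\<And>k. a k \<notin> D (t (Suc k))"
    using s(2) by (metis funpow.simps(2) comp_apply t_def)
  have "strict_mono t"
    by (rule strict_monoI_Suc) (simp add: t_def s(1))
  obtain \<phi> where \<phi>: "strict_mono \<phi>" "\<forall>i<M. incseq (\<lambda>k. a (\<phi> k) i)"
    using dickson by blast
  have "a (\<phi> 0) \<le> a (\<phi> 1)"
  proof (rule le_funI)
    fix i
    show "a (\<phi> 0) i \<le> a (\<phi> 1) i"
    proof (cases "i < M")
      case True then show ?thesis using \<phi>(2) by (auto simp: incseq_def)
    next
      case False
      then have "a (\<phi> 0) i = 0"
        using a(1)[of "\<phi> 0"] ideals[of "t (\<phi> 0)"] by (auto simp: order_ideal_def exponents_def)
      then show ?thesis by simp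
    qed
  qed
  moreover have "t (Suc (\<phi> 0)) \<le> t (\<phi> 1)"
    using \<phi>(1) \<open>strict_mono t\<close> by (simp add: strict_mono_less_eq Suc_le_eq strict_monoD)
  then have "a (\<phi> 1) \<in> D (t (Suc (\<phi> 0)))" using a(1) mono by blast
  ultimately have "a (\<phi> 0) \<in> D (t (Suc (\<phi> 0)))"
    using ideals by (auto simp: order_ideal_def)
  then show False using a(2) by blast
qed

lemma order_ideal_slice:
  assumes "order_ideal (Suc M) D" shows "order_ideal M (slice M D j)"
  unfolding order_ideal_def
proof (intro conjI ballI allI impI)
  show "slice M D j \<subseteq> exponents M" by (auto simp: slice_def)
  fix \<alpha> \<beta> assume \<alpha>: "\<alpha> \<in> slice M D j" and le: "\<beta> \<le> \<alpha>"
  have "\<beta> i \<le> \<alpha> i" for i using le by (simp add: le_fun_def)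
  then have "\<beta> \<in> exponents M"
    using \<alpha> by (simp add: slice_def exponents_def) (metis le_zero_eq)
  moreover have "\<beta>(M := j) \<le> \<alpha>(M := j)" using le by (simp add: le_fun_def)
  then have "\<beta>(M := j) \<in> D" using \<alpha> assms unfolding slice_def order_ideal_def by blast
  ultimately show "\<beta> \<in> slice M D j" by (simp add: slice_def)
qed

lemma slice_antimono:
  assumes "order_ideal (Suc M) D" shows "slice M D (Suc j) \<subseteq> slice M D j"
proof
  fix \<alpha> assume "\<alpha> \<in> slice M D (Suc j)"
  moreover have "\<alpha>(M := j) \<le> \<alpha>(M := Suc j)" by (simp add: le_fun_def)
  ultimately show "\<alpha> \<in> slice M D j"
    using assms unfolding slice_def order_ideal_def by blast
qed

lemma slices_stabilise:
  assumes "order_ideal (Suc M) D"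
  shows "\<exists>J. \<forall>j\<ge>J. slice M D j = slice M D J"
  using order_ideal_slice[OF assms] slice_antimono[OF assms]
  by (rule decreasing_order_ideals_stabilise)

lemma finite_layer_exponents: "finite (layer M (exponents M) m)"
proof (rule finite_subset)
  show "layer M (exponents M) m \<subseteq> {\<alpha>. \<forall>i. (i \<in> {..<M} \<longrightarrow> \<alpha> i \<in> {..m}) \<and> (i \<notin> {..<M} \<longrightarrow> \<alpha> i = 0)}"
    by (auto simp: layer_def mdeg_def exponents_def intro: member_le_sum)
  show "finite {\<alpha>::nat\<Rightarrow>nat. \<forall>i. (i \<in> {..<M} \<longrightarrow> \<alpha> i \<in> {..m}) \<and> (i \<notin> {..<M} \<longrightarrow> \<alpha> i = 0)}"
    by (rule finite_set_of_finite_funs) auto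
qed

lemma finite_layer: "D \<subseteq> exponents M \<Longrightarrow> finite (layer M D m)"
  by (rule finite_subset[OF _ finite_layer_exponents[of M m]]) (auto simp: layer_def)

lemma mdeg_upd: "mdeg (Suc M) (\<alpha>(M := j)) = mdeg M \<alpha> + j"
  by (simp add: mdeg_def)

text \<open>Fixing the last coordinate reduces the number of variables; the properties of order ideals
  below are proved by induction on \<open>M\<close> in this way.\<close>

lemma sum_layer_slices:
  fixes g :: "(nat \<Rightarrow> nat) \<Rightarrow> 'b::comm_monoid_add"
  assumes "D \<subseteq> exponents (Suc M)"
  shows "(\<Sum>\<alpha>\<in>layer (Suc M) D m. g \<alpha>)
       = (\<Sum>j\<le>m. \<Sum>\<alpha>\<in>layer M (slice M D j) (m - j). g (\<alpha>(M := j)))"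
proof -
  have fin: "finite (layer M (slice M D j) l)" for j l
    by (rule finite_layer) (auto simp: slice_def)
  have "(\<Sum>j\<le>m. \<Sum>\<alpha>\<in>layer M (slice M D j) (m - j). g (\<alpha>(M := j)))
      = (\<Sum>(j, \<alpha>)\<in>(SIGMA j:{..m}. layer M (slice M D j) (m - j)). g (\<alpha>(M := j)))"
    by (rule sum.Sigma) (auto simp: fin)
  also have "\<dots> = (\<Sum>\<alpha>\<in>layer (Suc M) D m. g \<alpha>)"
  proof (rule sum.reindex_bij_witness[where
        i = "\<lambda>\<alpha>. (\<alpha> M, \<alpha>(M := 0))" and j = "\<lambda>(j, \<alpha>). \<alpha>(M := j)"])
    fix \<alpha> assume \<alpha>: "\<alpha> \<in> layer (Suc M) D m"
    have "mdeg M (\<alpha>(M := 0)) = mdeg M \<alpha>" by (simp add: mdeg_def)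
    then show "(\<alpha> M, \<alpha>(M := 0)) \<in> (SIGMA j:{..m}. layer M (slice M D j) (m - j))"
      using \<alpha> assms by (auto simp: layer_def slice_def mdeg_def exponents_def Suc_le_eq)
    show "(case (\<alpha> M, \<alpha>(M := 0)) of (j, \<alpha>) \<Rightarrow> \<alpha>(M := j)) = \<alpha>" by simp
  next
    fix x assume "x \<in> (SIGMA j:{..m}. layer M (slice M D j) (m - j))"
    then obtain j \<alpha> where x: "x = (j, \<alpha>)" "j \<le> m" "\<alpha> \<in> layer M (slice M D j) (m - j)" by auto
    then show "(case x of (j, \<alpha>) \<Rightarrow> \<alpha>(M := j)) \<in> layer (Suc M) D m"
      by (auto simp: layer_def slice_def mdeg_upd)
    have "\<alpha> M = 0" using x(3) by (auto simp: layer_def slice_def exponents_def)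
    then show "((case x of (j, \<alpha>) \<Rightarrow> \<alpha>(M := j)) M, (case x of (j, \<alpha>) \<Rightarrow> \<alpha>(M := j))(M := 0)) = x"
      by (auto simp: x)
    show "g (case x of (j, \<alpha>) \<Rightarrow> \<alpha>(M := j)) = (case x of (j, \<alpha>) \<Rightarrow> g (\<alpha>(M := j)))"
      by (simp add: x)
  qed
  finally show ?thesis by simp
qed

text \<open>Slice along the last coordinate \<open>j\<close>. By Dickson's lemma the slices are equal to one ideal \<open>E\<close> from
  some \<open>J\<close> on. The finitely many slices before \<open>J\<close> contribute shifted polynomials, and the others
  contribute partial sums of polynomials belonging to \<open>E\<close>.\<close>

theorem eventually_poly_order_ideal:
  assumes "order_ideal M D"
  shows "eventually_poly (\<lambda>m. \<Sum>\<alpha>\<in>layer M D m. c + (\<Sum>i<M. w i * real (\<alpha> i)))"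
  using assms
proof (induction M arbitrary: D c)
  case 0
  have "layer 0 D m = {}" if "m \<ge> 1" for m
    using that by (auto simp: layer_def mdeg_def)
  then have "\<forall>\<^sub>F m in sequentially. (\<Sum>\<alpha>\<in>layer 0 D m. c + (\<Sum>i<0. w i * real (\<alpha> i))) = 0"
    unfolding eventually_sequentially by (intro exI[of _ 1]) simp
  then show ?case by (rule eventually_poly_cong[OF eventually_poly_const])
next
  case (Suc M)
  define S where "S E c m = (\<Sum>\<alpha>\<in>layer M E m. c + (\<Sum>i<M. w i * real (\<alpha> i)))" for E c m
  obtain J where J: "\<And>j. j \<ge> J \<Longrightarrow> slice M D j = slice M D J"
    using slices_stabilise[OF Suc.prems] by blast
  define E where "E = slice M D J"
  have JE: "slice M D j = E" if "j \<ge> J" for j unfolding E_def using J that .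
  have IH: "eventually_poly (S (slice M D j) c)" for j c
    unfolding S_def using Suc.IH[OF order_ideal_slice[OF Suc.prems]] by simp
  have IHE: "eventually_poly (S E c)" for c unfolding E_def by (rule IH)
  have IHN: "eventually_poly (\<lambda>m. real (card (layer M E m)))"
    unfolding E_def
    using Suc.IH[OF order_ideal_slice[OF Suc.prems], where c = 0]
      Suc.IH[OF order_ideal_slice[OF Suc.prems], where c = 1]
  proof -
    have "real (card (layer M (slice M D J) m)) = S (slice M D J) 1 m + (- 1) * S (slice M D J) 0 m" for m
      by (simp add: S_def sum.distrib)
    then show "eventually_poly (\<lambda>m. real (card (layer M (slice M D J) m)))"
      by (simp only:) (intro eventually_poly_add eventually_poly_mult eventually_poly_const IH)
  qed
  have shift: "S F (c + w M * real j) l = S F c l + w M * real j * real (card (layer M F l))" for F j l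
    by (simp add: S_def sum.distrib algebra_simps)
  have "(\<Sum>\<alpha>\<in>layer (Suc M) D m. c + (\<Sum>i<Suc M. w i * real (\<alpha> i)))
      = (\<Sum>j<J. S (slice M D j) (c + w M * real j) (m - j))
        + ((\<Sum>l\<le>m - J. S E c l)
           + w M * (real m * (\<Sum>l\<le>m - J. real (card (layer M E l))))
           + (- w M) * (\<Sum>l\<le>m - J. real l * real (card (layer M E l))))"
    if "m \<ge> J" for m
  proof -
    have "(\<Sum>\<alpha>\<in>layer (Suc M) D m. c + (\<Sum>i<Suc M. w i * real (\<alpha> i)))
        = (\<Sum>j\<le>m. S (slice M D j) (c + w M * real j) (m - j))"
      using Suc.prems
      by (subst sum_layer_slices) (auto simp: order_ideal_def S_def algebra_simps intro!: sum.cong)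
    also have "{..m} = {..<J} \<union> {J..m}" using that by auto
    also have "(\<Sum>j\<in>{..<J} \<union> {J..m}. S (slice M D j) (c + w M * real j) (m - j))
        = (\<Sum>j<J. S (slice M D j) (c + w M * real j) (m - j))
          + (\<Sum>j\<in>{J..m}. S (slice M D j) (c + w M * real j) (m - j))"
      by (rule sum.union_disjoint) auto
    also have "(\<Sum>j\<in>{J..m}. S (slice M D j) (c + w M * real j) (m - j))
        = (\<Sum>l\<le>m - J. S E (c + w M * real (m - l)) l)"
      by (rule sum.reindex_bij_witness[where i = "\<lambda>l. m - l" and j = "\<lambda>j. m - j"])
         (use that in \<open>auto simp: JE\<close>)
    also have "\<dots> = (\<Sum>l\<le>m - J. S E c l + w M * (real m - real l) * real (card (layer M E l)))"
      by (intro sum.cong refl) (subst shift, auto simp: of_nat_diff)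
    also have "\<dots> = (\<Sum>l\<le>m - J. S E c l)
           + w M * (real m * (\<Sum>l\<le>m - J. real (card (layer M E l))))
           + (- w M) * (\<Sum>l\<le>m - J. real l * real (card (layer M E l)))"
      by (simp add: sum.distrib sum_subtractf sum_distrib_left sum_negf algebra_simps)
    finally show ?thesis .
  qed
  then have eq: "\<forall>\<^sub>F m in sequentially.
      (\<Sum>\<alpha>\<in>layer (Suc M) D m. c + (\<Sum>i<Suc M. w i * real (\<alpha> i)))
      = (\<Sum>j<J. S (slice M D j) (c + w M * real j) (m - j))
        + ((\<Sum>l\<le>m - J. S E c l)
           + w M * (real m * (\<Sum>l\<le>m - J. real (card (layer M E l))))
           + (- w M) * (\<Sum>l\<le>m - J. real l * real (card (layer M E l))))"
    unfolding eventually_sequentially by blast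
  have head: "eventually_poly (\<lambda>m. \<Sum>j<J. S (slice M D j) (c + w M * real j) (m - j))"
    by (rule eventually_poly_sum) (rule eventually_poly_shift[OF IH])
  have tail1: "eventually_poly (\<lambda>m. \<Sum>l\<le>m - J. S E c l)"
    by (rule eventually_poly_shift[OF eventually_poly_partial_sums[OF IHE]])
  have tail2: "eventually_poly (\<lambda>m. \<Sum>l\<le>m - J. real (card (layer M E l)))"
    by (rule eventually_poly_shift[OF eventually_poly_partial_sums[OF IHN]])
  have tail3: "eventually_poly (\<lambda>m. \<Sum>l\<le>m - J. real l * real (card (layer M E l)))"
    by (rule eventually_poly_shift[OF eventually_poly_partial_sums[OF
          eventually_poly_mult[OF eventually_poly_ident IHN]]])
  note terms = eventually_poly_add[OF head eventually_poly_add[OF eventually_poly_add[OF tail1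
    eventually_poly_mult[OF eventually_poly_const eventually_poly_mult[OF eventually_poly_ident tail2]]]
    eventually_poly_mult[OF eventually_poly_const tail3]]]
  show ?case by (rule eventually_poly_cong[OF terms eq])
qed

lemma card_layer_exponents_le: "card (layer M (exponents M) m) \<le> (m + 1) ^ M"
proof (induction M arbitrary: m)
  case 0
  have "layer 0 (exponents 0) m \<subseteq> {\<lambda>_. 0}" by (auto simp: layer_def exponents_def)
  then have "card (layer 0 (exponents 0) m) \<le> card {\<lambda>_::nat. 0::nat}"
    by (rule card_mono[rotated]) simp
  then show ?case by simp
next
  case (Suc M)
  have sl: "slice M (exponents (Suc M)) j = exponents M" for j
    by (auto simp: slice_def exponents_def)
  have "card (layer (Suc M) (exponents (Suc M)) m) = (\<Sum>j\<le>m. card (layer M (exponents M) (m - j)))"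
    using sum_layer_slices[of "exponents (Suc M)" M "\<lambda>_. 1::nat" m] by (simp add: sl)
  also have "\<dots> \<le> (\<Sum>j\<le>m. (m + 1) ^ M)"
    by (intro sum_mono order.trans[OF Suc.IH] power_mono) auto
  finally show ?case by simp
qed

definition coordinate_subspace :: "nat set \<Rightarrow> (nat \<Rightarrow> nat) set" where
  "coordinate_subspace S = {\<alpha>. \<forall>i. i \<notin> S \<longrightarrow> \<alpha> i = 0}"

lemma finite_order_ideal_no_ray:
  assumes D: "order_ideal M D" and no: "\<And>i. i < M \<Longrightarrow> \<not> coordinate_subspace {i} \<subseteq> D"
  shows "finite D"
proof -
  have "\<exists>b. \<forall>\<alpha>\<in>D. \<alpha> i < b" if "i < M" for i
  proof -
    from no[OF that] obtain \<beta> where \<beta>: "\<beta> \<in> coordinate_subspace {i}" "\<beta> \<notin> D" by blast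
    have "\<alpha> i < \<beta> i" if "\<alpha> \<in> D" for \<alpha>
    proof (rule ccontr)
      assume "\<not> \<alpha> i < \<beta> i"
      then have "\<beta> \<le> \<alpha>" using \<beta>(1) unfolding coordinate_subspace_def le_fun_def by (metis (mono_tags, lifting) leI le0 mem_Collect_eq singletonD)
      then show False using D that \<beta>(2) by (auto simp: order_ideal_def)
    qed
    then show ?thesis by blast
  qed
  then obtain b where b: "\<And>i \<alpha>. i < M \<Longrightarrow> \<alpha> \<in> D \<Longrightarrow> \<alpha> i < b i" by metis
  have "D \<subseteq> {\<alpha>. \<forall>i. (i \<in> {..<M} \<longrightarrow> \<alpha> i \<in> {..<Max (b ` {..<M})}) \<and> (i \<notin> {..<M} \<longrightarrow> \<alpha> i = 0)}"
  proof -
    have "\<alpha> i < Max (b ` {..<M})" if "i < M" "\<alpha> \<in> D" for i \<alpha>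
      using b[OF that] that(1) by (meson Max_ge finite_imageI finite_lessThan imageI lessThan_iff less_le_trans)
    then show ?thesis using D by (auto simp: order_ideal_def exponents_def)
  qed
  then show ?thesis
    by (rule finite_subset) (rule finite_set_of_finite_funs; simp)
qed

text \<open>In the slicing by the last coordinate \<open>j\<close>, the finitely many slices before stabilisation satisfy the
  same bound. The stable slice \<open>E\<close> occurs about \<open>m\<close> times, which costs one factor \<open>m + 1\<close>; but the
  last coordinate can be added to each coordinate subspace of \<open>E\<close>, so those of \<open>E\<close> have
  smaller dimension. For \<open>t = 0\<close> this leaves no ray in \<open>E\<close>, so \<open>E\<close> is finite.\<close>

theorem order_ideal_growth:
  assumes "order_ideal M D"
    and "\<And>S. S \<subseteq> {..<M} \<Longrightarrow> coordinate_subspace S \<subseteq> D \<Longrightarrow> card S \<le> Suc t"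
  shows "\<exists>c. \<forall>m. card (layer M D m) \<le> c * (m + 1) ^ t"
  using assms
proof (induction M arbitrary: D t)
  case 0
  have "card (layer 0 D m) \<le> 1 * (m + 1) ^ t" for m
  proof -
    have "layer 0 D m \<subseteq> layer 0 (exponents 0) m"
      using 0 by (auto simp: layer_def order_ideal_def)
    then have "card (layer 0 D m) \<le> card (layer 0 (exponents 0) m)"
      by (intro card_mono finite_layer_exponents)
    also have "\<dots> \<le> (m + 1) ^ 0" by (rule card_layer_exponents_le)
    also have "\<dots> \<le> 1 * (m + 1) ^ t" by simp
    finally show ?thesis .
  qed
  then show ?case by blast
next
  case (Suc M)
  note ideal = Suc.prems(1)
  obtain J where J: "\<And>j. j \<ge> J \<Longrightarrow> slice M D j = slice M D J"
    using slices_stabilise[OF ideal] by blast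
  define E where "E = slice M D J"
  have JE: "slice M D j = E" if "j \<ge> J" for j unfolding E_def using J that .
  have idE: "order_ideal M E" unfolding E_def by (rule order_ideal_slice[OF ideal])
  have "\<exists>c. \<forall>m. card (layer M (slice M D j) m) \<le> c * (m + 1) ^ t" for j
  proof (rule Suc.IH[OF order_ideal_slice[OF ideal]])
    fix S assume S: "S \<subseteq> {..<M}" "coordinate_subspace S \<subseteq> slice M D j"
    have "coordinate_subspace S \<subseteq> D"
    proof
      fix \<alpha> assume \<alpha>: "\<alpha> \<in> coordinate_subspace S"
      then have "\<alpha>(M := j) \<in> D" using S(2) by (auto simp: slice_def)
      moreover have "\<alpha> M = 0" using \<alpha> S(1) by (auto simp: coordinate_subspace_def)
      then have "\<alpha> \<le> \<alpha>(M := j)" by (simp add: le_fun_def)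
      ultimately show "\<alpha> \<in> D" using ideal unfolding order_ideal_def by blast
    qed
    then show "card S \<le> Suc t" using Suc.prems(2)[of S] S(1) by (simp add: subset_iff less_Suc_eq)
  qed
  then obtain b where b: "\<And>j m. card (layer M (slice M D j) m) \<le> b j * (m + 1) ^ t" by metis
  have dimE: "card S \<le> t" if S: "S \<subseteq> {..<M}" "coordinate_subspace S \<subseteq> E" for S
  proof -
    have "coordinate_subspace (insert M S) \<subseteq> D"
    proof
      fix \<alpha> assume \<alpha>: "\<alpha> \<in> coordinate_subspace (insert M S)"
      define k where "k = max J (\<alpha> M)"
      have "\<alpha>(M := 0) \<in> coordinate_subspace S" using \<alpha> by (auto simp: coordinate_subspace_def)
      then have "\<alpha>(M := 0) \<in> slice M D k" using S(2) JE[of k] by (auto simp: k_def)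
      then have "\<alpha>(M := k) \<in> D" by (simp add: slice_def)
      moreover have "\<alpha> \<le> \<alpha>(M := k)" by (simp add: le_fun_def k_def)
      ultimately show "\<alpha> \<in> D" using ideal unfolding order_ideal_def by blast
    qed
    then have "card (insert M S) \<le> Suc t"
      by (rule Suc.prems(2)[rotated]) (use S(1) in auto)
    moreover have "finite S" "M \<notin> S" using S(1) by (auto intro: finite_subset)
    ultimately show ?thesis by simp
  qed
  have tail: "\<exists>c. \<forall>m. (\<Sum>l\<le>m. card (layer M E l)) \<le> c * (m + 1) ^ t"
  proof (cases t)
    case 0
    have "finite E"
    proof (rule finite_order_ideal_no_ray[OF idE])
      fix i assume "i < M"
      then show "\<not> coordinate_subspace {i} \<subseteq> E" using dimE[of "{i}"] 0 by auto
    qed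
    have "(\<Sum>l\<le>m. card (layer M E l)) \<le> card E" for m
    proof -
      have "(\<Sum>l\<le>m. card (layer M E l)) = card (\<Union>l\<le>m. layer M E l)"
        by (rule card_UN_disjoint[symmetric]) (use \<open>finite E\<close> in \<open>auto simp: layer_def\<close>)
      also have "\<dots> \<le> card E" by (rule card_mono[OF \<open>finite E\<close>]) (auto simp: layer_def)
      finally show ?thesis .
    qed
    then show ?thesis using 0 by auto
  next
    case (Suc t')
    obtain c where c: "\<And>m. card (layer M E m) \<le> c * (m + 1) ^ t'"
      using Suc.IH[OF idE, of t'] dimE Suc by auto
    have "(\<Sum>l\<le>m. card (layer M E l)) \<le> c * (m + 1) ^ t" for m
    proof -
      have "(\<Sum>l\<le>m. card (layer M E l)) \<le> (\<Sum>l\<le>m. c * (m + 1) ^ t')"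
        by (intro sum_mono order.trans[OF c] mult_left_mono power_mono) auto
      then show ?thesis by (simp add: Suc algebra_simps)
    qed
    then show ?thesis by blast
  qed
  then obtain c where c: "\<And>m. (\<Sum>l\<le>m. card (layer M E l)) \<le> c * (m + 1) ^ t" by blast
  have "card (layer (Suc M) D m) \<le> ((\<Sum>j<J. b j) + c) * (m + 1) ^ t" for m
  proof -
    have "card (layer (Suc M) D m) = (\<Sum>j\<le>m. card (layer M (slice M D j) (m - j)))"
      using sum_layer_slices[of D M "\<lambda>_. 1::nat" m] ideal by (simp add: order_ideal_def)
    also have "\<dots> \<le> (\<Sum>j\<in>{..<J} \<union> {j. J \<le> j \<and> j \<le> m}. card (layer M (slice M D j) (m - j)))"
      by (rule sum_mono2) auto
    also have "\<dots> = (\<Sum>j<J. card (layer M (slice M D j) (m - j)))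
        + (\<Sum>j\<in>{j. J \<le> j \<and> j \<le> m}. card (layer M E (m - j)))"
      by (subst sum.union_disjoint) (auto simp: JE)
    also have "(\<Sum>j\<in>{j. J \<le> j \<and> j \<le> m}. card (layer M E (m - j)))
        \<le> (\<Sum>j\<le>m. card (layer M E (m - j)))"
      by (rule sum_mono2) auto
    also have "(\<Sum>j\<le>m. card (layer M E (m - j))) = (\<Sum>l\<le>m. card (layer M E l))"
      by (rule sum.reindex_bij_witness[where i = "\<lambda>l. m - l" and j = "\<lambda>j. m - j"]) auto
    also have "\<dots> \<le> c * (m + 1) ^ t" by (rule c)
    also have "(\<Sum>j<J. card (layer M (slice M D j) (m - j))) \<le> (\<Sum>j<J. b j * (m + 1) ^ t)"
      by (intro sum_mono order.trans[OF b] mult_left_mono power_mono) auto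
    finally show ?thesis by (simp add: sum_distrib_right algebra_simps)
  qed
  then show ?case by blast
qed

section \<open>Spans of functions\<close>

lemma span_times_span:
  assumes "x \<in> fun_space.span A" "y \<in> fun_space.span B"
    and AB: "\<And>a b. a \<in> A \<Longrightarrow> b \<in> B \<Longrightarrow> a * b \<in> fun_space.span C"
  shows "x * y \<in> fun_space.span C"
  using assms(1)
proof (induction rule: fun_space.span_induct_alt)
  case base
  show ?case using fun_space.span_zero[of C] by (simp add: zero_fun_def)
next
  case (step c a x)
  have "a * y \<in> fun_space.span C"
    using assms(2)
  proof (induction rule: fun_space.span_induct_alt)
    case base
    show ?case using fun_space.span_zero[of C] by (simp add: zero_fun_def)
  next
    case (step d b y)
    have "a * (fscale d b + y) = fscale d (a * b) + a * y"
      by (auto simp: fscale_def fun_eq_iff algebra_simps)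
    then show ?case
      using AB[OF \<open>a \<in> A\<close> step(1)] step(2) by (metis fun_space.span_add fun_space.span_scale)
  qed
  moreover have "(fscale c a + x) * y = fscale c (a * y) + x * y"
    by (auto simp: fscale_def fun_eq_iff algebra_simps)
  ultimately show ?case
    using step by (metis fun_space.span_add fun_space.span_scale)
qed

lemma sum_fun_apply: "(\<Sum>i\<in>I. f i) x = (\<Sum>i\<in>I. (f i x :: 'b::comm_monoid_add))"
  by (induction I rule: infinite_finite_induct) auto

lemma module_homI:
  assumes "\<And>x y. L (x + y) = L x + L y" "\<And>c x. L (fscale c x) = fscale c (L x)"
  shows "module_hom fscale fscale (L :: ('a \<Rightarrow> complex) \<Rightarrow> 'b \<Rightarrow> complex)"
  using assms by unfold_locales (auto simp: fscale_def fun_eq_iff algebra_simps)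

lemma dim_linear_image_le:
  assumes "module_hom fscale fscale L" "finite B" "fun_space.span B = V"
  shows "fun_space.dim (L ` V) \<le> fun_space.dim V"
proof -
  obtain B' where B': "B' \<subseteq> B" "fun_space.independent B'" "B \<subseteq> fun_space.span B'"
    "card B' = fun_space.dim B"
    by (rule fun_space.basis_exists)
  have "finite B'" using B'(1) assms(2) by (rule finite_subset)
  have "fun_space.span B' = V"
    using B'(1,3) assms(3) by (metis fun_space.span_eq fun_space.span_superset order_trans)
  then have "L ` V = fun_space.span (L ` B')" using module_hom.span_image[OF assms(1)] by metis
  then have "fun_space.dim (L ` V) \<le> card (L ` B')"
    using \<open>finite B'\<close> by (intro fun_space.dim_le_card) auto
  also have "\<dots> \<le> card B'" using \<open>finite B'\<close> by (rule card_image_le)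
  also have "\<dots> = fun_space.dim V" using B'(4) assms(3) by (metis fun_space.dim_span)
  finally show ?thesis .
qed

definition independent_family :: "'i set \<Rightarrow> ('i \<Rightarrow> 'a \<Rightarrow> complex) \<Rightarrow> bool" where
  "independent_family I u \<longleftrightarrow>
     (\<forall>c. (\<forall>x. (\<Sum>i\<in>I. c i * u i x) = 0) \<longrightarrow> (\<forall>i\<in>I. c i = 0))"

lemma independent_family_iff:
  assumes I: "finite I"
  shows "independent_family I u \<longleftrightarrow> inj_on u I \<and> fun_space.independent (u ` I)"
proof
  assume ind: "independent_family I u"
  have inj: "inj_on u I"
  proof (rule inj_onI, rule ccontr)
    fix i j assume ij: "i \<in> I" "j \<in> I" "u i = u j" "i \<noteq> j"
    define c where "c k = (if k = i then 1 else if k = j then - 1 else 0 :: complex)" for k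
    have "(\<Sum>k\<in>I. c k * u k x) = 0" for x
    proof -
      have "(\<Sum>k\<in>I. c k * u k x) = (\<Sum>k\<in>{i, j}. c k * u k x)"
        by (rule sum.mono_neutral_right) (use I ij in \<open>auto simp: c_def\<close>)
      then show ?thesis using ij by (simp add: c_def)
    qed
    then have "c i = 0" using ind ij(1) unfolding independent_family_def by blast
    then show False by (simp add: c_def)
  qed
  have "fun_space.independent (u ` I)"
  proof (rule fun_space.independent_if_scalars_zero)
    fix c g assume 0: "(\<Sum>g\<in>u ` I. fscale (c g) g) = 0" and g: "g \<in> u ` I"
    have "(\<Sum>i\<in>I. fscale (c (u i)) (u i)) = 0"
      using 0 by (simp add: sum.reindex[OF inj])
    then have "(\<Sum>i\<in>I. c (u i) * u i x) = 0" for x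
      by (auto simp: fun_eq_iff sum_fun_apply fscale_def)
    then have "\<forall>i\<in>I. c (u i) = 0"
      using ind[unfolded independent_family_def, rule_format, of "\<lambda>i. c (u i)"] by blast
    then show "c g = 0" using g by blast
  qed (simp add: I)
  with inj show "inj_on u I \<and> fun_space.independent (u ` I)" by simp
next
  assume R: "inj_on u I \<and> fun_space.independent (u ` I)"
  show "independent_family I u"
    unfolding independent_family_def
  proof (intro allI impI ballI)
    fix c i assume 0: "\<forall>x. (\<Sum>i\<in>I. c i * u i x) = 0" and i: "i \<in> I"
    define d where "d g = c (inv_into I u g)" for g
    have "(\<Sum>g\<in>u ` I. fscale (d g) g) = (\<Sum>i\<in>I. fscale (c i) (u i))"
      unfolding sum.reindex[OF conjunct1[OF R]]
      by (rule sum.cong) (simp_all add: d_def inv_into_f_f[OF conjunct1[OF R]])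
    also have "\<dots> = 0" using 0 by (auto simp: fun_eq_iff sum_fun_apply fscale_def)
    finally have "d (u i) = 0"
      using R i I by (intro fun_space.independentD[of "u ` I" "u ` I"]) auto
    then show "c i = 0" using R i by (simp add: d_def inv_into_f_f)
  qed
qed

text \<open>The bound needs the finite spanning set: \<open>dim\<close> is 0 for spaces without a finite basis.\<close>

lemma independent_family_le_dim:
  assumes "finite I" "independent_family I u" "u ` I \<subseteq> fun_space.span Y" "finite Y"
  shows "card I \<le> fun_space.dim (fun_space.span Y)"
proof -
  obtain B where B: "B \<subseteq> fun_space.span Y" "fun_space.independent B"
    "fun_space.span Y \<subseteq> fun_space.span B" "card B = fun_space.dim (fun_space.span Y)"
    using fun_space.basis_exists by blast
  have "finite B" using fun_space.independent_span_bound[OF assms(4) B(2,1)] by simp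
  have "card (u ` I) \<le> card B"
    using fun_space.independent_span_bound[OF \<open>finite B\<close>, of "u ` I"] assms(1,2,3) B(3)
    by (auto simp: independent_family_iff)
  then show ?thesis
    using assms(1,2) B(4) by (simp add: independent_family_iff card_image)
qed

lemma independent_family_subset:
  assumes "independent_family I u" "J \<subseteq> I" "finite I"
  shows "independent_family J u"
  unfolding independent_family_def
proof (intro allI impI ballI)
  fix c j assume 0: "\<forall>x. (\<Sum>i\<in>J. c i * u i x) = 0" and j: "j \<in> J"
  have "(\<Sum>i\<in>I. (if i \<in> J then c i else 0) * u i x) = (\<Sum>i\<in>J. c i * u i x)" for x
    by (rule sum.mono_neutral_cong_right) (use assms in auto)
  then have "\<forall>i\<in>I. (if i \<in> J then c i else 0) = 0"
    using assms(1)[unfolded independent_family_def, rule_format, of "\<lambda>i. if i \<in> J then c i else 0"] 0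
    by simp
  then have "(if j \<in> J then c j else 0) = 0" using j assms(2) by blast
  then show "c j = 0" using j by simp
qed

text \<open>Linear independence is an open condition for pointwise convergence: pick a point where the
  last function does not vanish and use it to clear that point from the other functions.\<close>

lemma independent_family_eventually:
  assumes "finite I" "independent_family I u"
    and "\<And>i x. i \<in> I \<Longrightarrow> ((\<lambda>t. v t i x) \<longlongrightarrow> u i x) F"
  shows "\<forall>\<^sub>F t in F. independent_family I (v t)"
  using assms
proof (induction I arbitrary: u v rule: finite_induct)
  case empty
  then show ?case by (simp add: independent_family_def)
next
  case (insert p I)
  note ind = insert.prems(1) and lim = insert.prems(2)
  have "\<exists>a. u p a \<noteq> 0"
  proof (rule ccontr)
    assume "\<nexists>a. u p a \<noteq> 0"
    then have "\<forall>x. (\<Sum>i\<in>insert p I. (if i = p then 1 else 0) * u i x) = 0"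
      using insert.hyps by (auto intro: sum.neutral)
    from ind[unfolded independent_family_def, rule_format, OF this[rule_format], of p]
    show False by simp
  qed
  then obtain a where a: "u p a \<noteq> 0" by blast
  \<comment> \<open>One elimination step; the new functions all vanish at \<open>a\<close>.\<close>
  define u' where "u' i x = u i x - u i a / u p a * u p x" for i x
  define v' where "v' t i x = v t i x - v t i a / v t p a * v t p x" for t i x
  have "independent_family I u'"
    unfolding independent_family_def
  proof (intro allI impI ballI)
    fix c i assume 0: "\<forall>x. (\<Sum>i\<in>I. c i * u' i x) = 0" and i: "i \<in> I"
    define d where "d j = (if j = p then - (\<Sum>i\<in>I. c i * (u i a / u p a)) else c j)" for j
    have "(\<Sum>j\<in>insert p I. d j * u j x) = 0" for x
    proof -
      have "(\<Sum>j\<in>I. d j * u j x) = (\<Sum>j\<in>I. c j * u j x)"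
        by (rule sum.cong) (use insert.hyps(2) in \<open>auto simp: d_def\<close>)
      then have "(\<Sum>j\<in>insert p I. d j * u j x) = (\<Sum>i\<in>I. c i * u' i x)"
        using insert.hyps
        by (simp add: d_def u'_def sum_distrib_left sum_distrib_right sum_subtractf algebra_simps)
      then show ?thesis using 0 by simp
    qed
    then have "\<forall>j\<in>insert p I. d j = 0" using ind unfolding independent_family_def by blast
    then have "d i = 0" using i by blast
    then show "c i = 0" using i insert.hyps(2) by (auto simp: d_def split: if_splits)
  qed
  moreover have "((\<lambda>t. v' t i x) \<longlongrightarrow> u' i x) F" if "i \<in> I" for i x
    unfolding u'_def v'_def using a that by (intro tendsto_intros lim) auto
  ultimately have "\<forall>\<^sub>F t in F. independent_family I (v' t)" by (rule insert.IH)
  moreover have "\<forall>\<^sub>F t in F. v t p a \<noteq> 0"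
    using tendsto_imp_eventually_ne[OF lim a] by simp
  ultimately show ?case
  proof eventually_elim
    case (elim t)
    show ?case unfolding independent_family_def
    proof (intro allI impI ballI)
      fix c i assume 0: "\<forall>x. (\<Sum>i\<in>insert p I. c i * v t i x) = 0" and i: "i \<in> insert p I"
      have cp: "c p = - (\<Sum>i\<in>I. c i * (v t i a / v t p a))"
      proof -
        have "c p * v t p a = - (\<Sum>i\<in>I. c i * v t i a)"
          using 0[rule_format, of a] insert.hyps by (simp add: add_eq_0_iff2 add.commute)
        then have "c p = - (\<Sum>i\<in>I. c i * v t i a) / v t p a"
          using elim(2) by (simp add: field_simps)
        then show ?thesis by (simp add: sum_divide_distrib)
      qed
      have "(\<Sum>i\<in>I. c i * v' t i x) = (\<Sum>i\<in>insert p I. c i * v t i x)" for x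
        using insert.hyps
        by (simp add: cp v'_def sum_distrib_left sum_distrib_right sum_subtractf algebra_simps)
      then have *: "\<forall>i\<in>I. c i = 0" using elim(1) 0 unfolding independent_family_def by simp
      then have "c p = 0" using cp by simp
      then show "c i = 0" using * i by auto
    qed
  qed
qed

section \<open>Standard monomials\<close>

text \<open>Scan the indices in increasing order of their keys and keep those whose vector is not yet in the span.
  The hypothesis on \<open>B\<close> makes it an initial segment, so that one selection \<open>Std\<close> serves
  all levels of a filtration at once.\<close>

lemma greedy_basis:
  fixes key :: "'i \<Rightarrow> 'k::linorder" and u :: "'i \<Rightarrow> 'a \<Rightarrow> complex"
  assumes "finite A" "inj_on key A"
    and Std: "Std = {a\<in>A. u a \<notin> fun_space.span (u ` {b\<in>A. key b < key a})}"
    and "B \<subseteq> A" "\<And>a b. a \<in> B \<Longrightarrow> b \<in> A \<Longrightarrow> key b < key a \<Longrightarrow> b \<in> B"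
  shows "inj_on u (Std \<inter> B) \<and> fun_space.independent (u ` (Std \<inter> B)) \<and>
         fun_space.span (u ` (Std \<inter> B)) = fun_space.span (u ` B)"
  using assms(4,5)
proof (induction "card B" arbitrary: B)
  case 0
  then have "B = {}" using \<open>finite A\<close> by (auto dest: finite_subset)
  then show ?case by (simp add: fun_space.independent_empty)
next
  case (Suc k)
  have "finite B" "B \<noteq> {}" using Suc.hyps(2) by (auto intro: card_ge_0_finite)
  then have "Max (key ` B) \<in> key ` B" by (intro Max_in) auto
  then obtain a where "a \<in> B" and "key a = Max (key ` B)" by auto
  then have a: "a \<in> B" "\<And>b. b \<in> B \<Longrightarrow> key b \<le> key a"
    using \<open>finite B\<close> by simp_all
  define B' where "B' = B - {a}"
  have B': "B' = {b\<in>A. key b < key a}"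
  proof (intro set_eqI iffI)
    fix b assume "b \<in> B'"
    then have b: "b \<in> B" "b \<noteq> a" by (auto simp: B'_def)
    then have "key b \<noteq> key a"
      using a(1) Suc.prems(1) \<open>inj_on key A\<close> by (auto dest: inj_onD)
    then show "b \<in> {b\<in>A. key b < key a}"
      using a(2)[OF b(1)] b(1) Suc.prems(1) by auto
  next
    fix b assume "b \<in> {b\<in>A. key b < key a}"
    then show "b \<in> B'" using Suc.prems(2)[OF a(1)] by (auto simp: B'_def)
  qed
  have IH: "inj_on u (Std \<inter> B') \<and> fun_space.independent (u ` (Std \<inter> B')) \<and>
      fun_space.span (u ` (Std \<inter> B')) = fun_space.span (u ` B')"
  proof (rule Suc.hyps(1))
    show "k = card B'" using Suc.hyps(2) a(1) \<open>finite B\<close> by (simp add: B'_def)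
  qed (auto simp: B')
  have Ba: "B = insert a B'" using a(1) by (auto simp: B'_def)
  have aA: "a \<in> A" using a(1) Suc.prems by blast
  show ?case
  proof (cases "a \<in> Std")
    case True
    then have "u a \<notin> fun_space.span (u ` B')" unfolding Std B' by blast
    then have na: "u a \<notin> fun_space.span (u ` (Std \<inter> B'))" using IH by argo
    then have na': "u a \<notin> u ` (Std \<inter> B')" using fun_space.span_base[of "u a" "u ` (Std \<inter> B')"] by argo
    have eq: "Std \<inter> B = insert a (Std \<inter> B')" using True unfolding Ba by blast
    show ?thesis
    proof (intro conjI)
      show "inj_on u (Std \<inter> B)"
        unfolding eq inj_on_insert using IH na' by blast
      show "fun_space.independent (u ` (Std \<inter> B))"
        unfolding eq image_insert using IH na by (metis fun_space.independent_insertI)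
      show "fun_space.span (u ` (Std \<inter> B)) = fun_space.span (u ` B)"
        unfolding eq unfolding Ba image_insert fun_space.span_insert using IH by simp
    qed
  next
    case False
    then have "u a \<in> fun_space.span (u ` B')" using aA unfolding Std B' by blast
    then have "fun_space.span (u ` B) = fun_space.span (u ` B')"
      unfolding Ba image_insert by (rule fun_space.span_redundant)
    moreover have "Std \<inter> B = Std \<inter> B'" using False unfolding Ba by blast
    ultimately show ?thesis using IH by argo
  qed
qed

definition wt :: "nat \<Rightarrow> (nat \<Rightarrow> nat) \<Rightarrow> (nat \<Rightarrow> nat) \<Rightarrow> nat" where
  "wt M w \<alpha> = (\<Sum>i<M. w i * \<alpha> i)"

text \<open>Cutting off outside \<open>X\<close> matches the convention for sections and makes the empty product the unit
  of the coordinate ring.\<close>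

definition monomial :: "'a set \<Rightarrow> nat \<Rightarrow> (nat \<Rightarrow> 'a \<Rightarrow> complex) \<Rightarrow> (nat \<Rightarrow> nat) \<Rightarrow> 'a \<Rightarrow> complex" where
  "monomial X M f \<alpha> = (\<lambda>v. if v \<in> X then \<Prod>i<M. f i v ^ \<alpha> i else 0)"

text \<open>Lists are compared lexicographically, so the weight decides first. Hence the monomials of bounded
  weight form an initial segment in each degree.\<close>

definition monomial_key :: "nat \<Rightarrow> (nat \<Rightarrow> nat) \<Rightarrow> (nat \<Rightarrow> nat) \<Rightarrow> nat list" where
  "monomial_key M w \<alpha> = wt M w \<alpha> # map \<alpha> [0..<M]"

definition standard_exponents ::
  "'a set \<Rightarrow> nat \<Rightarrow> (nat \<Rightarrow> 'a \<Rightarrow> complex) \<Rightarrow> (nat \<Rightarrow> nat) \<Rightarrow> (nat \<Rightarrow> nat) set" where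
  "standard_exponents X M f w = {\<alpha>\<in>exponents M. monomial X M f \<alpha> \<notin> fun_space.span
     (monomial X M f ` {\<beta>\<in>layer M (exponents M) (mdeg M \<alpha>).
        monomial_key M w \<beta> < monomial_key M w \<alpha>})}"

definition weight_piece ::
  "'a set \<Rightarrow> nat \<Rightarrow> (nat \<Rightarrow> 'a \<Rightarrow> complex) \<Rightarrow> (nat \<Rightarrow> nat) \<Rightarrow> nat \<Rightarrow> nat \<Rightarrow> ('a \<Rightarrow> complex) set" where
  "weight_piece X M f w m i =
     fun_space.span (monomial X M f ` {\<alpha>\<in>layer M (exponents M) m. wt M w \<alpha> \<le> i})"

lemma wt_add: "wt M w (\<alpha> + \<beta>) = wt M w \<alpha> + wt M w \<beta>"
  by (simp add: wt_def sum.distrib algebra_simps)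

lemma mdeg_add: "mdeg M (\<alpha> + \<beta>) = mdeg M \<alpha> + mdeg M \<beta>"
  by (simp add: mdeg_def sum.distrib)

lemma exponents_add: "\<alpha> \<in> exponents M \<Longrightarrow> \<beta> \<in> exponents M \<Longrightarrow> \<alpha> + \<beta> \<in> exponents M"
  by (simp add: exponents_def)

lemma monomial_add: "monomial X M f (\<alpha> + \<beta>) = monomial X M f \<alpha> * monomial X M f \<beta>"
  by (auto simp: monomial_def fun_eq_iff power_add prod.distrib)

lemma list_less_add:
  fixes xs :: "nat list"
  assumes "map \<alpha> xs < map \<beta> xs"
  shows "map (\<alpha> + \<gamma>) xs < map (\<beta> + (\<gamma> :: nat \<Rightarrow> nat)) xs"
  using assms by (induction xs) auto

lemma monomial_key_add:
  assumes "monomial_key M w \<alpha> < monomial_key M w \<beta>"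
  shows "monomial_key M w (\<alpha> + \<gamma>) < monomial_key M w (\<beta> + \<gamma>)"
  using assms list_less_add[of \<alpha> "[0..<M]" \<beta> \<gamma>] by (auto simp: monomial_key_def wt_add)

lemma monomial_key_inj: "inj_on (monomial_key M w) (exponents M)"
proof (rule inj_onI, rule ext)
  fix \<alpha> \<beta> i assume "\<alpha> \<in> exponents M" "\<beta> \<in> exponents M" "monomial_key M w \<alpha> = monomial_key M w \<beta>"
  then show "\<alpha> i = \<beta> i"
    by (cases "i < M") (auto simp: monomial_key_def exponents_def)
qed

text \<open>A linear relation that expresses a monomial by smaller ones can be multiplied by any monomial,
  so multiples of non-standard monomials are non-standard.\<close>

lemma order_ideal_standard_exponents: "order_ideal M (standard_exponents X M f w)"
  unfolding order_ideal_def
proof (intro conjI ballI allI impI)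
  show "standard_exponents X M f w \<subseteq> exponents M" by (auto simp: standard_exponents_def)
  fix \<alpha> \<beta> assume \<alpha>: "\<alpha> \<in> standard_exponents X M f w" and le: "\<beta> \<le> \<alpha>"
  define \<gamma> where "\<gamma> i = \<alpha> i - \<beta> i" for i
  have le': "\<beta> i \<le> \<alpha> i" for i using le by (simp add: le_fun_def)
  then have \<alpha>_eq: "\<alpha> = \<beta> + \<gamma>" by (auto simp: fun_eq_iff \<gamma>_def)
  have "\<alpha> \<in> exponents M" using \<alpha> by (simp add: standard_exponents_def)
  then have \<gamma>: "\<gamma> \<in> exponents M" and \<beta>: "\<beta> \<in> exponents M"
    using le' by (auto simp: exponents_def \<gamma>_def) (metis le_zero_eq)
  show "\<beta> \<in> standard_exponents X M f w"
  proof (rule ccontr)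
    assume "\<beta> \<notin> standard_exponents X M f w"
    then have in_span: "monomial X M f \<beta> \<in> fun_space.span
        (monomial X M f ` {\<delta>\<in>layer M (exponents M) (mdeg M \<beta>). monomial_key M w \<delta> < monomial_key M w \<beta>})"
      using \<beta> by (simp add: standard_exponents_def)
    have "monomial X M f \<beta> * monomial X M f \<gamma> \<in> fun_space.span
        (monomial X M f ` {\<delta>\<in>layer M (exponents M) (mdeg M \<alpha>). monomial_key M w \<delta> < monomial_key M w \<alpha>})"
    proof (rule span_times_span[OF in_span fun_space.span_base[of _ "{monomial X M f \<gamma>}"]])
      fix a b assume "b \<in> {monomial X M f \<gamma>}" and
        "a \<in> monomial X M f ` {\<delta>\<in>layer M (exponents M) (mdeg M \<beta>). monomial_key M w \<delta> < monomial_key M w \<beta>}"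
      then obtain \<delta> where \<delta>: "\<delta> \<in> exponents M" "mdeg M \<delta> = mdeg M \<beta>"
        "monomial_key M w \<delta> < monomial_key M w \<beta>" "a * b = monomial X M f (\<delta> + \<gamma>)"
        by (auto simp: layer_def monomial_add)
      then show "a * b \<in> fun_space.span
        (monomial X M f ` {\<delta>\<in>layer M (exponents M) (mdeg M \<alpha>). monomial_key M w \<delta> < monomial_key M w \<alpha>})"
        unfolding \<delta>(4) \<alpha>_eq mdeg_add layer_def
        by (intro fun_space.span_base imageI CollectI conjI exponents_add[OF \<delta>(1) \<gamma>]
            monomial_key_add[OF \<delta>(3)]) (simp only: mdeg_add \<delta>(2))
    qed simp
    then show False using \<alpha> by (simp add: standard_exponents_def monomial_add[symmetric] \<alpha>_eq)
  qed
qed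

text \<open>Within one degree, being standard is the greedy selection with respect to the keys.\<close>

lemma dim_down_closed_span:
  assumes "B \<subseteq> layer M (exponents M) m"
    and "\<And>\<alpha> \<beta>. \<alpha> \<in> B \<Longrightarrow> \<beta> \<in> layer M (exponents M) m \<Longrightarrow>
           monomial_key M w \<beta> < monomial_key M w \<alpha> \<Longrightarrow> \<beta> \<in> B"
  shows "inj_on (monomial X M f) (standard_exponents X M f w \<inter> B)"
    and "fun_space.independent (monomial X M f ` (standard_exponents X M f w \<inter> B))"
    and "fun_space.dim (fun_space.span (monomial X M f ` B)) = card (standard_exponents X M f w \<inter> B)"
proof -
  let ?Std = "{\<alpha>\<in>layer M (exponents M) m. monomial X M f \<alpha> \<notin> fun_space.span
     (monomial X M f ` {\<beta>\<in>layer M (exponents M) m. monomial_key M w \<beta> < monomial_key M w \<alpha>})}"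
  have inj: "inj_on (monomial_key M w) (layer M (exponents M) m)"
    by (rule inj_on_subset[OF monomial_key_inj]) (auto simp: layer_def)
  have eq: "?Std \<inter> B = standard_exponents X M f w \<inter> B"
    using assms(1) by (auto simp: standard_exponents_def layer_def)
  have g: "inj_on (monomial X M f) (standard_exponents X M f w \<inter> B) \<and>
      fun_space.independent (monomial X M f ` (standard_exponents X M f w \<inter> B)) \<and>
      fun_space.span (monomial X M f ` (standard_exponents X M f w \<inter> B))
      = fun_space.span (monomial X M f ` B)"
    using greedy_basis[OF finite_layer_exponents inj refl assms(1), where u = "monomial X M f", unfolded eq]
      assms(2) by blast
  show "inj_on (monomial X M f) (standard_exponents X M f w \<inter> B)"
    "fun_space.independent (monomial X M f ` (standard_exponents X M f w \<inter> B))"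
    using g by auto
  then have "fun_space.dim (fun_space.span (monomial X M f ` (standard_exponents X M f w \<inter> B)))
      = card (standard_exponents X M f w \<inter> B)"
    using fun_space.dim_span_eq_card_independent card_image by fastforce
  then show "fun_space.dim (fun_space.span (monomial X M f ` B)) = card (standard_exponents X M f w \<inter> B)"
    using g by argo
qed

lemma dim_weight_piece:
  "fun_space.dim (weight_piece X M f w m i)
     = card {\<alpha>\<in>layer M (standard_exponents X M f w) m. wt M w \<alpha> \<le> i}"
proof -
  have "fun_space.dim (weight_piece X M f w m i)
      = card (standard_exponents X M f w \<inter> {\<alpha>\<in>layer M (exponents M) m. wt M w \<alpha> \<le> i})"
    unfolding weight_piece_def
    by (rule dim_down_closed_span) (auto simp: monomial_key_def)
  also have "standard_exponents X M f w \<inter> {\<alpha>\<in>layer M (exponents M) m. wt M w \<alpha> \<le> i}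
      = {\<alpha>\<in>layer M (standard_exponents X M f w) m. wt M w \<alpha> \<le> i}"
    by (auto simp: standard_exponents_def layer_def)
  finally show ?thesis .
qed

lemma independent_standard_monomials:
  "independent_family (layer M (standard_exponents X M f w) m) (monomial X M f)"
proof -
  have "standard_exponents X M f w \<inter> layer M (exponents M) m = layer M (standard_exponents X M f w) m"
    by (auto simp: standard_exponents_def layer_def)
  moreover have "finite (layer M (standard_exponents X M f w) m)"
    by (rule finite_layer) (auto simp: standard_exponents_def)
  ultimately show ?thesis
    using dim_down_closed_span(1,2)[of "layer M (exponents M) m" M m w X f]
    by (auto simp: independent_family_iff)
qed

lemma weight_piece_mult:
  assumes "g \<in> weight_piece X M f w a i" "h \<in> weight_piece X M f w b j"
  shows "g * h \<in> weight_piece X M f w (a + b) (i + j)"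
  using assms unfolding weight_piece_def
proof (rule span_times_span)
  fix x y
  assume "x \<in> monomial X M f ` {\<alpha>\<in>layer M (exponents M) a. wt M w \<alpha> \<le> i}"
    "y \<in> monomial X M f ` {\<alpha>\<in>layer M (exponents M) b. wt M w \<alpha> \<le> j}"
  then show "x * y \<in> fun_space.span (monomial X M f ` {\<alpha>\<in>layer M (exponents M) (a + b). wt M w \<alpha> \<le> i + j})"
    by (auto simp: layer_def monomial_add[symmetric] exponents_add mdeg_add wt_add
        intro!: fun_space.span_base imageI)
qed

lemma weight_piece_mono: "i \<le> j \<Longrightarrow> weight_piece X M f w m i \<subseteq> weight_piece X M f w m j"
  unfolding weight_piece_def by (intro fun_space.span_mono) auto

lemma weight_piece_unit: "(\<lambda>v. if v \<in> X then 1 else 0) \<in> weight_piece X M f w 0 0"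
proof -
  have "monomial X M f 0 = (\<lambda>v. if v \<in> X then 1 else 0)" by (auto simp: monomial_def)
  moreover have "0 \<in> {\<alpha>\<in>layer M (exponents M) 0. wt M w \<alpha> \<le> 0}"
    by (simp add: layer_def exponents_def mdeg_def wt_def)
  ultimately have "(\<lambda>v. if v \<in> X then 1 else 0)
      \<in> monomial X M f ` {\<alpha>\<in>layer M (exponents M) 0. wt M w \<alpha> \<le> 0}"
    by (intro image_eqI[of _ _ 0]) simp_all
  then show ?thesis unfolding weight_piece_def by (rule fun_space.span_base)
qed

text \<open>This serves to compare two filtrations: the \<open>g j\<close> are elements of the pieces of one of them whose
  weights come from the generators of the other.\<close>

lemma weight_piece_monomial:
  assumes g: "\<And>j. j < K \<Longrightarrow> g j \<in> weight_piece X M f w 1 (u j)"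
  shows "monomial X K g \<alpha> \<in> weight_piece X M f w (mdeg K \<alpha>) (wt K u \<alpha>)"
  using g
proof (induction K)
  case 0
  have "monomial X 0 g \<alpha> = (\<lambda>v. if v \<in> X then 1 else 0)" by (auto simp: monomial_def)
  then show ?case using weight_piece_unit[of X M f w] by (simp add: mdeg_def wt_def)
next
  case (Suc K)
  have pow: "(\<lambda>v. if v \<in> X then g K v ^ n else 0) \<in> weight_piece X M f w n (u K * n)" for n
  proof (induction n)
    case 0
    then show ?case using weight_piece_unit[of X M f w] by (simp only: power_0 mult_0_right)
  next
    case (Suc n)
    have gK: "g K \<in> weight_piece X M f w 1 (u K)" using Suc.prems \<open>\<And>j. j < Suc K \<Longrightarrow> _ j\<close> by simp
    have "(\<lambda>v. if v \<in> X then g K v ^ Suc n else 0) = g K * (\<lambda>v. if v \<in> X then g K v ^ n else 0)"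
      by (auto simp: fun_eq_iff)
    then show ?case using weight_piece_mult[OF gK Suc] by (simp add: algebra_simps)
  qed
  have "monomial X (Suc K) g \<alpha> = monomial X K g \<alpha> * (\<lambda>v. if v \<in> X then g K v ^ \<alpha> K else 0)"
    by (auto simp: fun_eq_iff monomial_def)
  moreover have "monomial X K g \<alpha> \<in> weight_piece X M f w (mdeg K \<alpha>) (wt K u \<alpha>)"
    using Suc.prems by (intro Suc.IH) simp
  ultimately show ?case
    using weight_piece_mult[OF _ pow, of "monomial X K g \<alpha>"]
    by (simp only: mdeg_def wt_def sum.lessThan_Suc)
qed

section \<open>The coordinate ring\<close>

lemma poly_funs_span_products:
  fixes C :: "('a \<Rightarrow> complex) set"
  shows "p \<in> poly_funs C \<Longrightarrow> p \<in> fun_space.span (prod_list ` lists C)"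
proof (induction rule: poly_funs.induct)
  case (const c)
  have "(\<lambda>_::'a. c) = fscale c (prod_list [])" by (simp add: fscale_def fun_eq_iff)
  moreover have "fscale c (prod_list []) \<in> fun_space.span (prod_list ` lists C)"
    by (intro fun_space.span_scale fun_space.span_base imageI) simp
  ultimately show ?case by argo
next
  case (coord f)
  then show ?case by (intro fun_space.span_base image_eqI[of _ _ "[f]"]) auto
next
  case (add f g)
  then show ?case using fun_space.span_add[of f _ g] by (simp add: plus_fun_def)
next
  case (mult f g)
  have "f * g \<in> fun_space.span (prod_list ` lists C)"
  proof (rule span_times_span[OF mult.IH])
    fix a b assume "a \<in> prod_list ` lists C" "b \<in> prod_list ` lists C"
    then obtain xs ys where "xs \<in> lists C" "ys \<in> lists C" "a * b = prod_list (xs @ ys)" by auto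
    then show "a * b \<in> fun_space.span (prod_list ` lists C)"
      by (auto intro!: fun_space.span_base imageI simp del: prod_list.append)
  qed
  then show ?case by (simp add: times_fun_def)
qed

definition coordinates :: "('n::finite) sect set" where
  "coordinates = range (\<lambda>i v. v $ i)"

lemma product_homogeneous:
  "fs \<in> lists coordinates \<Longrightarrow> prod_list fs (c *s v) = c ^ length fs * prod_list fs v"
  by (induction fs) (auto simp: coordinates_def)

lemma product_poly_funs: "fs \<in> lists coordinates \<Longrightarrow> prod_list fs \<in> poly_funs coordinates"
proof (induction fs)
  case Nil
  then show ?case using poly_funs.const[of 1] by (simp add: one_fun_def)
next
  case (Cons f fs)
  then show ?case
    using poly_funs.mult[of f coordinates "prod_list fs"] by (simp add: times_fun_def poly_funs.coord)
qed

lemma product_hom_polys: "fs \<in> lists coordinates \<Longrightarrow> prod_list fs \<in> hom_polys (length fs)"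
  unfolding hom_polys_def
  using product_poly_funs[of fs] product_homogeneous[of fs] by (simp add: coordinates_def)

lemma subspace_hom_polys: "fun_space.subspace (hom_polys k)"
proof (rule fun_space.subspaceI)
  show "0 \<in> hom_polys k"
    using poly_funs.const[of 0] by (simp add: hom_polys_def zero_fun_def)
  show "x + y \<in> hom_polys k" if "x \<in> hom_polys k" "y \<in> hom_polys k" for x y :: "'n::finite sect"
    using that poly_funs.add[of x _ y] by (simp add: hom_polys_def plus_fun_def distrib_left)
  show "fscale c x \<in> hom_polys k" if "x \<in> hom_polys k" for c and x :: "'n::finite sect"
    using that poly_funs.mult[OF poly_funs.const[of c], of x]
    by (auto simp add: hom_polys_def fscale_def)
qed

lemma poly_eq_zero_of_punctured:
  fixes P :: "complex poly"
  assumes "\<And>c. c \<noteq> 0 \<Longrightarrow> poly P c = 0"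
  shows "P = 0"
proof (rule ccontr)
  assume "P \<noteq> 0"
  then have "finite {c. poly P c = 0}" by (rule poly_roots_finite)
  then have "finite (insert 0 {c. poly P c = 0})" by simp
  moreover have "insert 0 {c. poly P c = 0} = UNIV" using assms by auto
  ultimately show False using infinite_UNIV_char_0[where 'a = complex] by simp
qed

text \<open>Compare the coefficients of the two sides as polynomials in the scaling factor \<open>c\<close>.\<close>

lemma homogeneous_part:
  fixes g :: "nat \<Rightarrow> complex"
  assumes "finite K" "\<And>c. c \<noteq> 0 \<Longrightarrow> (\<Sum>k\<in>K. c ^ k * g k) = c ^ d * y"
  shows "y = (if d \<in> K then g d else 0)"
proof -
  define P where "P = (\<Sum>k\<in>K. monom (g k) k) - monom y d"
  have "P = 0"
    by (rule poly_eq_zero_of_punctured)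
       (use assms(2) in \<open>simp add: P_def poly_sum poly_monom mult.commute\<close>)
  then have "coeff P d = 0" by simp
  then show ?thesis using assms(1) by (cases "d \<in> K") (simp_all add: P_def coeff_sum)
qed

text \<open>Expand a polynomial into products of coordinates; homogeneity forces it to equal its part of
  degree \<open>k\<close>.\<close>

lemma hom_polys_eq_span:
  "(hom_polys k :: ('n::finite) sect set) = fun_space.span (prod_list ` {fs\<in>lists coordinates. length fs = k})"
proof
  show "fun_space.span (prod_list ` {fs\<in>lists coordinates. length fs = k})
      \<subseteq> (hom_polys k :: 'n sect set)"
    by (rule fun_space.span_minimal[OF _ subspace_hom_polys]) (use product_hom_polys in auto)
  show "(hom_polys k :: 'n sect set)
      \<subseteq> fun_space.span (prod_list ` {fs\<in>lists coordinates. length fs = k})"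
  proof
    fix p :: "'n sect" assume p: "p \<in> hom_polys k"
    then have "p \<in> fun_space.span (prod_list ` lists coordinates)"
      by (intro poly_funs_span_products) (simp add: hom_polys_def coordinates_def)
    then obtain t a where t: "finite t" "t \<subseteq> prod_list ` lists coordinates"
      and p_eq: "p = (\<Sum>x\<in>t. fscale (a x) x)"
      unfolding fun_space.span_explicit by blast
    obtain T where T: "T \<subseteq> lists coordinates" "inj_on prod_list T" "t = prod_list ` T"
      using t(2) subset_image_inj by metis
    have "finite T" using T(2,3) t(1) by (simp add: finite_image_iff)
    have p_eq': "p v = (\<Sum>fs\<in>T. a (prod_list fs) * prod_list fs v)" for v
      unfolding p_eq T(3) sum.reindex[OF T(2)] by (simp add: sum_fun_apply fscale_def)
    define K where "K = length ` T"
    define q where "q d = (\<Sum>fs\<in>{fs\<in>T. length fs = d}. fscale (a (prod_list fs)) (prod_list fs))" for d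
    have "p v = (if k \<in> K then q k v else 0)" for v
    proof (rule homogeneous_part)
      show "finite K" using \<open>finite T\<close> by (simp add: K_def)
      fix c :: complex assume "c \<noteq> 0"
      have "(\<Sum>d\<in>K. c ^ d * q d v)
          = (\<Sum>d\<in>K. \<Sum>fs\<in>{fs\<in>T. length fs = d}. c ^ length fs * (a (prod_list fs) * prod_list fs v))"
        by (simp add: q_def sum_fun_apply fscale_def sum_distrib_left)
      also have "\<dots> = (\<Sum>fs\<in>T. c ^ length fs * (a (prod_list fs) * prod_list fs v))"
        unfolding K_def using \<open>finite T\<close> by (subst sum.image_gen[symmetric]) auto
      also have "\<dots> = (\<Sum>fs\<in>T. a (prod_list fs) * prod_list fs (c *s v))"
        by (intro sum.cong refl) (simp add: product_homogeneous[OF subsetD[OF T(1)]])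
      also have "\<dots> = c ^ k * p v"
        using p by (simp add: p_eq'[symmetric] hom_polys_def)
      finally show "(\<Sum>d\<in>K. c ^ d * q d v) = c ^ k * p v" .
    qed
    then have "p = (if k \<in> K then q k else 0)" by auto
    moreover have "q k \<in> fun_space.span (prod_list ` {fs\<in>lists coordinates. length fs = k})"
      unfolding q_def using T(1)
      by (auto intro!: fun_space.span_sum fun_space.span_scale intro: fun_space.span_base)
    ultimately show "p \<in> fun_space.span (prod_list ` {fs\<in>lists coordinates. length fs = k})"
      by (auto simp: fun_space.span_zero)
  qed
qed

definition restrict_to :: "'a set \<Rightarrow> ('a \<Rightarrow> complex) \<Rightarrow> 'a \<Rightarrow> complex" where
  "restrict_to X p = (\<lambda>v. if v \<in> X then p v else 0)"

lemma restrict_to_mult: "restrict_to X p * restrict_to X q = restrict_to X (p * q)"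
  by (auto simp: restrict_to_def)

lemma restrict_to_span: "restrict_to X ` fun_space.span S = fun_space.span (restrict_to X ` S)"
  by (rule module_hom.span_image[OF module_homI, symmetric])
     (auto simp: restrict_to_def fscale_def)

locale polarised_cone =
  fixes X :: "(complex^'n::finite) set"
  assumes X: "polarised_variety X"
begin

lemma cone_scale:
  assumes "v \<in> X" "c \<noteq> 0" shows "c *s v \<in> X"
proof -
  obtain S where S: "S \<subseteq> (\<Union>k. hom_polys k)" "X = {v. v \<noteq> 0 \<and> (\<forall>p\<in>S. p v = 0)}"
    using X by (auto simp: polarised_variety_def projective_variety_def proj_closed_def)
  have "p (c *s v) = 0" if "p \<in> S" for p
  proof -
    from that obtain k where "p \<in> hom_polys k" using S(1) by blast
    then show ?thesis using assms(1) that by (auto simp: S(2) hom_polys_def)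
  qed
  moreover have "c *s v \<noteq> 0" using assms by (simp add: S(2))
  ultimately show ?thesis by (simp add: S(2))
qed

text \<open>This is projective normality. Polynomials are sections because the denominator may be 1.\<close>

lemma sections_eq_restrict: "sections X k = restrict_to X ` hom_polys k"
proof
  show "sections X k \<subseteq> restrict_to X ` hom_polys k"
  proof
    fix f assume f: "f \<in> sections X k"
    then have "\<exists>p\<in>hom_polys k. \<forall>v\<in>X. f v = p v"
      using X unfolding polarised_variety_def projectively_normal_def by blast
    then obtain p where p: "p \<in> hom_polys k" "\<forall>v\<in>X. f v = p v" by blast
    have "f = restrict_to X p" using f p(2) by (auto simp: sections_def restrict_to_def)
    then show "f \<in> restrict_to X ` hom_polys k" using p(1) by blast
  qed
  show "restrict_to X ` hom_polys k \<subseteq> sections X k"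
  proof clarify
    fix p :: "'n sect" assume p: "p \<in> hom_polys k"
    have "(\<lambda>_. 1) \<in> hom_polys 0"
      using poly_funs.const[of 1] by (simp add: hom_polys_def)
    then have "\<forall>v\<in>X. \<exists>d. \<exists>p'\<in>hom_polys (d + k). \<exists>q\<in>hom_polys d.
            q v \<noteq> 0 \<and> (\<forall>u\<in>X. q u \<noteq> 0 \<longrightarrow> restrict_to X p u = p' u / q u)"
      using p by (intro ballI exI[of _ 0] bexI[of _ p] bexI[of _ "\<lambda>_. 1"]) (auto simp: restrict_to_def)
    then show "restrict_to X p \<in> sections X k"
      by (simp add: sections_def restrict_to_def)
  qed
qed

text \<open>Keeping the monomials as lists of coordinates makes the factorisation of a monomial of degree
  \<open>a + b\<close> into factors of degrees \<open>a\<close> and \<open>b\<close> a splitting of lists.\<close>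

definition "section_gens k =
  restrict_to X ` prod_list ` {fs\<in>lists coordinates. length fs = k}"

lemma finite_section_gens: "finite (section_gens k)"
proof -
  have "finite (coordinates :: 'n sect set)" by (simp add: coordinates_def)
  then have "finite {fs :: 'n sect list. set fs \<subseteq> coordinates \<and> length fs = k}"
    by (rule finite_lists_length_eq)
  moreover have "{fs\<in>lists coordinates. length fs = k}
      = {fs :: 'n sect list. set fs \<subseteq> coordinates \<and> length fs = k}"
    by auto
  ultimately show ?thesis unfolding section_gens_def by (intro finite_imageI) argo
qed

lemma sections_eq_span: "sections X k = fun_space.span (section_gens k)"
  unfolding section_gens_def sections_eq_restrict hom_polys_eq_span by (rule restrict_to_span)

lemma subspace_sections: "fun_space.subspace (sections X k)"
  unfolding sections_eq_span by (rule fun_space.subspace_span)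

lemma sections_vanish: "f \<in> sections X k \<Longrightarrow> v \<notin> X \<Longrightarrow> f v = 0"
  by (simp add: sections_def)

lemma sections_homogeneous:
  assumes "f \<in> sections X k" "v \<in> X" "c \<noteq> 0"
  shows "f (c *s v) = c ^ k * f v"
  using assms cone_scale[OF assms(2,3)]
  by (auto simp: sections_eq_restrict restrict_to_def hom_polys_def)

lemma section_gens_mult: "g \<in> section_gens a \<Longrightarrow> h \<in> section_gens b \<Longrightarrow> g * h \<in> section_gens (a + b)"
proof -
  assume "g \<in> section_gens a" "h \<in> section_gens b"
  then obtain xs ys where xs: "xs \<in> lists coordinates" "length xs = a" "g = restrict_to X (prod_list xs)"
    and ys: "ys \<in> lists coordinates" "length ys = b" "h = restrict_to X (prod_list ys)"
    by (auto simp: section_gens_def)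
  have "g * h = restrict_to X (prod_list (xs @ ys))"
    unfolding xs(3) ys(3) restrict_to_mult prod_list.append ..
  moreover have "xs @ ys \<in> {fs\<in>lists coordinates. length fs = a + b}" using xs ys by auto
  ultimately show "g * h \<in> section_gens (a + b)" unfolding section_gens_def by blast
qed

lemma sections_mult:
  assumes "f \<in> sections X a" "g \<in> sections X b"
  shows "f * g \<in> sections X (a + b)"
  using assms unfolding sections_eq_span
  by (rule span_times_span) (intro fun_space.span_base section_gens_mult)

lemma section_gens_split:
  assumes "g \<in> section_gens (a + b)"
  obtains x y where "x \<in> section_gens a" "y \<in> section_gens b" "g = x * y"
proof -
  obtain fs where fs: "fs \<in> lists coordinates" "length fs = a + b" "g = restrict_to X (prod_list fs)"
    using assms by (auto simp: section_gens_def)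
  have "take a fs \<in> {fs\<in>lists coordinates. length fs = a}"
    "drop a fs \<in> {fs\<in>lists coordinates. length fs = b}"
    using fs by (auto simp: dest: in_set_takeD in_set_dropD)
  moreover have "g = restrict_to X (prod_list (take a fs)) * restrict_to X (prod_list (drop a fs))"
    unfolding restrict_to_mult prod_list.append[symmetric] append_take_drop_id fs(3) ..
  ultimately show ?thesis using that unfolding section_gens_def by blast
qed

lemma sections_0: "sections X 0 = fun_space.span {restrict_to X 1}"
proof -
  have "{fs\<in>lists coordinates. length fs = 0} = {[]::'n sect list}" by auto
  then show ?thesis unfolding sections_eq_span section_gens_def by simp
qed

lemma const_sections: "(\<lambda>v. if v \<in> X then c else 0) \<in> sections X 0"
proof -
  have "(\<lambda>v. if v \<in> X then c else 0) = fscale c (restrict_to X 1)"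
    by (auto simp: fscale_def restrict_to_def)
  then show ?thesis
    unfolding sections_0 by (simp only:) (intro fun_space.span_scale fun_space.span_base, simp)
qed

lemma sections_disjoint:
  assumes "f \<in> sections X 0" "f \<in> sections X r" "r \<ge> 1" shows "f = 0"
proof
  fix v
  show "f v = 0 v"
  proof (cases "v \<in> X")
    case True
    have "f (2 *s v) = f v" "f (2 *s v) = 2 ^ r * f v"
      using sections_homogeneous[OF assms(1) True, of 2] sections_homogeneous[OF assms(2) True, of 2] by auto
    then have "(2 ^ r - 1) * f v = 0" by (simp add: algebra_simps)
    moreover have "(2::complex) ^ r \<noteq> 1"
    proof
      assume "(2::complex) ^ r = 1"
      then have "norm ((2::complex) ^ r) = 1" by simp
      then have "(2::real) ^ r = 1" by (simp add: norm_power)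
      moreover have "(1::real) < 2 ^ r" using assms(3) by (intro one_less_power) auto
      ultimately show False by simp
    qed
    ultimately show ?thesis by simp
  qed (use assms(1) sections_vanish in auto)
qed

text \<open>The graded pieces are linearly independent, so that homogeneous components can be extracted from
  spans of graded subsets.\<close>

lemma homogeneous_component:
  assumes T: "\<And>k. fun_space.subspace (T k)" "\<And>k. T k \<subseteq> sections X k"
    and x: "x \<in> fun_space.span (\<Union>k. T k)" "x \<in> sections X d"
  shows "x \<in> T d"
proof -
  have "\<exists>K g. finite K \<and> (\<forall>k. g k \<in> T k) \<and> x = (\<Sum>k\<in>K. g k)"
    using x(1)
  proof (induction rule: fun_space.span_induct_alt)
    case base
    show ?case
      using fun_space.subspace_0[OF T(1)] by (intro exI[of _ "{}"] exI[of _ "\<lambda>_. 0"]) (simp add: zero_fun_def)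
  next
    case (step c a y)
    then obtain K g where K: "finite K" "\<And>k. g k \<in> T k" "y = (\<Sum>k\<in>K. g k)" by blast
    obtain l where l: "a \<in> T l" using step by blast
    define g' where "g' k = (if k = l then fscale c a + (if l \<in> K then g l else 0) else g k)" for k
    have "g' k \<in> T k" for k
      using K(2) l unfolding g'_def
      by (auto intro!: fun_space.subspace_add fun_space.subspace_scale fun_space.subspace_0 T(1))
    moreover have "fscale c a + y = (\<Sum>k\<in>insert l K. g' k)"
    proof -
      have "(\<Sum>k\<in>insert l K. g' k) = g' l + (\<Sum>k\<in>K - {l}. g k)"
        using K(1) by (simp add: sum.insert_remove g'_def)
      moreover have "y = (if l \<in> K then g l else 0) + (\<Sum>k\<in>K - {l}. g k)"
        using K(1) by (auto simp: K(3) sum.remove)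
      ultimately show ?thesis by (auto simp: g'_def add.assoc)
    qed
    ultimately show ?case using K(1) by (intro exI[of _ "insert l K"] exI[of _ g']) simp
  qed
  then obtain K g where K: "finite K" "\<And>k. g k \<in> T k" "x = (\<Sum>k\<in>K. g k)" by blast
  have "x v = (if d \<in> K then g d else 0) v" for v
  proof (cases "v \<in> X")
    case True
    have "x v = (if d \<in> K then g d v else 0)"
    proof (rule homogeneous_part[OF K(1)])
      fix c :: complex assume c: "c \<noteq> 0"
      have "(\<Sum>k\<in>K. c ^ k * g k v) = (\<Sum>k\<in>K. g k (c *s v))"
        using K(2) T(2) by (intro sum.cong refl sections_homogeneous[OF _ True c, symmetric]) blast
      also have "\<dots> = x (c *s v)" by (simp add: K(3) sum_fun_apply)
      also have "\<dots> = c ^ d * x v" by (rule sections_homogeneous[OF x(2) True c])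
      finally show "(\<Sum>k\<in>K. c ^ k * g k v) = c ^ d * x v" .
    qed
    then show ?thesis by auto
  next
    case False
    then show ?thesis
      using sections_vanish[OF x(2)] sections_vanish[of "g d" d] K(2) T(2) by (auto simp: subset_iff)
  qed
  then have "x = (if d \<in> K then g d else 0)" by blast
  then show ?thesis using K(2) fun_space.subspace_0[OF T(1)] by (auto split: if_splits)
qed

end

section \<open>Approximations by weighted monomials\<close>

lemma power_fun_apply: "(f ^ n) x = (f x ^ n :: 'b::monoid_mult)"
  by (induction n) auto

definition unit_exponent :: "nat \<Rightarrow> nat \<Rightarrow> nat" where
  "unit_exponent j = (\<lambda>i. if i = j then 1 else 0)"

lemma layer_exponents_1: "layer M (exponents M) 1 = unit_exponent ` {..<M}"
proof
  show "layer M (exponents M) 1 \<subseteq> unit_exponent ` {..<M}"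
  proof
    fix \<alpha> assume "\<alpha> \<in> layer M (exponents M) 1"
    then have \<alpha>: "\<alpha> \<in> exponents M" "(\<Sum>i<M. \<alpha> i) = Suc 0" by (auto simp: layer_def mdeg_def)
    then obtain j where j: "j < M" "\<alpha> j = 1" "\<forall>i<M. i \<noteq> j \<longrightarrow> \<alpha> i = 0"
      by (auto simp: sum_eq_Suc0_iff)
    have "\<alpha> = unit_exponent j"
    proof
      fix i show "\<alpha> i = unit_exponent j i"
        using j \<alpha>(1) by (cases "i < M") (auto simp: unit_exponent_def exponents_def)
    qed
    then show "\<alpha> \<in> unit_exponent ` {..<M}" using j(1) by blast
  qed
  show "unit_exponent ` {..<M} \<subseteq> layer M (exponents M) 1"
    by (auto simp: layer_def exponents_def mdeg_def unit_exponent_def)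
qed

lemma wt_unit_exponent: "j < M \<Longrightarrow> wt M w (unit_exponent j) = w j"
  by (simp add: wt_def unit_exponent_def if_distrib cong: if_cong)

lemma monomial_unit_exponent:
  assumes "j < M" "\<And>v. v \<notin> X \<Longrightarrow> f j v = 0"
  shows "monomial X M f (unit_exponent j) = f j"
proof
  fix v
  have "(\<Prod>i<M. f i v ^ unit_exponent j i) = (\<Prod>i<M. if i = j then f i v else 1)"
    by (rule prod.cong) (auto simp: unit_exponent_def)
  then show "monomial X M f (unit_exponent j) v = f j v"
    using assms by (simp add: monomial_def)
qed

lemma weight_piece_1:
  assumes "\<And>j v. j < M \<Longrightarrow> v \<notin> X \<Longrightarrow> f j v = 0"
  shows "weight_piece X M f w 1 i = fun_space.span (f ` {j. j < M \<and> w j \<le> i})"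
proof -
  have "{\<alpha>\<in>layer M (exponents M) 1. wt M w \<alpha> \<le> i} = unit_exponent ` {j. j < M \<and> w j \<le> i}"
    unfolding layer_exponents_1 by (auto simp: wt_unit_exponent)
  moreover have "(\<lambda>j. monomial X M f (unit_exponent j)) ` {j. j < M \<and> w j \<le> i} = f ` {j. j < M \<and> w j \<le> i}"
    using assms by (intro image_cong refl monomial_unit_exponent) auto
  ultimately show ?thesis by (simp add: weight_piece_def image_image)
qed

lemma filtration_mono: "filtration X F \<Longrightarrow> i \<le> j \<Longrightarrow> F i \<subseteq> F j"
  by (rule lift_Suc_mono_le[of F]) (auto simp: filtration_def)

context polarised_cone
begin

definition exhaustion_index :: "(nat \<Rightarrow> 'n sect set) \<Rightarrow> nat \<Rightarrow> nat" where
  "exhaustion_index F r = (LEAST N. F N \<inter> sections X r = sections X r)"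

lemma filtration_ge_exhaustion_index:
  assumes F: "filtration X F" and i: "exhaustion_index F r \<le> i"
  shows "F i \<inter> sections X r = sections X r"
proof -
  have "\<exists>N. F N \<inter> sections X r = sections X r" using F by (simp add: filtration_def)
  then have "F (exhaustion_index F r) \<inter> sections X r = sections X r" unfolding exhaustion_index_def by (rule LeastI_ex)
  then show ?thesis using filtration_mono[OF F i] by blast
qed

lemma subspace_filtration_piece:
  assumes "filtration X F" shows "fun_space.subspace (F i \<inter> sections X k)"
  using assms subspace_sections by (intro fun_space.subspace_inter) (auto simp: filtration_def)

lemma finite_spanning_set:
  assumes "fun_space.subspace V" "V \<subseteq> sections X k"
  obtains B where "finite B" "B \<subseteq> V" "fun_space.span B = V"
proof -
  obtain B where B: "B \<subseteq> V" "fun_space.independent B" "V \<subseteq> fun_space.span B"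
    by (rule fun_space.basis_exists)
  have "B \<subseteq> fun_space.span (section_gens k)" using B(1) assms(2) by (simp add: sections_eq_span)
  then have "finite B"
    using fun_space.independent_span_bound[OF finite_section_gens B(2)] by blast
  moreover have "fun_space.span B = V"
    using B(1,3) fun_space.span_minimal[OF B(1) assms(1)] by blast
  ultimately show ?thesis using B(1) that by blast
qed

lemma filtration_0_piece:
  assumes "filtration X F" "r \<ge> 1" shows "F 0 \<inter> sections X r = {0}"
proof -
  have "F 0 = sections X 0" using assms(1) by (simp add: filtration_def)
  moreover have "0 \<in> F 0 \<inter> sections X r"
    by (rule fun_space.subspace_0[OF subspace_filtration_piece[OF assms(1)]])
  ultimately show ?thesis using sections_disjoint[OF _ _ assms(2)] by blast
qed

end

text \<open>A presentation of the filtration in degree \<open>r\<close> by finitely many weighted elements. The weights are at most the index where the filtration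
  of \<open>R\<^sub>r\<close> is exhausted, since the algebra of the approximation has generators only up to there.\<close>

locale weighted_generators = polarised_cone X for X :: "(complex^'n::finite) set" +
  fixes F :: "nat \<Rightarrow> 'n sect set" and r M :: nat and f :: "nat \<Rightarrow> 'n sect" and w :: "nat \<Rightarrow> nat"
  assumes F: "filtration X F" and r: "r \<ge> 1"
    and gen: "\<And>j. j < M \<Longrightarrow> 1 \<le> w j \<and> w j \<le> exhaustion_index F r \<and> f j \<in> F (w j) \<inter> sections X r"
    and span_gen: "\<And>i. fun_space.span (f ` {j. j < M \<and> w j \<le> i}) = F i \<inter> sections X r"

text \<open>Take a spanning set of every piece up to the exhaustion of \<open>R\<^sub>r\<close>, with its index as weight. The piece
  0 needs no generators, as it consists of constants and \<open>r\<close> is positive.\<close>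

lemma (in polarised_cone) weighted_generators_exist:
  assumes F: "filtration X F" and r: "r \<ge> 1"
  shows "\<exists>M f w. weighted_generators X F r M f w"
proof -
  have "\<exists>B. finite B \<and> B \<subseteq> F i \<inter> sections X r \<and> fun_space.span B = F i \<inter> sections X r" for i
    by (rule finite_spanning_set[OF subspace_filtration_piece[OF F] inf_le2]) blast
  then obtain B where B: "\<And>i. finite (B i)" "\<And>i. B i \<subseteq> F i \<inter> sections X r"
    "\<And>i. fun_space.span (B i) = F i \<inter> sections X r"
    by metis
  define I where "I = (SIGMA i:{1..exhaustion_index F r}. B i)"
  have "finite I" unfolding I_def using B(1) by simp
  then obtain e where e: "bij_betw e {..<card I} I"
    using ex_bij_betw_nat_finite[of I] by (auto simp: atLeast0LessThan)
  define f where "f j = snd (e j)" for j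
  define w where "w j = fst (e j)" for j
  have eI: "e j \<in> I" if "j < card I" for j using e that by (auto simp: bij_betw_def)
  have 1: "1 \<le> w j \<and> w j \<le> exhaustion_index F r \<and> f j \<in> F (w j) \<inter> sections X r" if "j < card I" for j
    using eI[OF that] B(2)[of "w j"] by (auto simp: I_def w_def f_def)
  have "weighted_generators X F r (card I) f w"
  proof unfold_locales
    show "filtration X F" "1 \<le> r" by (rule F, rule r)
    show "1 \<le> w j \<and> w j \<le> exhaustion_index F r \<and> f j \<in> F (w j) \<inter> sections X r" if "j < card I" for j
      using 1[OF that] .
    fix i
    show "fun_space.span (f ` {j. j < card I \<and> w j \<le> i}) = F i \<inter> sections X r"
    proof
      show "fun_space.span (f ` {j. j < card I \<and> w j \<le> i}) \<subseteq> F i \<inter> sections X r"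
        by (rule fun_space.span_minimal[OF _ subspace_filtration_piece[OF F]])
           (use 1 filtration_mono[OF F] in blast)
      define i' where "i' = min i (exhaustion_index F r)"
      have piece: "F i \<inter> sections X r = F i' \<inter> sections X r"
        using filtration_ge_exhaustion_index[OF F, of r] by (cases "i \<le> exhaustion_index F r") (simp_all add: i'_def)
      show "F i \<inter> sections X r \<subseteq> fun_space.span (f ` {j. j < card I \<and> w j \<le> i})"
      proof (cases "i' = 0")
        case True
        then show ?thesis
          unfolding piece using filtration_0_piece[OF F r] fun_space.span_zero by auto
      next
        case False
        have "B i' \<subseteq> f ` {j. j < card I \<and> w j \<le> i}"
        proof
          fix b assume "b \<in> B i'"
          then have "(i', b) \<in> I" using False by (auto simp: I_def i'_def)
          then have "(i', b) \<in> e ` {..<card I}" using e by (simp add: bij_betw_def)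
          then obtain j where "j < card I" "e j = (i', b)" by (metis imageE lessThan_iff)
          then show "b \<in> f ` {j. j < card I \<and> w j \<le> i}"
            by (intro image_eqI[of _ _ j]) (auto simp: f_def w_def i'_def)
        qed
        then have "fun_space.span (B i') \<subseteq> fun_space.span (f ` {j. j < card I \<and> w j \<le> i})"
          by (rule fun_space.span_mono)
        then show ?thesis unfolding piece B(3) .
      qed
    qed
  qed
  then show ?thesis by blast
qed

context weighted_generators
begin

abbreviation "N \<equiv> exhaustion_index F r"
abbreviation "mon \<equiv> monomial X M f"
abbreviation "piece \<equiv> weight_piece X M f w"

lemma gen_vanish: "j < M \<Longrightarrow> v \<notin> X \<Longrightarrow> f j v = 0"
  using gen sections_vanish by blast

lemma piece_1: "piece 1 i = F i \<inter> sections X r"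
  using weight_piece_1[of M X f w i] gen_vanish span_gen by simp

lemma mon_sections:
  shows "mon \<alpha> \<in> sections X (r * mdeg M \<alpha>)"
proof -
  have pow: "restrict_to X (f j ^ n) \<in> sections X (r * n)" if "j < M" for j n
  proof (induction n)
    case 0
    then show ?case using const_sections[of 1] by (simp add: restrict_to_def)
  next
    case (Suc n)
    have "restrict_to X (f j ^ Suc n) = f j * restrict_to X (f j ^ n)"
      using gen_vanish[OF that] by (auto simp: restrict_to_def fun_eq_iff)
    moreover have "f j * restrict_to X (f j ^ n) \<in> sections X (r + r * n)"
      using sections_mult[OF _ Suc] gen[OF that] by blast
    ultimately show ?case by (simp only: mult_Suc_right)
  qed
  have "monomial X K f \<alpha> \<in> sections X (r * mdeg K \<alpha>)" if "K \<le> M" for K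
    using that
  proof (induction K)
    case 0
    have "monomial X 0 f \<alpha> = (\<lambda>v. if v \<in> X then 1 else 0)" by (auto simp: monomial_def)
    then show ?case using const_sections[of 1] by (simp add: mdeg_def)
  next
    case (Suc K)
    have "monomial X (Suc K) f \<alpha> = monomial X K f \<alpha> * restrict_to X (f K ^ \<alpha> K)"
      by (auto simp: monomial_def restrict_to_def fun_eq_iff power_fun_apply)
    moreover have "monomial X K f \<alpha> * restrict_to X (f K ^ \<alpha> K)
        \<in> sections X (r * mdeg K \<alpha> + r * \<alpha> K)"
      using Suc by (intro sections_mult pow) simp_all
    ultimately show ?case by (simp only: mdeg_def sum.lessThan_Suc distrib_left)
  qed
  then show ?thesis by simp
qed

lemma piece_sections: "piece m i \<subseteq> sections X (r * m)"
  unfolding weight_piece_def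
  by (rule fun_space.span_minimal[OF _ subspace_sections]) (use mon_sections in \<open>auto simp: layer_def\<close>)

text \<open>Elements of degree \<open>r m\<close> are sums of products of \<open>m\<close> elements of \<open>R\<^sub>r\<close>, and those have weight at most
  \<open>N\<close>.\<close>

lemma sections_multiple: "sections X (r * m) = piece m (N * m)"
proof
  show "sections X (r * m) \<subseteq> piece m (N * m)"
  proof (induction m)
    case 0
    have "restrict_to X 1 = (\<lambda>v. if v \<in> X then 1 else 0)" by (auto simp: restrict_to_def)
    then have "restrict_to X 1 \<in> piece 0 0" using weight_piece_unit[of X M f w] by argo
    then have "fun_space.span {restrict_to X 1} \<subseteq> piece 0 0"
      by (intro fun_space.span_minimal) (auto simp: weight_piece_def)
    then show ?case by (simp only: mult_0_right sections_0)
  next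
    case (Suc m)
    have "section_gens (r + r * m) \<subseteq> piece (1 + m) (N + N * m)"
    proof
      fix g assume "g \<in> section_gens (r + r * m)"
      then obtain x y where xy: "x \<in> section_gens r" "y \<in> section_gens (r * m)" "g = x * y"
        by (rule section_gens_split)
      have "x \<in> piece 1 N"
        unfolding piece_1 filtration_ge_exhaustion_index[OF F order.refl]
        using xy(1) by (simp add: sections_eq_span fun_space.span_base)
      moreover have "y \<in> piece m (N * m)"
        using Suc xy(2) by (auto simp: sections_eq_span intro: fun_space.span_base)
      ultimately show "g \<in> piece (1 + m) (N + N * m)" unfolding xy(3) by (rule weight_piece_mult)
    qed
    then have "fun_space.span (section_gens (r + r * m)) \<subseteq> piece (1 + m) (N + N * m)"
      by (rule fun_space.span_minimal) (simp add: weight_piece_def)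
    then show ?case by (simp add: sections_eq_span algebra_simps)
  qed
qed (rule piece_sections)

text \<open>The algebra of the approximation is also generated by \<open>R\<^sub>1\<close> in weight \<open>N\<close>, so its elements of degree \<open>k\<close>
  and weight \<open>i\<close> are combinations of these products. They include degrees that are not multiples
  of \<open>r\<close>, which makes them closed under multiplication.\<close>

definition "mixed k i = {mon \<alpha> * g | \<alpha> g a. \<alpha> \<in> exponents M \<and> g \<in> sections X a \<and>
   a + r * mdeg M \<alpha> = k \<and> N * a + wt M w \<alpha> \<le> i}"

lemma mixed_mult:
  assumes "x \<in> mixed k i" "y \<in> mixed l j" shows "x * y \<in> mixed (k + l) (i + j)"
proof -
  obtain \<alpha> g a where x: "x = mon \<alpha> * g" "\<alpha> \<in> exponents M" "g \<in> sections X a"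
    "a + r * mdeg M \<alpha> = k" "N * a + wt M w \<alpha> \<le> i"
    using assms(1) unfolding mixed_def by blast
  obtain \<beta> h b where y: "y = mon \<beta> * h" "\<beta> \<in> exponents M" "h \<in> sections X b"
    "b + r * mdeg M \<beta> = l" "N * b + wt M w \<beta> \<le> j"
    using assms(2) unfolding mixed_def by blast
  have "x * y = mon (\<alpha> + \<beta>) * (g * h)" unfolding x(1) y(1) monomial_add by (simp only: mult_ac)
  moreover have "(a + b) + r * mdeg M (\<alpha> + \<beta>) = k + l"
    unfolding mdeg_add using x(4) y(4) by (simp add: algebra_simps)
  moreover have "N * (a + b) + wt M w (\<alpha> + \<beta>) \<le> i + j"
    unfolding wt_add using x(5) y(5) by (simp add: algebra_simps)
  ultimately show ?thesis
    unfolding mixed_def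
    using exponents_add[OF x(2) y(2)] sections_mult[OF x(3) y(3)] by blast
qed

lemma mixed_sections: "mixed k i \<subseteq> sections X k"
proof
  fix x assume "x \<in> mixed k i"
  then obtain \<alpha> g a where x: "x = mon \<alpha> * g" "g \<in> sections X a" "a + r * mdeg M \<alpha> = k"
    unfolding mixed_def by blast
  show "x \<in> sections X k"
    using sections_mult[OF mon_sections[of \<alpha>] x(2)] by (simp add: x(1,3)[symmetric] add.commute)
qed

lemma mixed_zeroI:
  assumes "g \<in> sections X a" "N * a \<le> i" shows "g \<in> mixed a i"
proof -
  have "mon 0 * g = g"
    using sections_vanish[OF assms(1)] by (auto simp: monomial_def fun_eq_iff)
  moreover have "(0 :: nat \<Rightarrow> nat) \<in> exponents M" by (simp add: exponents_def)
  moreover have "mdeg M 0 = 0" "wt M w 0 = 0" by (simp_all add: mdeg_def wt_def)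
  ultimately show ?thesis
    unfolding mixed_def using assms by (intro CollectI exI[of _ 0] exI[of _ g] exI[of _ a]) simp
qed

lemma piece_mixed: "piece m i \<subseteq> fun_space.span (mixed (r * m) i)"
  unfolding weight_piece_def
proof (intro fun_space.span_mono subsetI)
  fix x assume "x \<in> mon ` {\<alpha>\<in>layer M (exponents M) m. wt M w \<alpha> \<le> i}"
  then obtain \<alpha> where \<alpha>: "x = mon \<alpha>" "\<alpha> \<in> exponents M" "mdeg M \<alpha> = m" "wt M w \<alpha> \<le> i"
    by (auto simp: layer_def)
  have "mon \<alpha> * (\<lambda>v. if v \<in> X then 1 else 0) = mon \<alpha>"
    by (auto simp: monomial_def fun_eq_iff)
  then show "x \<in> mixed (r * m) i"
    unfolding mixed_def using \<alpha> const_sections[of 1]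
    by (intro CollectI exI[of _ \<alpha>] exI[of _ "\<lambda>v. if v \<in> X then 1 else 0"] exI[of _ 0]) simp
qed

text \<open>In a degree divisible by \<open>r\<close> the degree of the factor \<open>g\<close> is a multiple \<open>r b\<close> too. As a product of elements
  of degree one it has weight \<open>N r b\<close>, whereas as a product of \<open>b\<close> elements of \<open>R\<^sub>r\<close> it only needs
  weight \<open>N b\<close>; so the generators of degree one contribute nothing new.\<close>

lemma mixed_piece: "mixed (r * m) i \<subseteq> piece m i"
proof
  fix x assume "x \<in> mixed (r * m) i"
  then obtain \<alpha> g a where x: "x = mon \<alpha> * g" "\<alpha> \<in> exponents M" "g \<in> sections X a"
    "a + r * mdeg M \<alpha> = r * m" "N * a + wt M w \<alpha> \<le> i"
    unfolding mixed_def by blast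
  define b where "b = m - mdeg M \<alpha>"
  have "r * mdeg M \<alpha> \<le> r * m" using x(4) by linarith
  then have "mdeg M \<alpha> \<le> m" using r by simp
  then have m: "m = mdeg M \<alpha> + b" by (simp add: b_def)
  then have a: "a = r * b" using x(4) by (simp add: algebra_simps)
  have "b \<le> a" using r by (simp add: a)
  then have le: "wt M w \<alpha> + N * b \<le> i" using x(5) mult_le_mono2[of b a N] by linarith
  have "mon \<alpha> \<in> piece (mdeg M \<alpha>) (wt M w \<alpha>)"
    unfolding weight_piece_def using x(2) by (intro fun_space.span_base imageI) (simp add: layer_def)
  moreover have "g \<in> piece b (N * b)" using x(3) by (simp add: a sections_multiple)
  ultimately have "x \<in> piece m (wt M w \<alpha> + N * b)" unfolding x(1) m by (rule weight_piece_mult)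
  then show "x \<in> piece m i" using weight_piece_mono[OF le] by blast
qed

lemma approx_algebra_coeff:
  assumes "p \<in> approx_algebra X F r"
  shows "coeff p i \<in> fun_space.span (\<Union>k. mixed k i)"
proof -
  have "p \<in> Ct_subalgebra X ((\<lambda>f. monom f N) ` sections X 1 \<union>
            (\<Union>i\<in>{1..N}. (\<lambda>f. monom f i) ` (F i \<inter> sections X r)))"
    using assms by (simp add: approx_algebra_def exhaustion_index_def Let_def)
  then show ?thesis
  proof (induction arbitrary: i rule: Ct_subalgebra.induct)
    case (scalar c j)
    have "(\<lambda>v. if v \<in> X then c else 0) \<in> mixed 0 i" by (rule mixed_zeroI[OF const_sections]) simp
    then show ?case
      by (cases "i = j") (auto simp: zero_fun_def[symmetric] fun_space.span_zero intro!: fun_space.span_base)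
  next
    case (gen p)
    then consider (linear) g where "g \<in> sections X 1" "p = monom g N"
      | (piece) j g where "g \<in> F j \<inter> sections X r" "p = monom g j"
      by blast
    then show ?case
    proof cases
      case linear
      have "g \<in> mixed 1 N" by (rule mixed_zeroI[OF linear(1)]) simp
      then show ?thesis
        by (cases "i = N") (auto simp: linear(2) zero_fun_def[symmetric] fun_space.span_zero intro!: fun_space.span_base)
    next
      case piece
      have "g \<in> fun_space.span (mixed (r * 1) j)" using piece(1) piece_1 piece_mixed by blast
      moreover have "fun_space.span (mixed (r * 1) j) \<subseteq> fun_space.span (\<Union>k. mixed k j)"
        by (rule fun_space.span_mono) blast
      ultimately show ?thesis
        by (cases "i = j") (auto simp: piece(2) zero_fun_def[symmetric] fun_space.span_zero)
    qed
  next
    case (add p q)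
    then show ?case unfolding coeff_add by (intro fun_space.span_add)
  next
    case (mult p q)
    have "coeff p j * coeff q (i - j) \<in> fun_space.span (\<Union>k. mixed k i)" if "j \<in> {..i}" for j
    proof (rule span_times_span[OF mult.IH])
      fix a b assume "a \<in> (\<Union>k. mixed k j)" "b \<in> (\<Union>k. mixed k (i - j))"
      then obtain k l where "a \<in> mixed k j" "b \<in> mixed l (i - j)" by blast
      then have "a * b \<in> mixed (k + l) (j + (i - j))" by (rule mixed_mult)
      then have "a * b \<in> mixed (k + l) i" using that by simp
      then show "a * b \<in> fun_space.span (\<Union>k. mixed k i)" by (blast intro: fun_space.span_base)
    qed
    then show ?case unfolding coeff_mult by (rule fun_space.span_sum)
  qed
qed

lemma scalar_approx: "monom (\<lambda>v. if v \<in> X then c else 0) j \<in> approx_algebra X F r"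
  unfolding approx_algebra_def Let_def by (rule Ct_subalgebra.scalar)

lemma add_approx:
  "p \<in> approx_algebra X F r \<Longrightarrow> q \<in> approx_algebra X F r \<Longrightarrow> p + q \<in> approx_algebra X F r"
  unfolding approx_algebra_def Let_def by (rule Ct_subalgebra.add)

lemma mult_approx:
  "p \<in> approx_algebra X F r \<Longrightarrow> q \<in> approx_algebra X F r \<Longrightarrow> p * q \<in> approx_algebra X F r"
  unfolding approx_algebra_def Let_def by (rule Ct_subalgebra.mult)

lemma gen_approx: "j < M \<Longrightarrow> monom (f j) (w j) \<in> approx_algebra X F r"
  unfolding approx_algebra_def Let_def
  by (rule Ct_subalgebra.gen) (use gen[of j] in \<open>auto simp: exhaustion_index_def\<close>)

lemma mon_approx:
  assumes "wt M w \<alpha> \<le> i" shows "monom (mon \<alpha>) i \<in> approx_algebra X F r"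
proof -
  have pow: "monom (restrict_to X (f j ^ n)) (w j * n) \<in> approx_algebra X F r" if "j < M" for j n
  proof (induction n)
    case 0
    have "restrict_to X (f j ^ 0) = (\<lambda>v. if v \<in> X then 1 else 0)" by (auto simp: restrict_to_def)
    then show ?case using scalar_approx[of 1 0] by (simp only: mult_0_right)
  next
    case (Suc n)
    have "restrict_to X (f j ^ Suc n) = f j * restrict_to X (f j ^ n)"
      using gen_vanish[OF that] by (auto simp: restrict_to_def fun_eq_iff)
    then have "monom (restrict_to X (f j ^ Suc n)) (w j * Suc n)
        = monom (f j) (w j) * monom (restrict_to X (f j ^ n)) (w j * n)"
      by (simp only: mult_monom mult_Suc_right)
    then show ?case using mult_approx[OF gen_approx[OF that] Suc] by argo
  qed
  have "monom (monomial X K f \<alpha>) (wt K w \<alpha>) \<in> approx_algebra X F r" if "K \<le> M" for K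
    using that
  proof (induction K)
    case 0
    have "monomial X 0 f \<alpha> = (\<lambda>v. if v \<in> X then 1 else 0)" by (auto simp: monomial_def)
    then show ?case using scalar_approx[of 1 0] by (simp add: wt_def)
  next
    case (Suc K)
    have "monomial X (Suc K) f \<alpha> = monomial X K f \<alpha> * restrict_to X (f K ^ \<alpha> K)"
      by (auto simp: monomial_def restrict_to_def fun_eq_iff power_fun_apply)
    then have "monom (monomial X (Suc K) f \<alpha>) (wt (Suc K) w \<alpha>)
        = monom (monomial X K f \<alpha>) (wt K w \<alpha>) * monom (restrict_to X (f K ^ \<alpha> K)) (w K * \<alpha> K)"
      by (simp only: mult_monom wt_def sum.lessThan_Suc)
    then show ?case using mult_approx[OF Suc.IH pow] Suc.prems by simp
  qed
  then have "monom (mon \<alpha>) (wt M w \<alpha>) \<in> approx_algebra X F r" by simp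
  from mult_approx[OF this scalar_approx[of 1 "i - wt M w \<alpha>"]]
  have "monom (mon \<alpha> * (\<lambda>v. if v \<in> X then 1 else 0)) i \<in> approx_algebra X F r"
    using assms by (simp add: mult_monom)
  moreover have "mon \<alpha> * (\<lambda>v. if v \<in> X then 1 else 0) = mon \<alpha>"
    by (auto simp: monomial_def fun_eq_iff)
  ultimately show ?thesis by argo
qed

text \<open>For the inclusion from left to right, take the homogeneous component of degree \<open>r m\<close> of an
  expansion into mixed products.\<close>

lemma approx_piece: "approx X F r i \<inter> sections X (r * m) = piece m i"
proof
  show "approx X F r i \<inter> sections X (r * m) \<subseteq> piece m i"
  proof
    fix s assume s: "s \<in> approx X F r i \<inter> sections X (r * m)"
    then have "coeff (monom s i) i \<in> fun_space.span (\<Union>k. mixed k i)"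
      by (intro approx_algebra_coeff) (simp add: approx_def)
    then have "s \<in> fun_space.span (\<Union>k. mixed k i)" by simp
    moreover have "fun_space.span (\<Union>k. mixed k i) \<subseteq> fun_space.span (\<Union>k. fun_space.span (mixed k i))"
      by (intro fun_space.span_mono UN_mono order.refl fun_space.span_superset)
    ultimately have "s \<in> fun_space.span (\<Union>k. fun_space.span (mixed k i))" by blast
    then have "s \<in> fun_space.span (mixed (r * m) i)"
      using s by (intro homogeneous_component[where T = "\<lambda>k. fun_space.span (mixed k i)"]
          fun_space.subspace_span fun_space.span_minimal mixed_sections subspace_sections) simp_all
    moreover have "fun_space.span (mixed (r * m) i) \<subseteq> piece m i"
      by (rule fun_space.span_minimal[OF mixed_piece]) (simp add: weight_piece_def)
    ultimately show "s \<in> piece m i" by blast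
  qed
  show "piece m i \<subseteq> approx X F r i \<inter> sections X (r * m)"
  proof
    fix s assume s: "s \<in> piece m i"
    then have sec: "s \<in> sections X (r * m)" using piece_sections by blast
    then have "s \<in> coord_ring X"
      unfolding coord_ring_def by (intro fun_space.span_base) blast
    moreover have "monom s i \<in> approx_algebra X F r"
      using s unfolding weight_piece_def
    proof (induction rule: fun_space.span_induct_alt)
      case base
      have "(0 :: 'n sect) = (\<lambda>v. if v \<in> X then 0 else 0)" by auto
      then show ?case using scalar_approx[of 0 i] by argo
    next
      case (step c x y)
      obtain \<alpha> where \<alpha>: "x = mon \<alpha>" "wt M w \<alpha> \<le> i" using step by auto
      have "fscale c x = (\<lambda>v. if v \<in> X then c else 0) * mon \<alpha>"
        by (auto simp: fscale_def \<alpha>(1) monomial_def fun_eq_iff)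
      then have "monom (fscale c x + y) i
          = monom (\<lambda>v. if v \<in> X then c else 0) 0 * monom (mon \<alpha>) i + monom y i"
        by (simp only: mult_monom add_monom add_0)
      then show ?case
        using add_approx[OF mult_approx[OF scalar_approx[of c 0] mon_approx[OF \<alpha>(2)]] step(2)] by argo
    qed
    ultimately show "s \<in> approx X F r i \<inter> sections X (r * m)" using sec by (simp add: approx_def)
  qed
qed

end

section \<open>The Hilbert function is bounded by the dimension\<close>

abbreviation power_product :: "nat \<Rightarrow> (nat \<Rightarrow> nat) \<Rightarrow> (nat \<Rightarrow> complex) \<Rightarrow> complex" where
  "power_product m \<equiv> monomial UNIV m (\<lambda>j s. s j)"

lemma power_product_apply: "power_product m \<beta> s = (\<Prod>j<m. s j ^ \<beta> j)"
  by (simp add: monomial_def)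

lemma poly_funs_power_products:
  assumes "G \<in> poly_funs ((\<lambda>j s. s j) ` {..<m})"
  shows "G \<in> fun_space.span (power_product m ` exponents m)"
  using assms
proof (induction rule: poly_funs.induct)
  case (const c)
  have "(\<lambda>_. c) = fscale c (power_product m 0)" by (auto simp: fscale_def monomial_def)
  moreover have "fscale c (power_product m 0) \<in> fun_space.span (power_product m ` exponents m)"
    by (intro fun_space.span_scale fun_space.span_base imageI) (simp add: exponents_def)
  ultimately show ?case by argo
next
  case (coord f)
  then obtain j where j: "j < m" "f = (\<lambda>s. s j)" by auto
  then have "power_product m (unit_exponent j) = f" by (subst monomial_unit_exponent) auto
  moreover have "unit_exponent j \<in> exponents m" using j(1) by (auto simp: unit_exponent_def exponents_def)
  ultimately show ?case by (intro fun_space.span_base) blast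
next
  case (add f g)
  then show ?case using fun_space.span_add[of f _ g] by (simp add: plus_fun_def)
next
  case (mult f g)
  have "f * g \<in> fun_space.span (power_product m ` exponents m)"
    by (rule span_times_span[OF mult.IH])
       (auto simp: monomial_add[symmetric] intro!: fun_space.span_base imageI exponents_add simp del: plus_fun_apply)
  then show ?case by (simp add: times_fun_def)
qed

lemma power_product_poly_funs: "power_product m \<beta> \<in> poly_funs ((\<lambda>j s. s j) ` {..<m})"
proof -
  have pow: "(\<lambda>s. s j ^ n) \<in> poly_funs ((\<lambda>j s. s j) ` {..<m})" if "j < m" for j n
  proof (induction n)
    case 0
    show ?case using poly_funs.const[of 1] by simp
  next
    case (Suc n)
    then show ?case
      using poly_funs.mult[OF poly_funs.coord[of "\<lambda>s. s j"] Suc] that by simp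
  qed
  have "(\<lambda>s. \<Prod>j<k. s j ^ \<beta> j) \<in> poly_funs ((\<lambda>j s. s j) ` {..<m})" if "k \<le> m" for k
    using that
  proof (induction k)
    case 0
    show ?case using poly_funs.const[of 1] by simp
  next
    case (Suc k)
    then show ?case using poly_funs.mult[OF Suc.IH pow[of k]] by simp
  qed
  then show ?thesis by (simp add: monomial_def)
qed

lemma poly_funs_sum:
  "(\<And>i. i \<in> I \<Longrightarrow> g i \<in> poly_funs C) \<Longrightarrow> (\<lambda>x. \<Sum>i\<in>I. c i * g i x) \<in> poly_funs C"
proof (induction I rule: infinite_finite_induct)
  case (insert i I)
  have "(\<lambda>x. c i * g i x + (\<Sum>i\<in>I. c i * g i x)) \<in> poly_funs C"
    by (rule poly_funs.add[OF poly_funs.mult[OF poly_funs.const]]) (use insert in auto)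
  then show ?case using insert.hyps by simp
qed (simp_all add: poly_funs.const)

text \<open>Induction on the number of variables: as a polynomial in the last variable, a vanishing combination
  has vanishing coefficients.\<close>

lemma independent_power_products:
  assumes "finite B" "B \<subseteq> exponents m"
  shows "independent_family B (power_product m)"
  using assms
proof (induction m arbitrary: B)
  case 0
  then have B: "B \<subseteq> {\<lambda>_. 0}" by (auto simp: exponents_def)
  show ?case
    unfolding independent_family_def
  proof (intro allI impI ballI)
    fix c \<beta> assume "\<forall>x. (\<Sum>i\<in>B. c i * power_product 0 i x) = 0" "\<beta> \<in> B"
    moreover from this B have "B = {\<lambda>_. 0}" by blast
    ultimately show "c \<beta> = 0" by (simp add: power_product_apply)
  qed
next
  case (Suc m)
  show ?case
    unfolding independent_family_def
  proof (intro allI impI ballI)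
    fix c \<beta>
    assume 0: "\<forall>s. (\<Sum>\<alpha>\<in>B. c \<alpha> * power_product (Suc m) \<alpha> s) = 0" and \<beta>: "\<beta> \<in> B"
    define k where "k = \<beta> m"
    define g where "g l s = (\<Sum>\<alpha>\<in>{\<alpha>\<in>B. \<alpha> m = l}. c \<alpha> * power_product m \<alpha> s)" for l s
    have g0: "g k s = 0" for s
    proof -
      have "0 = (if k \<in> (\<lambda>\<alpha>. \<alpha> m) ` B then g k s else 0)"
      proof (rule homogeneous_part[where d = k])
        show "finite ((\<lambda>\<alpha>. \<alpha> m) ` B)" using Suc.prems by simp
        fix z :: complex
        have "(\<Sum>l\<in>(\<lambda>\<alpha>. \<alpha> m) ` B. z ^ l * g l s)
            = (\<Sum>l\<in>(\<lambda>\<alpha>. \<alpha> m) ` B. \<Sum>\<alpha>\<in>{\<alpha>\<in>B. \<alpha> m = l}. z ^ \<alpha> m * (c \<alpha> * power_product m \<alpha> s))"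
          by (simp add: g_def sum_distrib_left)
        also have "\<dots> = (\<Sum>\<alpha>\<in>B. z ^ \<alpha> m * (c \<alpha> * power_product m \<alpha> s))"
          using Suc.prems(1) by (subst sum.image_gen[symmetric]) auto
        also have "\<dots> = (\<Sum>\<alpha>\<in>B. c \<alpha> * power_product (Suc m) \<alpha> (s(m := z)))"
          by (rule sum.cong) (simp_all add: power_product_apply)
        also have "\<dots> = z ^ k * 0" using 0 by simp
        finally show "(\<Sum>l\<in>(\<lambda>\<alpha>. \<alpha> m) ` B. z ^ l * g l s) = z ^ k * 0" .
      qed
      then show ?thesis using \<beta> by (auto simp: k_def)
    qed
    define B' where "B' = (\<lambda>\<alpha>. \<alpha>(m := 0)) ` {\<alpha>\<in>B. \<alpha> m = k}"
    have inj: "inj_on (\<lambda>\<alpha>. \<alpha>(m := 0)) {\<alpha>\<in>B. \<alpha> m = k}"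
    proof (rule inj_onI)
      fix \<alpha> \<alpha>' assume *: "\<alpha> \<in> {\<alpha>\<in>B. \<alpha> m = k}" "\<alpha>' \<in> {\<alpha>\<in>B. \<alpha> m = k}" "\<alpha>(m := 0) = \<alpha>'(m := 0)"
      have "\<alpha> = (\<alpha>(m := 0))(m := k)" using *(1) by auto
      also have "\<dots> = (\<alpha>'(m := 0))(m := k)" by (simp only: *(3))
      also have "\<dots> = \<alpha>'" using *(2) by auto
      finally show "\<alpha> = \<alpha>'" .
    qed
    have "independent_family B' (power_product m)"
    proof (rule Suc.IH)
      show "finite B'" using Suc.prems(1) by (simp add: B'_def)
      show "B' \<subseteq> exponents m" using Suc.prems(2) by (force simp: B'_def exponents_def Suc_le_eq)
    qed
    moreover have "(\<Sum>\<alpha>\<in>B'. c (\<alpha>(m := k)) * power_product m \<alpha> s) = 0" for s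
    proof -
      have "(\<Sum>\<alpha>\<in>B'. c (\<alpha>(m := k)) * power_product m \<alpha> s) = g k s"
        unfolding B'_def g_def sum.reindex[OF inj]
        by (rule sum.cong) (auto simp: power_product_apply fun_upd_idem)
      then show ?thesis using g0 by simp
    qed
    ultimately have "\<forall>\<alpha>\<in>B'. c (\<alpha>(m := k)) = 0"
      unfolding independent_family_def
      by (drule_tac spec[of _ "\<lambda>\<alpha>. c (\<alpha>(m := k))"]) blast
    moreover have "\<beta>(m := 0) \<in> B'" using \<beta> by (auto simp: B'_def k_def)
    ultimately have "c ((\<beta>(m := 0))(m := k)) = 0" by blast
    then show "c \<beta> = 0" by (simp add: k_def)
  qed
qed

context polarised_cone
begin

definition independent_ratios :: "nat \<Rightarrow> (nat \<Rightarrow> 'n sect) \<Rightarrow> (nat \<Rightarrow> 'n sect) \<Rightarrow> bool" where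
  "independent_ratios m p q \<longleftrightarrow>
     (\<forall>j<m. (\<exists>e. p j \<in> hom_polys e \<and> q j \<in> hom_polys e) \<and> (\<exists>v\<in>X. q j v \<noteq> 0)) \<and>
     alg_indep_on X m p q"

lemma variety_dim_eq: "variety_dim X = (GREATEST m. \<exists>p q. independent_ratios m p q)"
  by (simp add: variety_dim_def independent_ratios_def)

end

context weighted_generators
begin

abbreviation "Std \<equiv> standard_exponents X M f w"

lemma finite_Std_layer: "finite (layer M Std m)"
  by (rule finite_layer) (auto simp: standard_exponents_def)

lemma wt_le: "wt M w \<alpha> \<le> N * mdeg M \<alpha>"
  unfolding wt_def mdeg_def sum_distrib_left
  by (rule sum_mono) (use gen in \<open>auto intro: mult_le_mono1\<close>)

lemma hilb_multiple: "hilb X (r * m) = card (layer M Std m)"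
proof -
  have "{\<alpha>\<in>layer M Std m. wt M w \<alpha> \<le> N * m} = layer M Std m"
    using wt_le by (auto simp: layer_def)
  then show ?thesis by (simp add: hilb_def sections_multiple dim_weight_piece)
qed

lemma hilb_multiple_le: "hilb X (r * m) \<le> (m + 1) ^ M"
proof -
  have "card (layer M Std m) \<le> card (layer M (exponents M) m)"
    by (intro card_mono finite_layer_exponents) (auto simp: layer_def standard_exponents_def)
  then show ?thesis using card_layer_exponents_le[of M m] by (simp add: hilb_multiple)
qed

text \<open>If all monomials in the generators indexed by \<open>S\<close> are standard, then they are linearly
  independent, which makes these generators algebraically independent; dividing by one of them
  gives rational functions on the variety.\<close>

lemma independent_ratios_of_coordinate_subspace:
  assumes S: "S \<subseteq> {..<M}" "coordinate_subspace S \<subseteq> Std" "card S = Suc m"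
  shows "\<exists>p q. independent_ratios m p q"
proof -
  have "finite S" using S(1) by (rule finite_subset) simp
  obtain s\<^sub>0 where s0: "s\<^sub>0 \<in> S" using S(3) by fastforce
  have "card (S - {s\<^sub>0}) = m" using S(3) s0 \<open>finite S\<close> by simp
  then obtain \<sigma> where \<sigma>: "bij_betw \<sigma> {..<m} (S - {s\<^sub>0})"
    using ex_bij_betw_nat_finite[of "S - {s\<^sub>0}"] \<open>finite S\<close> by (auto simp: atLeast0LessThan)
  have \<sigma>S: "\<sigma> j \<in> S" "\<sigma> j \<noteq> s\<^sub>0" if "j < m" for j
    using \<sigma> that by (auto simp: bij_betw_def)
  have "\<exists>P. P \<in> hom_polys r \<and> f i = restrict_to X P" if "i < M" for i
    using gen[OF that] by (auto simp: sections_eq_restrict)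
  then obtain P where P: "\<And>i. i < M \<Longrightarrow> P i \<in> hom_polys r" "\<And>i. i < M \<Longrightarrow> f i = restrict_to X (P i)"
    by metis
  have fP: "f i v = P i v" if "i \<in> S" "v \<in> X" for i v
    using P(2)[of i] S(1) that by (auto simp: restrict_to_def)
  define p where "p j = P (\<sigma> j)" for j
  define q where "q j = P s\<^sub>0" for j :: nat
  have nz: "\<exists>v\<in>X. P s\<^sub>0 v \<noteq> 0"
  proof (rule ccontr)
    assume "\<not> ?thesis"
    moreover have "f s\<^sub>0 = restrict_to X (P s\<^sub>0)" using P(2) S(1) s0 by blast
    ultimately have "f s\<^sub>0 = 0" by (auto simp: restrict_to_def)
    then have "mon (unit_exponent s\<^sub>0) = 0"
      using S(1) s0 gen_vanish by (subst monomial_unit_exponent) auto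
    moreover have "unit_exponent s\<^sub>0 \<in> coordinate_subspace S" using s0 by (auto simp: coordinate_subspace_def unit_exponent_def)
    then have "mon (unit_exponent s\<^sub>0) \<notin> fun_space.span
       (mon ` {\<beta>\<in>layer M (exponents M) (mdeg M (unit_exponent s\<^sub>0)).
          monomial_key M w \<beta> < monomial_key M w (unit_exponent s\<^sub>0)})"
      using S(2) by (auto simp: standard_exponents_def)
    ultimately show False using fun_space.span_zero by metis
  qed
  have "alg_indep_on X m p q"
    unfolding alg_indep_on_def
  proof (intro ballI impI)
    fix G :: "(nat \<Rightarrow> complex) \<Rightarrow> complex"
    assume G: "G \<in> poly_funs ((\<lambda>j s. s j) ` {..<m})"
      and van: "\<forall>v\<in>X. (\<forall>j<m. q j v \<noteq> 0) \<longrightarrow> G (\<lambda>j. p j v / q j v) = 0"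
    obtain t a where t: "finite t" "t \<subseteq> power_product m ` exponents m"
      and G_eq: "G = (\<Sum>x\<in>t. fscale (a x) x)"
      using poly_funs_power_products[OF G] unfolding fun_space.span_explicit by blast
    obtain B where B: "B \<subseteq> exponents m" "inj_on (power_product m) B" "t = power_product m ` B"
      using t(2) subset_image_inj by metis
    have "finite B" using B(2,3) t(1) by (simp add: finite_image_iff)
    define c where "c \<beta> = a (power_product m \<beta>)" for \<beta>
    have G_eq': "G s = (\<Sum>\<beta>\<in>B. c \<beta> * (\<Prod>j<m. s j ^ \<beta> j))" for s
      unfolding G_eq B(3) sum.reindex[OF B(2)]
      by (simp add: sum_fun_apply fscale_def c_def power_product_apply)
    \<comment> \<open>The exponent is larger than all degrees, so that clearing denominators leaves a multiple
      of the denominator, which also covers the points where it vanishes.\<close>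
    define d where "d = Suc (\<Sum>\<beta>\<in>B. mdeg m \<beta>)"
    have d: "mdeg m \<beta> < d" if "\<beta> \<in> B" for \<beta>
      using member_le_sum[OF that, of "mdeg m"] \<open>finite B\<close> by (simp add: d_def)
    define h where "h \<beta> i = (if i = s\<^sub>0 then d - mdeg m \<beta>
        else if i \<in> S then \<beta> (inv_into {..<m} \<sigma> i) else 0)" for \<beta> i
    have h\<sigma>: "h \<beta> (\<sigma> j) = \<beta> j" if "j < m" for \<beta> j
      using \<sigma>S[OF that] \<sigma> that by (simp add: h_def bij_betw_def inv_into_f_f)
    have prod_S: "(\<Prod>i<M. g i ^ h \<beta> i) = g s\<^sub>0 ^ (d - mdeg m \<beta>) * (\<Prod>j<m. g (\<sigma> j) ^ \<beta> j)"
      for g :: "nat \<Rightarrow> complex" and \<beta>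
    proof -
      have "(\<Prod>i<M. g i ^ h \<beta> i) = (\<Prod>i\<in>S. g i ^ h \<beta> i)"
        using S(1) s0 by (intro prod.mono_neutral_right) (auto simp: h_def)
      also have "\<dots> = g s\<^sub>0 ^ h \<beta> s\<^sub>0 * (\<Prod>i\<in>S - {s\<^sub>0}. g i ^ h \<beta> i)"
        by (rule prod.remove[OF \<open>finite S\<close> s0])
      also have "(\<Prod>i\<in>S - {s\<^sub>0}. g i ^ h \<beta> i) = (\<Prod>j<m. g (\<sigma> j) ^ h \<beta> (\<sigma> j))"
        by (rule prod.reindex_bij_betw[OF \<sigma>, symmetric])
      also have "\<dots> = (\<Prod>j<m. g (\<sigma> j) ^ \<beta> j)" by (rule prod.cong) (simp_all add: h\<sigma>)
      finally show ?thesis by (simp add: h_def)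
    qed
    have sum_S: "mdeg M (h \<beta>) = (d - mdeg m \<beta>) + mdeg m \<beta>" for \<beta>
    proof -
      have "mdeg M (h \<beta>) = (\<Sum>i\<in>S. h \<beta> i)"
        unfolding mdeg_def using S(1) s0 by (intro sum.mono_neutral_right) (auto simp: h_def)
      also have "\<dots> = h \<beta> s\<^sub>0 + (\<Sum>i\<in>S - {s\<^sub>0}. h \<beta> i)"
        by (rule sum.remove[OF \<open>finite S\<close> s0])
      also have "(\<Sum>i\<in>S - {s\<^sub>0}. h \<beta> i) = (\<Sum>j<m. h \<beta> (\<sigma> j))"
        by (rule sum.reindex_bij_betw[OF \<sigma>, symmetric])
      also have "\<dots> = mdeg m \<beta>" unfolding mdeg_def by (rule sum.cong) (simp_all add: h\<sigma>)
      also have "h \<beta> s\<^sub>0 = d - mdeg m \<beta>" by (simp add: h_def)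
      finally show ?thesis .
    qed
    have hB: "h ` B \<subseteq> layer M Std d"
    proof
      fix \<alpha> assume "\<alpha> \<in> h ` B"
      then obtain \<beta> where \<beta>: "\<beta> \<in> B" "\<alpha> = h \<beta>" by blast
      have "h \<beta> \<in> coordinate_subspace S" using s0 by (auto simp: coordinate_subspace_def h_def)
      then show "\<alpha> \<in> layer M Std d" using S(2) d[OF \<beta>(1)] by (auto simp: layer_def \<beta>(2) sum_S)
    qed
    have inj: "inj_on h B"
    proof (rule inj_onI, rule ext)
      fix \<beta> \<beta>' j assume *: "\<beta> \<in> B" "\<beta>' \<in> B" "h \<beta> = h \<beta>'"
      then have "\<beta> \<in> exponents m" "\<beta>' \<in> exponents m" using B(1) by auto
      then show "\<beta> j = \<beta>' j"
        using *(3) h\<sigma>[of j \<beta>] h\<sigma>[of j \<beta>'] by (cases "j < m") (simp_all add: exponents_def)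
    qed
    have rel: "(\<Sum>\<beta>\<in>B. c \<beta> * mon (h \<beta>) v) = 0" for v
    proof (cases "v \<in> X \<and> P s\<^sub>0 v \<noteq> 0")
      case True
      then have v: "v \<in> X" and nz: "P s\<^sub>0 v \<noteq> 0" by auto
      have "mon (h \<beta>) v = P s\<^sub>0 v ^ d * (\<Prod>j<m. (p j v / q j v) ^ \<beta> j)" if "\<beta> \<in> B" for \<beta>
      proof -
        have "mon (h \<beta>) v = P s\<^sub>0 v ^ (d - mdeg m \<beta>) * (\<Prod>j<m. P (\<sigma> j) v ^ \<beta> j)"
          using v \<sigma>S by (simp add: monomial_def prod_S fP s0)
        also have "P s\<^sub>0 v ^ (d - mdeg m \<beta>) = P s\<^sub>0 v ^ d / P s\<^sub>0 v ^ mdeg m \<beta>"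
          using nz d[OF that] by (simp add: power_diff)
        also have "P s\<^sub>0 v ^ mdeg m \<beta> = (\<Prod>j<m. P s\<^sub>0 v ^ \<beta> j)"
          by (simp add: mdeg_def power_sum)
        finally show ?thesis by (simp add: p_def q_def power_divide prod_dividef)
      qed
      then have "(\<Sum>\<beta>\<in>B. c \<beta> * mon (h \<beta>) v) = P s\<^sub>0 v ^ d * G (\<lambda>j. p j v / q j v)"
        by (simp add: G_eq' sum_distrib_left mult_ac)
      then show ?thesis using van v nz by (simp add: q_def)
    next
      case False
      have "mon (h \<beta>) v = 0" if "\<beta> \<in> B" for \<beta>
      proof (cases "v \<in> X")
        case True
        then show ?thesis using False d[OF that] by (simp add: monomial_def prod_S fP s0)
      qed (simp add: monomial_def)
      then show ?thesis by simp
    qed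
    have "c \<beta> = 0" if "\<beta> \<in> B" for \<beta>
    proof -
      define c' where "c' \<alpha> = (if \<alpha> \<in> h ` B then c (inv_into B h \<alpha>) else 0)" for \<alpha>
      have "(\<Sum>\<alpha>\<in>layer M Std d. c' \<alpha> * mon \<alpha> v) = 0" for v
      proof -
        have "(\<Sum>\<alpha>\<in>layer M Std d. c' \<alpha> * mon \<alpha> v) = (\<Sum>\<alpha>\<in>h ` B. c' \<alpha> * mon \<alpha> v)"
          using hB finite_Std_layer by (intro sum.mono_neutral_right) (auto simp: c'_def)
        also have "\<dots> = (\<Sum>\<beta>\<in>B. c \<beta> * mon (h \<beta>) v)"
          unfolding sum.reindex[OF inj] by (rule sum.cong) (simp_all add: c'_def inv_into_f_f[OF inj])
        finally show ?thesis using rel by simp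
      qed
      then have "\<forall>\<alpha>\<in>layer M Std d. c' \<alpha> = 0"
        using independent_standard_monomials unfolding independent_family_def by blast
      then have "c' (h \<beta>) = 0" using hB that by blast
      then show ?thesis using that by (simp add: c'_def inv_into_f_f[OF inj])
    qed
    then show "G = (\<lambda>_. 0)" by (auto simp: G_eq')
  qed
  moreover have "\<exists>e. p j \<in> hom_polys e \<and> q j \<in> hom_polys e" if "j < m" for j
    using P(1) \<sigma>S(1)[OF that] s0 S(1) by (auto simp: p_def q_def)
  ultimately have "independent_ratios m p q"
    using nz by (simp add: independent_ratios_def q_def)
  then show ?thesis by blast
qed

text \<open>Polynomials of degree at most \<open>D\<close> in each of \<open>m\<close> algebraically independent ratios have a common
  denominator, so they embed into one graded piece, whose dimension is known to be at most a power
  of \<open>D\<close> with fixed exponent \<open>M\<close>.\<close>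

lemma independent_ratios_le:
  assumes "independent_ratios m p q" shows "m \<le> M"
proof (rule ccontr)
  assume "\<not> m \<le> M"
  then have mM: "M + 1 \<le> m" by simp
  obtain e where e: "\<And>j. j < m \<Longrightarrow> p j \<in> hom_polys (e j)" "\<And>j. j < m \<Longrightarrow> q j \<in> hom_polys (e j)"
    using assms unfolding independent_ratios_def by metis
  define E where "E = (\<Sum>j<m. e j)"
  have bound: "(D + 1) ^ m \<le> (D * E + 1) ^ M" for D
  proof -
    \<comment> \<open>The multiple \<open>r D\<close> is used as degree bound so that the common degree is a multiple of \<open>r\<close>.\<close>
    define Box where "Box = {\<alpha>\<in>exponents m. \<forall>j<m. \<alpha> j \<le> r * D}"
    define \<Phi> where "\<Phi> \<alpha> = restrict_to X (\<lambda>v. \<Prod>j<m. p j v ^ \<alpha> j * q j v ^ (r * D - \<alpha> j))" for \<alpha>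
    have Box_eq: "Box = {\<alpha>. \<forall>j. (j \<in> {..<m} \<longrightarrow> \<alpha> j \<in> {..r * D}) \<and> (j \<notin> {..<m} \<longrightarrow> \<alpha> j = 0)}"
      unfolding Box_def exponents_def by (rule set_eqI) (simp, meson not_less)
    have fin: "finite Box"
      unfolding Box_eq by (rule finite_set_of_finite_funs) auto
    have "card (PiE {..<m} (\<lambda>_. {..r * D})) \<le> card Box"
    proof (rule card_inj_on_le[where f = "\<lambda>g j. if j < m then g j else 0"])
      show "inj_on (\<lambda>g j. if j < m then g j else 0) (PiE {..<m} (\<lambda>_. {..r * D}))"
      proof (rule inj_onI)
        fix g g' assume g: "g \<in> PiE {..<m} (\<lambda>_. {..r * D})" "g' \<in> PiE {..<m} (\<lambda>_. {..r * D})"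
          and eq: "(\<lambda>j. if j < m then g j else 0) = (\<lambda>j. if j < m then g' j else 0)"
        show "g = g'"
        proof (rule PiE_ext[OF g])
          fix j assume "j \<in> {..<m}"
          then show "g j = g' j" using fun_cong[OF eq, of j] by simp
        qed
      qed
      show "(\<lambda>g j. if j < m then g j else 0) ` PiE {..<m} (\<lambda>_. {..r * D}) \<subseteq> Box"
        unfolding Box_def exponents_def by (rule image_subsetI) (simp add: PiE_iff)
    qed (rule fin)
    then have card_Box: "(r * D + 1) ^ m \<le> card Box" by (simp add: card_PiE)
    have "independent_family Box \<Phi>"
      unfolding independent_family_def
    proof (intro allI impI)
      fix c assume 0: "\<forall>v. (\<Sum>\<alpha>\<in>Box. c \<alpha> * \<Phi> \<alpha> v) = 0"
      define G where "G s = (\<Sum>\<alpha>\<in>Box. c \<alpha> * power_product m \<alpha> s)" for s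
      have "G = (\<lambda>_. 0)"
      proof -
        have "G \<in> poly_funs ((\<lambda>j s. s j) ` {..<m})"
          unfolding G_def[abs_def] by (intro poly_funs_sum power_product_poly_funs)
        moreover have "G (\<lambda>j. p j v / q j v) = 0" if v: "v \<in> X" and nz: "\<forall>j<m. q j v \<noteq> 0" for v
        proof -
          have "\<Phi> \<alpha> v = (\<Prod>j<m. q j v ^ (r * D)) * power_product m \<alpha> (\<lambda>j. p j v / q j v)"
            if "\<alpha> \<in> Box" for \<alpha>
          proof -
            have "p j v ^ \<alpha> j * q j v ^ (r * D - \<alpha> j) = q j v ^ (r * D) * (p j v / q j v) ^ \<alpha> j"
              if "j < m" for j
            proof -
              have "\<alpha> j \<le> r * D" "q j v \<noteq> 0" using nz that \<open>\<alpha> \<in> Box\<close> by (auto simp: Box_def)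
              then have "q j v ^ (r * D) = q j v ^ (r * D - \<alpha> j) * q j v ^ \<alpha> j"
                by (simp only: power_add[symmetric]) simp
              then show ?thesis using \<open>q j v \<noteq> 0\<close> by (simp only: power_divide) simp
            qed
            then have "(\<Prod>j<m. p j v ^ \<alpha> j * q j v ^ (r * D - \<alpha> j))
                = (\<Prod>j<m. q j v ^ (r * D) * (p j v / q j v) ^ \<alpha> j)"
              by (intro prod.cong refl) simp
            then show ?thesis
              using v by (simp only: \<Phi>_def restrict_to_def power_product_apply prod.distrib if_True)
          qed
          then have "(\<Prod>j<m. q j v ^ (r * D)) * G (\<lambda>j. p j v / q j v) = (\<Sum>\<alpha>\<in>Box. c \<alpha> * \<Phi> \<alpha> v)"
            by (simp add: G_def sum_distrib_left mult_ac)
          then show ?thesis using 0 nz by simp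
        qed
        ultimately show ?thesis
          using assms unfolding independent_ratios_def alg_indep_on_def by blast
      qed
      then have "\<forall>s. (\<Sum>\<alpha>\<in>Box. c \<alpha> * power_product m \<alpha> s) = 0" by (simp add: G_def[symmetric])
      moreover have "independent_family Box (power_product m)"
        by (rule independent_power_products[OF fin]) (auto simp: Box_def)
      ultimately show "\<forall>\<alpha>\<in>Box. c \<alpha> = 0" unfolding independent_family_def by blast
    qed
    moreover have "\<Phi> ` Box \<subseteq> fun_space.span (section_gens (r * (D * E)))"
    proof clarify
      fix \<alpha> assume \<alpha>: "\<alpha> \<in> Box"
      have pw: "(\<lambda>v. g v ^ n) \<in> hom_polys (n * l)" if "g \<in> hom_polys l" for g :: "'n sect" and n l
      proof (induction n)
        case 0
        show ?case using poly_funs.const[of 1] by (simp add: hom_polys_def)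
      next
        case (Suc n)
        then show ?case
          using that poly_funs.mult[of g _ "\<lambda>v. g v ^ n"]
          by (simp add: hom_polys_def power_add power_mult_distrib power_mult[symmetric] mult_ac)
      qed
      have ml: "(\<lambda>v. g v * h v) \<in> hom_polys (k + l)" if "g \<in> hom_polys k" "h \<in> hom_polys l"
        for g h :: "'n sect" and k l
        using that poly_funs.mult[of g _ h] by (simp add: hom_polys_def power_add mult_ac)
      have "(\<lambda>v. \<Prod>j<k. p j v ^ \<alpha> j * q j v ^ (r * D - \<alpha> j)) \<in> hom_polys (\<Sum>j<k. r * D * e j)"
        if "k \<le> m" for k
        using that
      proof (induction k)
        case 0
        show ?case using poly_funs.const[of 1] by (simp add: hom_polys_def)
      next
        case (Suc k)
        have "\<alpha> k * e k + (r * D - \<alpha> k) * e k = r * D * e k"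
          using \<alpha> Suc.prems by (simp add: Box_def distrib_right[symmetric])
        then have "(\<lambda>v. p k v ^ \<alpha> k * q k v ^ (r * D - \<alpha> k)) \<in> hom_polys (r * D * e k)"
          using ml[OF pw[OF e(1)] pw[OF e(2)], of k k "\<alpha> k" "r * D - \<alpha> k"] Suc.prems by simp
        from ml[OF Suc.IH this] show ?case using Suc.prems by simp
      qed
      from this[of m] have "\<Phi> \<alpha> \<in> sections X (\<Sum>j<m. r * D * e j)"
        unfolding \<Phi>_def sections_eq_restrict by (intro imageI) simp
      then show "\<Phi> \<alpha> \<in> fun_space.span (section_gens (r * (D * E)))"
        by (simp add: sections_eq_span E_def sum_distrib_left mult.assoc)
    qed
    ultimately have "card Box \<le> hilb X (r * (D * E))"
      unfolding hilb_def sections_eq_span by (intro independent_family_le_dim fin finite_section_gens)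
    also have "\<dots> \<le> (D * E + 1) ^ M" by (rule hilb_multiple_le)
    finally have "(r * D + 1) ^ m \<le> (D * E + 1) ^ M" using card_Box by linarith
    moreover have "(D + 1) ^ m \<le> (r * D + 1) ^ m" using r by (intro power_mono) auto
    ultimately show ?thesis by linarith
  qed
  \<comment> \<open>The exponent \<open>m\<close> on the left exceeds \<open>M\<close>, so large \<open>D\<close> violate the bound.\<close>
  define D where "D = (E + 1) ^ M"
  have "(D + 1) ^ M * (D + 1) = (D + 1) ^ (M + 1)" by simp
  also have "\<dots> \<le> (D + 1) ^ m" using mM by (intro power_increasing) auto
  also have "\<dots> \<le> (D * E + 1) ^ M" by (rule bound)
  also have "\<dots> \<le> ((D + 1) * (E + 1)) ^ M" by (intro power_mono) auto
  also have "\<dots> = (D + 1) ^ M * D" by (simp only: power_mult_distrib D_def[symmetric])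
  finally show False by simp
qed

text \<open>The bound is what makes the greatest element in the definition of the dimension exist.\<close>

lemma independent_ratios_le_variety_dim:
  assumes "independent_ratios m p q" shows "m \<le> variety_dim X"
  unfolding variety_dim_eq using assms independent_ratios_le by (intro Greatest_le_nat) blast+

theorem hilb_growth: "\<exists>c. \<forall>m. hilb X (r * m) \<le> c * (m + 1) ^ variety_dim X"
  unfolding hilb_multiple
proof (rule order_ideal_growth[OF order_ideal_standard_exponents])
  fix S assume S: "S \<subseteq> {..<M}" "coordinate_subspace S \<subseteq> Std"
  show "card S \<le> Suc (variety_dim X)"
  proof (cases "card S")
    case (Suc m)
    then show ?thesis
      using independent_ratios_of_coordinate_subspace[OF S Suc] independent_ratios_le_variety_dim by auto
  qed simp
qed

section \<open>Weights of the approximations\<close>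

lemma gr_dim_approx:
  "gr_dim X (approx X F r) i (r * m) = card {\<alpha>\<in>layer M Std m. wt M w \<alpha> = i}"
proof (cases i)
  case 0
  then show ?thesis by (simp add: gr_dim_def approx_piece dim_weight_piece)
next
  case (Suc j)
  have "{\<alpha>\<in>layer M Std m. wt M w \<alpha> \<le> Suc j}
      = {\<alpha>\<in>layer M Std m. wt M w \<alpha> \<le> j} \<union> {\<alpha>\<in>layer M Std m. wt M w \<alpha> = Suc j}" by auto
  then have "card {\<alpha>\<in>layer M Std m. wt M w \<alpha> \<le> Suc j}
      = card {\<alpha>\<in>layer M Std m. wt M w \<alpha> \<le> j} + card {\<alpha>\<in>layer M Std m. wt M w \<alpha> = Suc j}"
    using finite_Std_layer by (simp only:) (rule card_Un_disjoint; auto)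
  then show ?thesis by (simp add: gr_dim_def Suc approx_piece dim_weight_piece)
qed

text \<open>The weights of the standard monomials are the jumps of the filtration, with multiplicity.\<close>

lemma weight_approx:
  "weight X (approx X F r) (r * m) = - int (\<Sum>\<alpha>\<in>layer M Std m. wt M w \<alpha>)"
proof -
  have "(\<Sum>\<alpha>\<in>layer M Std m. wt M w \<alpha>)
      = (\<Sum>i\<in>wt M w ` layer M Std m. \<Sum>\<alpha>\<in>{\<alpha>\<in>layer M Std m. wt M w \<alpha> = i}. wt M w \<alpha>)"
    by (rule sum.image_gen[OF finite_Std_layer])
  also have "\<dots> = (\<Sum>i\<in>wt M w ` layer M Std m. i * gr_dim X (approx X F r) i (r * m))"
    by (rule sum.cong) (simp_all add: gr_dim_approx)
  also have "wt M w ` layer M Std m = {i. gr_dim X (approx X F r) i (r * m) \<noteq> 0}"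
    using finite_Std_layer by (auto simp: gr_dim_approx)
  finally show ?thesis by (simp add: weight_def sum_negf)
qed

text \<open>Summation by parts: a standard monomial of weight \<open>j\<close> is missing from exactly the \<open>j\<close> pieces below
  index \<open>j\<close>. In this form weights are compared by comparing dimensions.\<close>

lemma weight_approx_eq_dims:
  assumes "N * m \<le> L"
  shows "weight X (approx X F r) (r * m)
    = - (\<Sum>i<L. int (hilb X (r * m)) - int (fun_space.dim (approx X F r i \<inter> sections X (r * m))))"
proof -
  have wtL: "wt M w \<alpha> \<le> L" if "\<alpha> \<in> layer M Std m" for \<alpha>
    using wt_le[of \<alpha>] that assms by (simp add: layer_def)
  have "int (hilb X (r * m)) - int (fun_space.dim (approx X F r i \<inter> sections X (r * m)))
      = int (\<Sum>\<alpha>\<in>layer M Std m. if i < wt M w \<alpha> then 1 else 0)" for i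
  proof -
    have "(\<Sum>\<alpha>\<in>layer M Std m. if i < wt M w \<alpha> then 1 else 0) = card {\<alpha>\<in>layer M Std m. i < wt M w \<alpha>}"
      using finite_Std_layer by (simp add: sum.If_cases Int_def)
    moreover have "card (layer M Std m)
        = card {\<alpha>\<in>layer M Std m. wt M w \<alpha> \<le> i} + card {\<alpha>\<in>layer M Std m. i < wt M w \<alpha>}"
      using finite_Std_layer
      by (subst card_Un_disjoint[symmetric]) (auto intro!: arg_cong[where f = card])
    ultimately show ?thesis by (simp add: hilb_multiple approx_piece dim_weight_piece)
  qed
  then have "(\<Sum>i<L. int (hilb X (r * m)) - int (fun_space.dim (approx X F r i \<inter> sections X (r * m))))
      = int (\<Sum>i<L. \<Sum>\<alpha>\<in>layer M Std m. if i < wt M w \<alpha> then 1 else 0)"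
    by simp
  also have "(\<Sum>i<L. \<Sum>\<alpha>\<in>layer M Std m. if i < wt M w \<alpha> then 1 else 0)
      = (\<Sum>\<alpha>\<in>layer M Std m. \<Sum>i<L. if i < wt M w \<alpha> then 1 else 0)" by (rule sum.swap)
  also have "\<dots> = (\<Sum>\<alpha>\<in>layer M Std m. wt M w \<alpha>)"
  proof (rule sum.cong[OF refl])
    fix \<alpha> assume "\<alpha> \<in> layer M Std m"
    then have "{..<L} \<inter> {i. i < wt M w \<alpha>} = {..<wt M w \<alpha>}" using wtL[of \<alpha>] by auto
    then show "(\<Sum>i<L. if i < wt M w \<alpha> then 1 else 0) = wt M w \<alpha>" by (simp add: sum.If_cases)
  qed
  finally show ?thesis by (simp add: weight_approx)
qed

lemma weight_approx_bound: "\<bar>weight X (approx X F r) (r * m)\<bar> \<le> int (N * m * hilb X (r * m))"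
proof -
  have "(\<Sum>\<alpha>\<in>layer M Std m. wt M w \<alpha>) \<le> (\<Sum>\<alpha>\<in>layer M Std m. N * m)"
    by (rule sum_mono) (use wt_le in \<open>auto simp: layer_def\<close>)
  then have "(\<Sum>\<alpha>\<in>layer M Std m. wt M w \<alpha>) \<le> N * m * card (layer M Std m)"
    by (simp add: mult.commute)
  then show ?thesis
    by (simp only: weight_approx hilb_multiple abs_minus_cancel abs_of_nat of_nat_le_iff)
qed

lemma eventually_poly_hilb: "eventually_poly (\<lambda>m. real (hilb X (r * m)))"
  using eventually_poly_order_ideal[OF order_ideal_standard_exponents, of 1 "\<lambda>_. 0" M X f w]
  by (simp add: hilb_multiple)

lemma eventually_poly_weight: "eventually_poly (\<lambda>m. real_of_int (weight X (approx X F r) (r * m)))"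
  using eventually_poly_order_ideal[OF order_ideal_standard_exponents, of 0 "\<lambda>i. - real (w i)" M X f w]
  by (simp add: weight_approx wt_def sum_negf)

end

section \<open>Limits of subspaces\<close>

lemma act_hom: "module_hom fscale fscale (act X g)"
  by (rule module_homI) (auto simp: act_def fscale_def fun_eq_iff)

text \<open>On functions that vanish outside \<open>X\<close> the action is invertible, and so preserves dimensions.\<close>

lemma act_inverse:
  assumes "bij_betw g X X" "\<And>v. v \<notin> X \<Longrightarrow> f v = 0"
  shows "act X (inv_into X g) (act X g f) = f"
proof
  fix v
  have inv: "bij_betw (inv_into X g) X X" by (rule bij_betw_inv_into[OF assms(1)])
  show "act X (inv_into X g) (act X g f) v = f v"
  proof (cases "v \<in> X")
    case True
    have "inv_into X (inv_into X g) v \<in> X" using bij_betwE[OF bij_betw_inv_into[OF inv]] True by blast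
    moreover have "inv_into X g (inv_into X (inv_into X g) v) = v"
      using inv True by (rule bij_betw_inv_into_right)
    ultimately show ?thesis using True by (simp add: act_def)
  qed (simp add: act_def assms(2))
qed

lemma dim_act_image:
  assumes g: "bij_betw g X X" and B: "finite B" "fun_space.span B = V"
    and V: "\<And>f v. f \<in> V \<Longrightarrow> v \<notin> X \<Longrightarrow> f v = 0"
  shows "fun_space.dim (act X g ` V) = fun_space.dim V"
proof (rule antisym)
  show "fun_space.dim (act X g ` V) \<le> fun_space.dim V"
    by (rule dim_linear_image_le[OF act_hom B])
  have "act X (inv_into X g) ` act X g ` V = V"
    unfolding image_image by (subst image_cong[OF refl act_inverse[OF g V]]) simp_all
  moreover have "fun_space.span (act X g ` B) = act X g ` V"
    using module_hom.span_image[OF act_hom] B(2) by metis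
  then have "fun_space.dim (act X (inv_into X g) ` act X g ` V) \<le> fun_space.dim (act X g ` V)"
    using B(1) by (intro dim_linear_image_le[OF act_hom]) auto
  ultimately show "fun_space.dim V \<le> fun_space.dim (act X g ` V)" by simp
qed

lemma dim_is_frame: "is_frame m b W \<Longrightarrow> fun_space.dim W = m"
  unfolding is_frame_def
  by (metis card_image card_lessThan fun_space.dim_span_eq_card_independent)

lemma grassmann_limit_dim:
  assumes "grassmann_limit W W\<^sub>0"
  shows "\<forall>\<^sub>F \<tau> in at 0. fun_space.dim (W \<tau>) = fun_space.dim W\<^sub>0"
proof -
  obtain m b b\<^sub>0 where "is_frame m b\<^sub>0 W\<^sub>0" "\<forall>\<^sub>F \<tau> in at 0. is_frame m (b \<tau>) (W \<tau>)"
    using assms unfolding grassmann_limit_def by blast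
  then show ?thesis by (auto simp: dim_is_frame elim: eventually_mono)
qed

text \<open>Use the coordinates of \<open>x\<close> with respect to the limit frame in the converging frames.\<close>

lemma grassmann_limit_approach:
  assumes "grassmann_limit W W\<^sub>0" "x \<in> W\<^sub>0"
  shows "\<exists>u. (\<forall>\<^sub>F \<tau> in at 0. u \<tau> \<in> W \<tau>) \<and> (\<forall>v. ((\<lambda>\<tau>. u \<tau> v) \<longlongrightarrow> x v) (at 0))"
proof -
  obtain m b b\<^sub>0 where fr: "is_frame m b\<^sub>0 W\<^sub>0" "\<forall>\<^sub>F \<tau> in at 0. is_frame m (b \<tau>) (W \<tau>)"
    and lim: "\<And>j v. j < m \<Longrightarrow> ((\<lambda>\<tau>. b \<tau> j v) \<longlongrightarrow> b\<^sub>0 j v) (at 0)"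
    using assms(1) unfolding grassmann_limit_def by blast
  have "x \<in> fun_space.span (b\<^sub>0 ` {..<m})" using fr(1) assms(2) by (simp add: is_frame_def)
  then obtain a where a: "x = (\<Sum>y\<in>b\<^sub>0 ` {..<m}. fscale (a y) y)"
    by (subst (asm) fun_space.span_finite) auto
  have x: "x v = (\<Sum>j<m. a (b\<^sub>0 j) * b\<^sub>0 j v)" for v
    using fr(1) by (simp add: a sum.reindex is_frame_def sum_fun_apply fscale_def)
  define u where "u \<tau> = (\<Sum>j<m. fscale (a (b\<^sub>0 j)) (b \<tau> j))" for \<tau>
  have "\<forall>\<^sub>F \<tau> in at 0. u \<tau> \<in> W \<tau>"
    using fr(2)
  proof eventually_elim
    case (elim \<tau>)
    have "u \<tau> \<in> fun_space.span (b \<tau> ` {..<m})"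
      unfolding u_def by (auto intro!: fun_space.span_sum fun_space.span_scale intro: fun_space.span_base)
    then show ?case using elim by (simp add: is_frame_def)
  qed
  moreover have "((\<lambda>\<tau>. u \<tau> v) \<longlongrightarrow> x v) (at 0)" for v
    unfolding x u_def sum_fun_apply fscale_def by (intro tendsto_intros lim) simp
  ultimately show ?thesis by blast
qed

lemma monomial_act:
  assumes "bij_betw g X X" "v \<in> X"
  shows "monomial X M (\<lambda>j. act X g (y j)) \<alpha> v = monomial X M y \<alpha> (inv_into X g v)"
proof -
  have "inv_into X g v \<in> X" using bij_betwE[OF bij_betw_inv_into[OF assms(1)]] assms(2) by blast
  then show ?thesis using assms(2) by (simp add: monomial_def act_def)
qed

text \<open>The approximation of the limit filtration is spanned by products of limits, and these are limits
  of products. So a basis of standard monomials for the limit stays independent when it is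
  moved into a translate of the approximation of the original filtration.\<close>

lemma dim_approx_limit_le:
  assumes gens: "weighted_generators X F r M f w"
    and gensbar: "weighted_generators X Fbar r Mbar fbar wbar"
    and aut: "\<And>\<tau>. \<tau> \<noteq> 0 \<Longrightarrow> bij_betw (g \<tau>) X X"
    and lim: "\<And>i. grassmann_limit (\<lambda>\<tau>. act X (g \<tau>) ` (F i \<inter> sections X r)) (Fbar i \<inter> sections X r)"
  shows "fun_space.dim (approx X Fbar r i \<inter> sections X (r * m))
       \<le> fun_space.dim (approx X F r i \<inter> sections X (r * m))"
proof -
  interpret A: weighted_generators X F r M f w by (rule gens)
  interpret B: weighted_generators X Fbar r Mbar fbar wbar by (rule gensbar)
  have "\<forall>j\<in>{..<Mbar}. \<exists>u. (\<forall>\<^sub>F \<tau> in at 0. u \<tau> \<in> act X (g \<tau>) ` (F (wbar j) \<inter> sections X r)) \<and>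
      (\<forall>v. ((\<lambda>\<tau>. u \<tau> v) \<longlongrightarrow> fbar j v) (at 0))"
  proof
    fix j assume "j \<in> {..<Mbar}"
    then have "fbar j \<in> Fbar (wbar j) \<inter> sections X r" using B.gen by simp
    then show "\<exists>u. (\<forall>\<^sub>F \<tau> in at 0. u \<tau> \<in> act X (g \<tau>) ` (F (wbar j) \<inter> sections X r)) \<and>
      (\<forall>v. ((\<lambda>\<tau>. u \<tau> v) \<longlongrightarrow> fbar j v) (at 0))"
      by (rule grassmann_limit_approach[OF lim])
  qed
  then obtain u where
    u: "\<And>j. j < Mbar \<Longrightarrow> \<forall>\<^sub>F \<tau> in at 0. u j \<tau> \<in> act X (g \<tau>) ` (F (wbar j) \<inter> sections X r)"
    and u_lim: "\<And>j v. j < Mbar \<Longrightarrow> ((\<lambda>\<tau>. u j \<tau> v) \<longlongrightarrow> fbar j v) (at 0)"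
    unfolding bchoice_iff by (auto simp: Ball_def)
  define U where "U = {\<alpha>\<in>layer Mbar B.Std m. wt Mbar wbar \<alpha> \<le> i}"
  have U: "finite U" using B.finite_Std_layer by (simp add: U_def)
  have "independent_family U B.mon"
    by (rule independent_family_subset[OF independent_standard_monomials _ B.finite_Std_layer])
       (auto simp: U_def)
  moreover have "((\<lambda>\<tau>. monomial X Mbar (\<lambda>j. u j \<tau>) \<alpha> v) \<longlongrightarrow> B.mon \<alpha> v) (at 0)" for \<alpha> v
    unfolding monomial_def by (cases "v \<in> X") (auto intro!: tendsto_prod tendsto_power u_lim)
  ultimately have "\<forall>\<^sub>F \<tau> in at 0. independent_family U (monomial X Mbar (\<lambda>j. u j \<tau>))"
    by (intro independent_family_eventually[OF U])
  moreover have "\<forall>\<^sub>F \<tau> in at 0. \<forall>j\<in>{..<Mbar}. u j \<tau> \<in> act X (g \<tau>) ` (F (wbar j) \<inter> sections X r)"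
    by (rule eventually_ball_finite) (use u in auto)
  moreover have "\<forall>\<^sub>F \<tau> in at 0. \<tau> \<noteq> (0::complex)" by (simp add: eventually_at_filter)
  ultimately have "\<forall>\<^sub>F \<tau> in at (0::complex). independent_family U (monomial X Mbar (\<lambda>j. u j \<tau>)) \<and>
      (\<forall>j\<in>{..<Mbar}. u j \<tau> \<in> act X (g \<tau>) ` (F (wbar j) \<inter> sections X r)) \<and> \<tau> \<noteq> 0"
    by eventually_elim simp
  then obtain \<tau> where ind: "independent_family U (monomial X Mbar (\<lambda>j. u j \<tau>))"
    and mem: "\<forall>j\<in>{..<Mbar}. u j \<tau> \<in> act X (g \<tau>) ` (F (wbar j) \<inter> sections X r)" and "\<tau> \<noteq> 0"
    using eventually_happens'[OF at_neq_bot] by blast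
  note bij = aut[OF \<open>\<tau> \<noteq> 0\<close>]
  have "\<forall>j\<in>{..<Mbar}. \<exists>y. y \<in> F (wbar j) \<inter> sections X r \<and> u j \<tau> = act X (g \<tau>) y"
    using mem by blast
  then obtain y where y: "\<And>j. j < Mbar \<Longrightarrow> y j \<in> F (wbar j) \<inter> sections X r"
    "\<And>j. j < Mbar \<Longrightarrow> u j \<tau> = act X (g \<tau>) (y j)"
    unfolding bchoice_iff by (auto simp: Ball_def)
  have mon_u: "monomial X Mbar (\<lambda>j. u j \<tau>) \<alpha> v = monomial X Mbar y \<alpha> (inv_into X (g \<tau>) v)"
    if "v \<in> X" for \<alpha> v
  proof -
    have "monomial X Mbar (\<lambda>j. u j \<tau>) \<alpha> v = monomial X Mbar (\<lambda>j. act X (g \<tau>) (y j)) \<alpha> v"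
      by (simp add: monomial_def y(2))
    then show ?thesis using monomial_act[OF bij that] by simp
  qed
  have "independent_family U (monomial X Mbar y)"
    unfolding independent_family_def
  proof (intro allI impI)
    fix c assume 0: "\<forall>x. (\<Sum>\<alpha>\<in>U. c \<alpha> * monomial X Mbar y \<alpha> x) = 0"
    have "(\<Sum>\<alpha>\<in>U. c \<alpha> * monomial X Mbar (\<lambda>j. u j \<tau>) \<alpha> v) = 0" for v
      using 0 by (cases "v \<in> X") (simp_all add: mon_u, simp add: monomial_def)
    then show "\<forall>\<alpha>\<in>U. c \<alpha> = 0" using ind unfolding independent_family_def by blast
  qed
  moreover have "monomial X Mbar y ` U \<subseteq> A.piece m i"
  proof (rule image_subsetI)
    fix \<alpha> assume \<alpha>: "\<alpha> \<in> U"
    have "monomial X Mbar y \<alpha> \<in> A.piece (mdeg Mbar \<alpha>) (wt Mbar wbar \<alpha>)"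
      by (rule weight_piece_monomial) (use y(1) A.piece_1 in auto)
    then show "monomial X Mbar y \<alpha> \<in> A.piece m i"
      using \<alpha> weight_piece_mono[of "wt Mbar wbar \<alpha>" i X M f w m] by (auto simp: U_def layer_def)
  qed
  ultimately have "card U \<le> fun_space.dim (A.piece m i)"
    unfolding weight_piece_def
    by (intro independent_family_le_dim U finite_imageI)
       (auto intro: finite_subset[OF _ finite_layer_exponents[of M m]])
  then show ?thesis by (simp add: A.approx_piece B.approx_piece dim_weight_piece[of X Mbar] U_def)
qed

section \<open>Comparison of Chow weights\<close>

text \<open>The weights in degree \<open>r\<close> agree, and those in degree \<open>r m\<close> decrease. Both weights are at most
  a multiple of \<open>m h(r m)\<close> in absolute value, so the difference of their polynomials has degree at
  most \<open>n + 1\<close> and a non-negative coefficient there.\<close>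

lemma chow_weight_limit_le:
  fixes X :: "(complex^'n::finite) set"
  assumes X: "polarised_variety X" and F: "filtration X F" and Fbar: "filtration X Fbar" and r: "r \<ge> 1"
    and aut: "\<And>\<tau>. \<tau> \<noteq> 0 \<Longrightarrow> bij_betw (g \<tau>) X X"
    and lim: "\<And>i. grassmann_limit (\<lambda>\<tau>. act X (g \<tau>) ` (F i \<inter> sections X r)) (Fbar i \<inter> sections X r)"
  shows "chow_weight X (approx X Fbar r) r \<le> chow_weight X (approx X F r) r"
proof -
  interpret polarised_cone X by unfold_locales (rule X)
  obtain M f w where "weighted_generators X F r M f w"
    using weighted_generators_exist[OF F r] by blast
  then interpret A: weighted_generators X F r M f w .
  obtain Mb fb wb where "weighted_generators X Fbar r Mb fb wb"
    using weighted_generators_exist[OF Fbar r] by blast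
  then interpret B: weighted_generators X Fbar r Mb fb wb .
  let ?w = "\<lambda>k. weight X (approx X F r) k" and ?wb = "\<lambda>k. weight X (approx X Fbar r) k"
  have dim_eq: "fun_space.dim (Fbar i \<inter> sections X r) = fun_space.dim (F i \<inter> sections X r)" for i
  proof -
    obtain S where S: "finite S" "fun_space.span S = F i \<inter> sections X r"
      by (rule finite_spanning_set[OF subspace_filtration_piece[OF F, of i r] inf_le2])
    have "\<forall>\<^sub>F \<tau> in at (0::complex). \<tau> \<noteq> 0" by (simp add: eventually_at_filter)
    with grassmann_limit_dim[OF lim[of i]]
    have "\<forall>\<^sub>F \<tau> in at (0::complex). fun_space.dim (Fbar i \<inter> sections X r) = fun_space.dim (F i \<inter> sections X r)"
    proof eventually_elim
      case (elim \<tau>)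
      have "fun_space.dim (act X (g \<tau>) ` (F i \<inter> sections X r)) = fun_space.dim (F i \<inter> sections X r)"
        by (rule dim_act_image[OF aut[OF elim(2)] S]) (use sections_vanish in blast)
      then show ?case using elim(1) by simp
    qed
    then show ?thesis by simp
  qed
  have weight_r: "?wb r = ?w r"
  proof -
    define L where "L = max A.N B.N"
    have "approx X F r i \<inter> sections X (r * 1) = F i \<inter> sections X r"
      "approx X Fbar r i \<inter> sections X (r * 1) = Fbar i \<inter> sections X r" for i
      by (simp_all only: A.approx_piece B.approx_piece A.piece_1 B.piece_1)
    then have "?wb (r * 1) = ?w (r * 1)"
      using A.weight_approx_eq_dims[of 1 L] B.weight_approx_eq_dims[of 1 L] dim_eq
      by (simp add: L_def)
    then show ?thesis by simp
  qed
  have weight_le: "?wb (r * m) \<le> ?w (r * m)" for m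
  proof -
    define L where "L = max (A.N * m) (B.N * m)"
    have "fun_space.dim (approx X Fbar r i \<inter> sections X (r * m))
       \<le> fun_space.dim (approx X F r i \<inter> sections X (r * m))" for i
      by (rule dim_approx_limit_le[OF A.weighted_generators_axioms B.weighted_generators_axioms aut lim])
    then have "(\<Sum>i<L. int (hilb X (r * m)) - int (fun_space.dim (approx X F r i \<inter> sections X (r * m))))
        \<le> (\<Sum>i<L. int (hilb X (r * m)) - int (fun_space.dim (approx X Fbar r i \<inter> sections X (r * m))))"
      by (intro sum_mono) simp
    then show ?thesis
      using A.weight_approx_eq_dims[of m L] B.weight_approx_eq_dims[of m L] by (simp add: L_def)
  qed
  define n where "n = variety_dim X"
  obtain c where c: "\<And>m. hilb X (r * m) \<le> c * (m + 1) ^ n"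
    using A.hilb_growth unfolding n_def by blast
  define H where "H = eventual_poly r (\<lambda>k. real (hilb X k))"
  define P where "P = eventual_poly r (\<lambda>k. real_of_int (?w k))"
  define Pb where "Pb = eventual_poly r (\<lambda>k. real_of_int (?wb k))"
  have H: "\<forall>\<^sub>F m in sequentially. real (hilb X (r * m)) = poly H (real (r * m))"
    unfolding H_def by (rule eventual_poly_on_multiples[OF r A.eventually_poly_hilb])
  have P: "\<forall>\<^sub>F m in sequentially. real_of_int (?w (r * m)) = poly P (real (r * m))"
    unfolding P_def by (rule eventual_poly_on_multiples[OF r A.eventually_poly_weight])
  have Pb: "\<forall>\<^sub>F m in sequentially. real_of_int (?wb (r * m)) = poly Pb (real (r * m))"
    unfolding Pb_def by (rule eventual_poly_on_multiples[OF r B.eventually_poly_weight])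
  have hilb_le: "real (hilb X (r * m)) \<le> real c * (real m + 1) ^ n" for m
  proof -
    have "real (hilb X (r * m)) \<le> real (c * (m + 1) ^ n)" using c by (simp only: of_nat_le_iff)
    then show ?thesis by (simp add: add.commute)
  qed
  have a0: "0 \<le> coeff H n"
  proof (rule coeff_nonneg_on_multiples[OF r])
    show "\<forall>\<^sub>F m in sequentially. \<bar>poly H (real (r * m))\<bar> \<le> real c * (real m + 1) ^ n"
      using H
    proof eventually_elim
      case (elim m)
      show ?case unfolding elim[symmetric] using hilb_le[of m] by simp
    qed
    show "\<forall>\<^sub>F m in sequentially. 0 \<le> poly H (real (r * m))"
      using H
    proof eventually_elim
      case (elim m)
      show ?case unfolding elim[symmetric] by simp
    qed
  qed
  have "0 \<le> coeff (P - Pb) (n + 1)"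
  proof (rule coeff_nonneg_on_multiples[OF r])
    show "\<forall>\<^sub>F m in sequentially. \<bar>poly (P - Pb) (real (r * m))\<bar>
        \<le> real (A.N + B.N) * real c * (real m + 1) ^ (n + 1)"
      using P Pb
    proof eventually_elim
      case (elim m)
      have "\<bar>?w (r * m)\<bar> + \<bar>?wb (r * m)\<bar> \<le> int ((A.N + B.N) * m * hilb X (r * m))"
        using A.weight_approx_bound[of m] B.weight_approx_bound[of m] by (simp add: algebra_simps)
      then have "real_of_int (\<bar>?w (r * m)\<bar> + \<bar>?wb (r * m)\<bar>)
          \<le> real_of_int (int ((A.N + B.N) * m * hilb X (r * m)))"
        by (simp only: of_int_le_iff)
      also have "\<dots> = real (A.N + B.N) * real m * real (hilb X (r * m))" by simp
      also have "\<dots> \<le> real (A.N + B.N) * (real m + 1) * (real c * (real m + 1) ^ n)"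
        by (intro mult_mono hilb_le) auto
      finally have "real_of_int (\<bar>?w (r * m)\<bar> + \<bar>?wb (r * m)\<bar>)
          \<le> real (A.N + B.N) * real c * (real m + 1) ^ (n + 1)" by (simp add: mult_ac)
      moreover have "\<bar>real_of_int (?w (r * m)) - real_of_int (?wb (r * m))\<bar>
          \<le> real_of_int (\<bar>?w (r * m)\<bar> + \<bar>?wb (r * m)\<bar>)" by simp
      ultimately show ?case unfolding poly_diff elim[symmetric] by linarith
    qed
    show "\<forall>\<^sub>F m in sequentially. 0 \<le> poly (P - Pb) (real (r * m))"
      using P Pb
    proof eventually_elim
      case (elim m)
      show ?case unfolding poly_diff elim[symmetric] using weight_le[of m] by simp
    qed
  qed
  then have "coeff Pb (n + 1) / coeff H n \<le> coeff P (n + 1) / coeff H n"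
    using a0 by (intro divide_right_mono) simp_all
  then have "real r * (coeff Pb (n + 1) / coeff H n) \<le> real r * (coeff P (n + 1) / coeff H n)"
    by (rule mult_left_mono) simp
  then show ?thesis
    unfolding chow_weight_def Let_def weight_r
    by (simp only: H_def P_def Pb_def n_def diff_right_mono)
qed

theorem theorem27:
  fixes X :: "(complex^'n::finite) set"
    and d :: nat
    and \<rho> :: "(nat \<Rightarrow> complex) \<Rightarrow> complex^'n \<Rightarrow> complex^'n"
    and \<gamma> :: "complex \<Rightarrow> nat \<Rightarrow> complex"
    and F Fbar :: "nat \<Rightarrow> 'n sect set"
  assumes "polarised_variety X"
    and "filtration X F"
    and "torus_in_Aut X d \<rho>"
    and "one_parameter_subgroup d \<gamma>"
    and "is_specialisation X d \<rho> \<gamma> F Fbar"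
  shows "chow_infinity X Fbar \<le> chow_infinity X F"
  unfolding chow_infinity_def
proof (rule Liminf_mono, unfold eventually_sequentially, intro exI[of _ 1] allI impI)
  fix r :: nat assume r: "1 \<le> r"
  have "bij_betw (\<rho> (\<gamma> \<tau>)) X X" if "\<tau> \<noteq> 0" for \<tau>
    using assms(3,4) that
    by (simp add: torus_in_Aut_def one_parameter_subgroup_def automorphism_with_lift_def)
  moreover have "filtration X Fbar"
    "\<And>i. grassmann_limit (\<lambda>\<tau>. act X (\<rho> (\<gamma> \<tau>)) ` (F i \<inter> sections X r)) (Fbar i \<inter> sections X r)"
    using assms(5) by (simp_all add: is_specialisation_def)
  ultimately show "ereal (chow_weight X (approx X Fbar r) r) \<le> ereal (chow_weight X (approx X F r) r)"
    using chow_weight_limit_le[OF assms(1,2) _ r, of Fbar "\<lambda>\<tau>. \<rho> (\<gamma> \<tau>)"] by simp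
qed

end
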